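(* Let $G$ be a finite group, $s\in G$, $\mathcal{O}$ the conjugacy class of $s$ in $G$, and $\rho:G^s\to GL(V)$ an irreducible complex representation of the centralizer $G^s$ such that $\dim\mathfrak{B}(\mathcal{O},\rho)<\infty$. Assume that there exists an integer $j$ such that $s^j\neq s$ and $s^j\in\mathcal{O}$. (a) If $\deg\rho>1$, then $s$ has even order and $q_{ss}=-1$. (b) If $\deg\rho=1$, then either $s$ has even order and $q_{ss}=-1$, or $q_{ss}\in\mathbb{G}_3\setminus\{1\}$.
   Context: $\mathbb{G}_3$ is the group of cube roots of $1$ in $\mathbb{C}$; $\deg\rho=\dim V$. Let $G$ be a finite group, $s\in G$, $\mathcal{O}$ the conjugacy class of $s$ in $G$, $G^s$ the centralizer of $s$ in $G$, and $\rho:G^s\to GL(V)$ an irreducible complex representation. Since $s$ is central in $G^s$, by Schur's Lemma $\rho(s)$ is a scalar, denoted $q_{ss}$. List $\mathcal{O}=\{t_1=s,\dots,t_M\}$ and choose $g_i\in G$ with $g_isg_i^{-1}=t_i$. The irreducible Yetter-Drinfeld module $M(\mathcal{O},\rho)=\bigoplus_{i=1}^M g_i\otimes V$ over $\mathbb{C}G$ has, writing $g_iv:=g_i\otimes v$, coaction $\delta(g_iv)=t_i\otimes g_iv$ and action $g\cdot(g_iv)=g_j(\gamma\cdot v)$, where $gg_i=g_j\gamma$ with $\gamma\in G^s$. It is a braided vector space with braiding $c(g_iv\otimes g_jw)=t_i\cdot(g_jw)\otimes g_iv$. $\mathfrak{B}(\mathcal{O},\rho)$ denotes the Nichols algebra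 of this braided vector space. *)

theory Defs
  imports Complex_Main "HOL-Algebra.Algebra" "HOL-Combinatorics.Permutations"
    "HOL-Library.Poly_Mapping" "HOL-Library.Function_Algebras"
begin

section \<open>Tensor algebra of a complex vector space\<close>

text \<open>
  A complex vector space is a subset \<open>M\<close> of a type \<open>'m\<close> that is a subspace for a scaling
  \<open>sc\<close>. Its tensor algebra is the complex vector space freely spanned by the words over \<open>M\<close>
  (the word \<open>[x1, ..., xn]\<close> stands for \<open>x1 \<otimes> ... \<otimes> xn\<close>) modulo the subspace of
  multilinearity relations. All elements of type \<open>'m tens\<close> below are representatives modulo
  that subspace.
\<close>

type_synonym 'm tens = "'m list \<Rightarrow>\<^sub>0 complex"

definition tscale :: "complex \<Rightarrow> 'm tens \<Rightarrow> 'm tens" where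
  "tscale a p = Poly_Mapping.map ((*) a) p"

lemma lookup_tscale: "Poly_Mapping.lookup (tscale a p) w = a * Poly_Mapping.lookup p w"
  unfolding tscale_def by (simp add: Poly_Mapping.map.rep_eq when_def)

interpretation tens: vector_space "tscale :: complex \<Rightarrow> 'm tens \<Rightarrow> 'm tens"
  by unfold_locales
    (auto intro!: poly_mapping_eqI simp: lookup_tscale Poly_Mapping.lookup_add algebra_simps)

definition word :: "'m list \<Rightarrow> 'm tens" where
  "word w = Poly_Mapping.single w 1"

definition lin_ext :: "('m list \<Rightarrow> 'm tens) \<Rightarrow> 'm tens \<Rightarrow> 'm tens" where
  "lin_ext f p = (\<Sum>w\<in>Poly_Mapping.keys p. tscale (Poly_Mapping.lookup p w) (f w))"

definition free_tens :: "'m set \<Rightarrow> 'm tens set" where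
  "free_tens M = tens.span (word ` lists M)"

definition tens_rel :: "(complex \<Rightarrow> 'm \<Rightarrow> 'm) \<Rightarrow> 'm::ab_group_add set \<Rightarrow> 'm tens set" where
  "tens_rel sc M = tens.span
     ({word (u @ [x + y] @ v) - word (u @ [x] @ v) - word (u @ [y] @ v) | u v x y.
         u \<in> lists M \<and> v \<in> lists M \<and> x \<in> M \<and> y \<in> M} \<union>
      {word (u @ [sc a x] @ v) - tscale a (word (u @ [x] @ v)) | a u v x.
         u \<in> lists M \<and> v \<in> lists M \<and> x \<in> M})"


section \<open>Quantum symmetrizers and the Nichols algebra\<close>

text \<open>
  Words \<open>[i1, ..., il]\<close> in the adjacent transpositions \<open>(i i+1)\<close>, positions counted from \<open>0\<close>.
  Such a word for a permutation of \<open>{..<n}\<close> is reduced iff its length is the Coxeter length, i.e. the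
  number of inversions. By Matsumoto's theorem and the braid equation, the operator
  \<open>braid_perm c n \<pi>\<close> below does not depend on the chosen reduced word (modulo
  \<open>tens_rel\<close>).
\<close>

definition perm_of_word :: "nat list \<Rightarrow> nat \<Rightarrow> nat" where
  "perm_of_word is = foldr (\<lambda>i \<pi>. Transposition.transpose i (Suc i) \<circ> \<pi>) is id"

definition inversions :: "nat \<Rightarrow> (nat \<Rightarrow> nat) \<Rightarrow> (nat \<times> nat) set" where
  "inversions n \<pi> = {(i, j). i < j \<and> j < n \<and> \<pi> j < \<pi> i}"

definition is_reduced_word :: "nat \<Rightarrow> (nat \<Rightarrow> nat) \<Rightarrow> nat list \<Rightarrow> bool" where
  "is_reduced_word n \<pi> is \<longleftrightarrow>
     (\<forall>i\<in>set is. Suc i < n) \<and> perm_of_word is = \<pi> \<and> length is = card (inversions n \<pi>)"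

lemma reduced_word_exists:
  assumes "\<pi> permutes {..<n}"
  shows "\<exists>is. is_reduced_word n \<pi> is"
  using assms
proof (induction "card (inversions n \<pi>)" arbitrary: \<pi> rule: less_induct)
  case less
  define \<sigma> where "\<sigma> = inv_into UNIV \<pi>"
  have perm: "\<sigma> permutes {..<n}"
    using less.prems by (simp add: \<sigma>_def permutes_inv)
  have \<pi>\<sigma> [simp]: "\<pi> (\<sigma> k) = k" and \<sigma>\<pi> [simp]: "\<sigma> (\<pi> k) = k" for k
    using less.prems by (simp_all add: \<sigma>_def permutes_inverses)
  have inj: "\<pi> a = \<pi> b \<longleftrightarrow> a = b" for a b
    by (metis \<sigma>\<pi>)
  have fin: "finite (inversions n \<rho>)" for \<rho>
    by (rule finite_subset[of _ "{..<n} \<times> {..<n}"]) (auto simp: inversions_def)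
  show ?case
  proof (cases "\<exists>i. Suc i < n \<and> \<sigma> (Suc i) < \<sigma> i")
    case False
    have "Suc i < n \<Longrightarrow> \<sigma> i < \<sigma> (Suc i)" for i
      using False by (metis \<pi>\<sigma> n_not_Suc_n linorder_neqE_nat)
    then have "i < n \<Longrightarrow> i \<le> \<sigma> i" for i
      by (induction i) (auto simp: less_eq_Suc_le intro: order_trans dest: Suc_lessD)
    then have "\<sigma> = id"
      using permutes_natset_ge[OF perm] by simp
    then have "\<pi> = id"
      by (metis \<pi>\<sigma> id_apply eq_id_iff)
    moreover have "inversions n id = {}"
      by (auto simp: inversions_def)
    ultimately have "is_reduced_word n \<pi> []"
      by (simp add: is_reduced_word_def perm_of_word_def)
    then show ?thesis by blast
  next
    case True
    then obtain i where i: "Suc i < n" "\<sigma> (Suc i) < \<sigma> i" by blast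
    define \<tau> where "\<tau> = Transposition.transpose i (Suc i) \<circ> \<pi>"
    have \<tau>: "\<tau> permutes {..<n}"
      unfolding \<tau>_def using i(1) less.prems by (intro permutes_compose permutes_swap_id) auto
    have lt: "\<sigma> i < n"
      using perm i(1) by (metis Suc_lessD lessThan_iff permutes_in_image)
    have "inversions n \<pi> = insert (\<sigma> (Suc i), \<sigma> i) (inversions n \<tau>)"
    proof (rule Set.set_eqI)
      fix p :: "nat \<times> nat"
      obtain a b where p: "p = (a, b)"
        by (cases p)
      have less_swap: "\<pi> b < \<pi> a \<longleftrightarrow> (\<tau> b < \<tau> a) \<noteq> ({\<pi> a, \<pi> b} = {i, Suc i})" if "a < b"
        using that inj[of a b]
        by (simp add: \<tau>_def Transposition.transpose_def doubleton_eq_iff) linarith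
      have mem: "{\<pi> a, \<pi> b} = {i, Suc i} \<longleftrightarrow> (a, b) = (\<sigma> (Suc i), \<sigma> i)" if "a < b"
        using that i(2) by (metis \<pi>\<sigma> \<sigma>\<pi> doubleton_eq_iff not_less_iff_gr_or_eq prod.inject)
      show "p \<in> inversions n \<pi> \<longleftrightarrow> p \<in> insert (\<sigma> (Suc i), \<sigma> i) (inversions n \<tau>)"
      proof (cases "p = (\<sigma> (Suc i), \<sigma> i)")
        case True
        then show ?thesis
          using i lt by (simp add: inversions_def)
      next
        case False
        then show ?thesis
          using less_swap mem by (auto simp: inversions_def p)
      qed
    qed
    moreover have "(\<sigma> (Suc i), \<sigma> i) \<notin> inversions n \<tau>"
      by (auto simp: inversions_def \<tau>_def)
    ultimately have card: "card (inversions n \<pi>) = Suc (card (inversions n \<tau>))"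
      using fin by simp
    then obtain "is" where "is": "is_reduced_word n \<tau> is"
      using less.hyps[of \<tau>] \<tau> by auto
    have "Transposition.transpose i (Suc i) \<circ> \<tau> = \<pi>"
      by (simp add: \<tau>_def flip: comp_assoc)
    then have "is_reduced_word n \<pi> (i # is)"
      using "is" i card by (simp add: is_reduced_word_def perm_of_word_def)
    then show ?thesis by blast
  qed
qed

text \<open>
  A braiding \<open>c : M \<otimes> M \<rightarrow> M \<otimes> M\<close> is given by representatives \<open>c x y\<close> of
  \<open>c (x \<otimes> y)\<close>; \<open>braid_at c i\<close> is \<open>id \<otimes> c \<otimes> id\<close> acting in positions \<open>i\<close> and \<open>i + 1\<close>.
\<close>

definition braid_at :: "('m \<Rightarrow> 'm \<Rightarrow> 'm tens) \<Rightarrow> nat \<Rightarrow> 'm tens \<Rightarrow> 'm tens" where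
  "braid_at c i = lin_ext (\<lambda>w.
     lin_ext (\<lambda>u. word (take i w @ u @ drop (i + 2) w)) (c (w ! i) (w ! (i + 1))))"

definition braid_perm ::
  "('m \<Rightarrow> 'm \<Rightarrow> 'm tens) \<Rightarrow> nat \<Rightarrow> (nat \<Rightarrow> nat) \<Rightarrow> 'm tens \<Rightarrow> 'm tens" where
  "braid_perm c n \<pi> = foldr (\<lambda>i f. braid_at c i \<circ> f) (SOME is. is_reduced_word n \<pi> is) id"

text \<open>On words of length \<open>n\<close> this is the quantum symmetrizer of degree \<open>n\<close>.\<close>

definition quantum_symmetrizer :: "('m \<Rightarrow> 'm \<Rightarrow> 'm tens) \<Rightarrow> 'm tens \<Rightarrow> 'm tens" where
  "quantum_symmetrizer c = lin_ext (\<lambda>w.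
     \<Sum>\<pi> | \<pi> permutes {..<length w}. braid_perm c (length w) \<pi> (word w))"

text \<open>
  The Nichols algebra is the tensor algebra modulo the kernel of the sum of all quantum symmetrizers,
  that is, the quotient of \<open>free_tens M\<close> by \<open>nichols_ideal\<close>. The ideal contains
  \<open>tens_rel sc M\<close>. The dimension only involves the underlying vector space of this quotient.
\<close>

definition nichols_ideal ::
  "(complex \<Rightarrow> 'm \<Rightarrow> 'm) \<Rightarrow> 'm::ab_group_add set \<Rightarrow> ('m \<Rightarrow> 'm \<Rightarrow> 'm tens) \<Rightarrow> 'm tens set" where
  "nichols_ideal sc M c = {p \<in> free_tens M. quantum_symmetrizer c p \<in> tens_rel sc M}"

definition nichols_finite_dim ::
  "(complex \<Rightarrow> 'm \<Rightarrow> 'm) \<Rightarrow> 'm::ab_group_add set \<Rightarrow> ('m \<Rightarrow> 'm \<Rightarrow> 'm tens) \<Rightarrow> bool" where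
  "nichols_finite_dim sc M c \<longleftrightarrow>
     (\<exists>F. finite F \<and> F \<subseteq> free_tens M \<and> free_tens M \<subseteq> tens.span (F \<union> nichols_ideal sc M c))"


section \<open>Representations\<close>

definition conj_class :: "('g, 'b) monoid_scheme \<Rightarrow> 'g \<Rightarrow> 'g set" where
  "conj_class G s = {g \<otimes>\<^bsub>G\<^esub> s \<otimes>\<^bsub>G\<^esub> inv\<^bsub>G\<^esub> g | g. g \<in> carrier G}"

definition centralizer :: "('g, 'b) monoid_scheme \<Rightarrow> 'g \<Rightarrow> 'g set" where
  "centralizer G s = {h \<in> carrier G. h \<otimes>\<^bsub>G\<^esub> s = s \<otimes>\<^bsub>G\<^esub> h}"

definition GL :: "(complex \<Rightarrow> 'v \<Rightarrow> 'v) \<Rightarrow> ('v::ab_group_add \<Rightarrow> 'v) monoid" where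
  "GL scale = \<lparr>carrier = {f. Vector_Spaces.linear scale scale f \<and> bij f}, monoid.mult = (\<circ>), one = id\<rparr>"

definition irreducible_rep ::
  "('g, 'b) monoid_scheme \<Rightarrow> (complex \<Rightarrow> 'v \<Rightarrow> 'v) \<Rightarrow> ('g \<Rightarrow> 'v::ab_group_add \<Rightarrow> 'v) \<Rightarrow> bool" where
  "irreducible_rep H scale \<rho> \<longleftrightarrow>
     vector_space scale \<and> \<rho> \<in> hom H (GL scale) \<and> (UNIV :: 'v set) \<noteq> {0} \<and>
     (\<forall>W. module.subspace scale W \<and> (\<forall>h\<in>carrier H. \<rho> h ` W \<subseteq> W) \<longrightarrow> W = {0} \<or> W = UNIV)"

definition q_scalar :: "(complex \<Rightarrow> 'v \<Rightarrow> 'v) \<Rightarrow> ('g \<Rightarrow> 'v \<Rightarrow> 'v) \<Rightarrow> 'g \<Rightarrow> complex" where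
  "q_scalar scale \<rho> s = (THE q. \<forall>v. \<rho> s v = scale q v)"


section \<open>The Yetter-Drinfeld module of a conjugacy class and a representation\<close>

text \<open>
  Given a family \<open>r\<close> with \<open>r t \<in> G\<close> and \<open>r t s (r t)\<inverse> = t\<close> for \<open>t\<close> in the class, the sum over \<open>t\<close>
  of the spaces \<open>r t \<otimes> V\<close> is realised by the functions from the class to \<open>V\<close> extended by zero:
  \<open>f\<close> represents the sum of the \<open>r t \<otimes> f t\<close>.
\<close>

definition yd_space :: "('g, 'b) monoid_scheme \<Rightarrow> 'g \<Rightarrow> ('g \<Rightarrow> 'v::ab_group_add) set" where
  "yd_space G s = {f. \<forall>t. t \<notin> conj_class G s \<longrightarrow> f t = 0}"

definition yd_scale :: "(complex \<Rightarrow> 'v \<Rightarrow> 'v) \<Rightarrow> complex \<Rightarrow> ('g \<Rightarrow> 'v) \<Rightarrow> 'g \<Rightarrow> 'v" where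
  "yd_scale scale a f = (\<lambda>t. scale a (f t))"

definition yd_elem :: "'g \<Rightarrow> 'v::ab_group_add \<Rightarrow> 'g \<Rightarrow> 'v" where
  "yd_elem t v = (\<lambda>u. if u = t then v else 0)"

text \<open>
  For \<open>h \<in> G\<close> and \<open>t' = h t h\<inverse>\<close> one has \<open>h (r t) = (r t') \<gamma>\<close> with
  \<open>\<gamma> = (r t')\<inverse> h (r t)\<close> in the centralizer of \<open>s\<close>.
\<close>

definition yd_action ::
  "('g, 'b) monoid_scheme \<Rightarrow> 'g \<Rightarrow> ('g \<Rightarrow> 'v::ab_group_add \<Rightarrow> 'v) \<Rightarrow> ('g \<Rightarrow> 'g) \<Rightarrow>
   'g \<Rightarrow> ('g \<Rightarrow> 'v) \<Rightarrow> 'g \<Rightarrow> 'v" where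
  "yd_action G s \<rho> r h f = (\<Sum>t\<in>conj_class G s.
     let t' = h \<otimes>\<^bsub>G\<^esub> t \<otimes>\<^bsub>G\<^esub> inv\<^bsub>G\<^esub> h
     in yd_elem t' (\<rho> (inv\<^bsub>G\<^esub> (r t') \<otimes>\<^bsub>G\<^esub> h \<otimes>\<^bsub>G\<^esub> r t) (f t)))"

text \<open>
  The coaction maps \<open>x\<close> to the sum of \<open>t \<otimes> x\<^sub>t\<close> with \<open>x\<^sub>t = yd_elem t (x t)\<close>, so
  \<open>c (x \<otimes> y)\<close> is the sum of \<open>t \<cdot> y \<otimes> x\<^sub>t\<close>.
\<close>

definition yd_braiding ::
  "('g, 'b) monoid_scheme \<Rightarrow> 'g \<Rightarrow> ('g \<Rightarrow> 'v::ab_group_add \<Rightarrow> 'v) \<Rightarrow> ('g \<Rightarrow> 'g) \<Rightarrow>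
   ('g \<Rightarrow> 'v) \<Rightarrow> ('g \<Rightarrow> 'v) \<Rightarrow> ('g \<Rightarrow> 'v) tens" where
  "yd_braiding G s \<rho> r x y =
     (\<Sum>t\<in>conj_class G s. word [yd_action G s \<rho> r t y, yd_elem t (x t)])"

end

theory Submission
  imports Defs
begin

text \<open>
  Let \<open>q\<close> be the scalar by which \<open>s\<close> acts and \<open>N\<close> its order. For \<open>u\<close> such that \<open>s^u\<close> lies in the class
  and \<open>v\<close> in a basis of \<open>V\<close>, the vectors supported at \<open>s^u\<close> with value \<open>v\<close> span a braided subspace of
  diagonal type with matrix \<open>q^(u / u')\<close>. It is of Cartan type: \<open>Q i i = q\<close> and
  \<open>Q i j * Q j i * q^(m i j) = 1\<close> with \<open>0 \<le> m i j < N\<close> and \<open>m\<close> symmetric. If \<open>N \<ge> 4\<close>, or if \<open>N = 3\<close>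
  and \<open>dim V > 1\<close>, every row of \<open>m\<close> sums to at least \<open>2\<close>, so the Cartan matrix is not of finite type.

  That the Nichols algebra is then infinite dimensional needs no classification. Let the quantum double of
  the diagonal part act on a simple highest weight module whose highest weight is generic. In each
  degree the module is spanned by combinations of images of quantum symmetrizers, so its degrees are
  bounded if the Nichols algebra is finite dimensional. Reflecting the generators at a vertex \<open>i\<close>
  gives generators of the same kind, with the same \<open>m\<close>, whose highest weight vector is
  \<open>F i ^ (N - 1)\<close> applied to the old one. The row sum condition keeps the sum of the heights of the
  simple roots positive, so one can always reflect at a simple root of positive height, and the
  degree of the highest weight vector grows without bound.
\<close>

section \<open>Commutators in a quantum double\<close>

text \<open>Simplicity of the module stands in for defining relations: if an operator raises the
  degree and commutes with all \<open>E k\<close>, its image generates a submodule that misses the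
  highest weight, so it vanishes. This yields \<open>F i ^ N = 0\<close> and the quantum Serre
  relations at every stage, whatever reflections came before. Genericity prevents the opposite
  collapse: all values of the bicharacter have modulus 1, so a factor of another modulus keeps
  \<open>F i ^ (N - 1)\<close> nonzero on the highest weight vector at every root of nonzero height.
  The obstacle on the other side is that tensors are representatives modulo multilinearity. Products
  of coordinate functionals kill these relations and, composed with the symmetrizer, give its matrix
  coefficients on the diagonal part; finite dimension makes them vanish in high degree. The
  surviving orders of q are 2 and, with one basis vector, 3: there two exponents congruent modulo 3
  give type A2, with row sum 1. The value q = 1 falls already in rank one, where the coefficient at
  a constant word is a factorial.\<close>

primrec braided_ad ::
  "(complex \<Rightarrow> 'v \<Rightarrow> 'v::ab_group_add) \<Rightarrow> ('v \<Rightarrow> 'v) \<Rightarrow> ('v \<Rightarrow> 'v) \<Rightarrow> complex \<Rightarrow> complex \<Rightarrow> nat \<Rightarrow> 'v \<Rightarrow> 'v"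
where
  "braided_ad sc f g p q 0 = g"
| "braided_ad sc f g p q (Suc n) =
     (\<lambda>x. f (braided_ad sc f g p q n x) - sc (p * q ^ n) (braided_ad sc f g p q n (f x)))"

section \<open>Quantum integers\<close>

definition q_nat :: "complex \<Rightarrow> nat \<Rightarrow> complex" where
  "q_nat q n = (\<Sum>r<n. q ^ r)"

lemma q_nat_0 [simp]: "q_nat q 0 = 0"
  and q_nat_Suc: "q_nat q (Suc n) = q_nat q n + q ^ n"
  by (simp_all add: q_nat_def)

lemma q_nat_Suc_shift: "q_nat q (Suc n) = 1 + q * q_nat q n"
  unfolding q_nat_def sum.lessThan_Suc_shift by (simp add: sum_distrib_left)

text \<open>Multiplying by q^n reverses the geometric sum. This converts the q-integers in 1/q,
  which come with the characters b, into those in q, which come with a.\<close>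

lemma q_nat_inverse:
  assumes "q \<noteq> 0" shows "q ^ n * q_nat (inverse q) (Suc n) = q_nat q (Suc n)"
proof (induction n)
  case (Suc n)
  have "q ^ Suc n * q_nat (inverse q) (Suc (Suc n))
        = q * (q ^ n * q_nat (inverse q) (Suc n)) + q ^ Suc n * inverse q ^ Suc n"
    by (simp add: q_nat_Suc[of _ "Suc n"] algebra_simps)
  also have "q ^ Suc n * inverse q ^ Suc n = 1"
    using assms by (simp add: field_simps)
  also have "q * (q ^ n * q_nat (inverse q) (Suc n)) + 1 = q_nat q (Suc (Suc n))"
    by (simp add: Suc q_nat_Suc_shift[of _ "Suc n"])
  finally show ?case .
qed (simp add: q_nat_Suc)

lemma q_nat_nonzero:
  assumes "q ^ n \<noteq> 1" shows "q_nat q n \<noteq> 0"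
proof
  assume "q_nat q n = 0"
  then have "(1 - q) * q_nat q n = 0" by simp
  moreover have "(1 - q) * q_nat q n = 1 - q ^ n"
    unfolding q_nat_def by (rule one_diff_power_eq[symmetric])
  ultimately show False using assms by simp
qed

abbreviation lin_endo :: "('a::field \<Rightarrow> 'b::ab_group_add \<Rightarrow> 'b) \<Rightarrow> ('b \<Rightarrow> 'b) \<Rightarrow> bool" where
  "lin_endo sc \<equiv> Vector_Spaces.linear sc sc"

context vector_space begin

lemma linear_simps:
  fixes f :: "'b \<Rightarrow> 'b" and x y :: 'b
  assumes "lin_endo scale f"
  shows "f (x + y) = f x + f y" "f (x - y) = f x - f y" "f (c *s x) = c *s f x" "f 0 = 0"
proof -
  interpret f: Vector_Spaces.linear scale scale f by (rule assms)
  show "f (x + y) = f x + f y" "f (x - y) = f x - f y" "f (c *s x) = c *s f x" "f 0 = 0"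
    by (rule f.add f.diff f.scale f.zero)+
qed

lemma linear_span_subset:
  fixes f :: "'b \<Rightarrow> 'b" and x :: 'b
  assumes "lin_endo scale f" "\<And>x. x \<in> S \<Longrightarrow> f x \<in> T" "subspace T" "x \<in> span S"
  shows "f x \<in> T"
  using assms(4)
proof (induction rule: span_induct_alt)
  case base
  then show ?case using linear_simps(4)[OF assms(1)] subspace_0[OF assms(3)] by simp
next
  case (step d x y)
  then show ?case
    using assms(2,3) by (simp add: linear_simps[OF assms(1)] subspace_add subspace_scale)
qed

end

text \<open>The relations of a quantum double, seen on weight spaces only: \<open>a i\<close> and
  \<open>b i\<close> are the characters of the two group-like parts of the commutator of
  \<open>E i\<close> and \<open>F i\<close>. \<open>b_add\<close> has the form into which
  \<open>a_add\<close> turns when E and F are exchanged. Weights lie in a ring so that multiples of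
  roots are \<open>of_nat n * \<alpha> i\<close>.\<close>

locale double_relations = vector_space scale
  for scale :: "complex \<Rightarrow> 'v::ab_group_add \<Rightarrow> 'v" (infixr "*s" 75) +
  fixes I :: "'i set" and L :: "'w::comm_ring_1 \<Rightarrow> 'v set" and \<alpha> :: "'i \<Rightarrow> 'w"
    and E F :: "'i \<Rightarrow> 'v \<Rightarrow> 'v" and a b :: "'i \<Rightarrow> 'w \<Rightarrow> complex" and p :: "'i \<Rightarrow> 'i \<Rightarrow> complex"
  assumes subspace_L: "subspace (L \<mu>)"
    and linear_E: "i \<in> I \<Longrightarrow> lin_endo scale (E i)"
    and linear_F: "i \<in> I \<Longrightarrow> lin_endo scale (F i)"
    and E_weight: "i \<in> I \<Longrightarrow> x \<in> L \<mu> \<Longrightarrow> E i x \<in> L (\<mu> - \<alpha> i)"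
    and F_weight: "i \<in> I \<Longrightarrow> x \<in> L \<mu> \<Longrightarrow> F i x \<in> L (\<mu> + \<alpha> i)"
    and EF: "i \<in> I \<Longrightarrow> j \<in> I \<Longrightarrow> x \<in> L \<mu> \<Longrightarrow>
       E i (F j x) = F j (E i x) + (if i = j then (a i \<mu> - b i \<mu>) *s x else 0)"
    and a_add: "i \<in> I \<Longrightarrow> j \<in> I \<Longrightarrow> a i (\<mu> + \<alpha> j) = p i j * a i \<mu>"
    and b_add: "i \<in> I \<Longrightarrow> j \<in> I \<Longrightarrow> b i \<mu> = p j i * b i (\<mu> + \<alpha> j)"
    and p_nonzero: "i \<in> I \<Longrightarrow> j \<in> I \<Longrightarrow> p i j \<noteq> 0"
begin

text \<open>Exchanging E with F and a with b, negating the roots and transposing p preserves the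
  relations, so every statement on braided commutators of F has a mirror for E.\<close>

lemma dual: "double_relations scale I L (\<lambda>i. - \<alpha> i) F E b a (\<lambda>i j. p j i)"
proof (intro double_relations.intro vector_space_axioms double_relations_axioms.intro)
  fix i j \<mu> assume ij: "i \<in> I" "j \<in> I"
  show "b i (\<mu> + - \<alpha> j) = p j i * b i \<mu>"
    using b_add[OF ij, of "\<mu> - \<alpha> j"] by simp
  show "a i \<mu> = p i j * a i (\<mu> + - \<alpha> j)"
    using a_add[OF ij, of "\<mu> - \<alpha> j"] by simp
  fix x assume x: "x \<in> L \<mu>"
  show "F i (E j x) = E j (F i x) + (if i = j then (b i \<mu> - a i \<mu>) *s x else 0)"
    using EF[OF ij(2) ij(1) x] by (auto simp: algebra_simps)
qed (use subspace_L linear_E linear_F E_weight F_weight p_nonzero in auto)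

text \<open>The n-th power of the braided adjoint action of \<open>F i\<close> on
  \<open>F j\<close>. The twist \<open>p i j * p i i ^ n\<close> is the braiding of
  \<open>F i\<close> past an element of degree \<alpha> j + n \<alpha> i.\<close>

abbreviation Fad :: "'i \<Rightarrow> 'i \<Rightarrow> nat \<Rightarrow> 'v \<Rightarrow> 'v" where
  "Fad i j \<equiv> braided_ad scale (F i) (F j) (p i j) (p i i)"

abbreviation Ead :: "'i \<Rightarrow> 'i \<Rightarrow> nat \<Rightarrow> 'v \<Rightarrow> 'v" where
  "Ead i j \<equiv> braided_ad scale (E i) (E j) (p j i) (p i i)"

lemma linear_braided_ad:
  assumes f: "lin_endo scale f" and g: "lin_endo scale g"
  shows "lin_endo scale (braided_ad scale f g c d n)"
proof (induction n)
  case (Suc n)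
  show ?case
    by (simp add: Vector_Spaces.linear_iff vector_space_axioms linear_simps[OF f] linear_simps[OF Suc] algebra_simps)
qed (simp add: g)

lemma linear_Fad: "i \<in> I \<Longrightarrow> j \<in> I \<Longrightarrow> lin_endo scale (Fad i j n)"
  by (intro linear_braided_ad linear_F)

lemma linear_Ead: "i \<in> I \<Longrightarrow> j \<in> I \<Longrightarrow> lin_endo scale (Ead i j n)"
  by (intro linear_braided_ad linear_E)

lemma Fad_weight:
  assumes ij: "i \<in> I" "j \<in> I"
  shows "x \<in> L \<mu> \<Longrightarrow> Fad i j n x \<in> L (\<mu> + (\<alpha> j + of_nat n * \<alpha> i))"
proof (induction n arbitrary: x \<mu>)
  case (Suc n)
  have "F i (Fad i j n x) \<in> L (\<mu> + (\<alpha> j + of_nat n * \<alpha> i) + \<alpha> i)"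
    using Suc ij by (intro F_weight)
  moreover have "Fad i j n (F i x) \<in> L (\<mu> + \<alpha> i + (\<alpha> j + of_nat n * \<alpha> i))"
    using Suc ij by (intro Suc.IH F_weight)
  moreover have "\<mu> + (\<alpha> j + of_nat n * \<alpha> i) + \<alpha> i = \<mu> + (\<alpha> j + of_nat (Suc n) * \<alpha> i)"
    "\<mu> + \<alpha> i + (\<alpha> j + of_nat n * \<alpha> i) = \<mu> + (\<alpha> j + of_nat (Suc n) * \<alpha> i)"
    by (simp_all add: algebra_simps)
  ultimately show ?case
    by (simp add: subspace_diff[OF subspace_L] subspace_scale[OF subspace_L])
qed (simp add: F_weight ij)

lemma a_add_mult:
  assumes ij: "i \<in> I" "j \<in> I"
  shows "a i (\<mu> + of_nat n * \<alpha> j) = p i j ^ n * a i \<mu>"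
proof (induction n)
  case (Suc n)
  show ?case
    using a_add[OF ij, of "\<mu> + of_nat n * \<alpha> j"] Suc by (simp add: algebra_simps)
qed simp

lemma b_add_mult:
  assumes ij: "i \<in> I" "j \<in> I"
  shows "b i \<mu> = p j i ^ n * b i (\<mu> + of_nat n * \<alpha> j)"
proof (induction n)
  case (Suc n)
  show ?case
    using b_add[OF ij, of "\<mu> + of_nat n * \<alpha> j"] Suc by (simp add: algebra_simps)
qed simp

text \<open>The scalar left over when \<open>E i\<close> passes the n-th braided commutator; its
  factored form is \<open>\<kappa>_alt\<close>.\<close>

definition \<kappa> :: "'i \<Rightarrow> 'i \<Rightarrow> nat \<Rightarrow> complex" where
  "\<kappa> i j n = (\<Sum>r<n. p i j * p i i ^ r - inverse (p j i * p i i ^ r))"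

text \<open>The twist \<open>p i j * p i i ^ n\<close> is the factor by which \<open>a i\<close>
  changes along \<alpha> j + n \<alpha> i, so the contributions of \<open>a i\<close> cancel and
  only a multiple of \<open>b i\<close> remains.\<close>

lemma E_Fad:
  assumes ij: "i \<in> I" "j \<in> I" "i \<noteq> j"
  shows "x \<in> L \<mu> \<Longrightarrow>
    E i (Fad i j n x) = Fad i j n (E i x) + (\<kappa> i j n * b i \<mu>) *s Fad i j (n - 1) x"
proof (induction n arbitrary: x \<mu>)
  case 0
  then show ?case using EF[OF ij(1,2)] ij(3) by (simp add: \<kappa>_def)
next
  case (Suc n)
  define z where "z = Fad i j n x"
  define c where "c = p i j * p i i ^ n"
  have lin: "lin_endo scale (Fad i j n)" "lin_endo scale (F i)"
      "lin_endo scale (E i)"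
    using ij linear_Fad linear_F linear_E by auto
  have z: "z \<in> L (\<mu> + (\<alpha> j + of_nat n * \<alpha> i))"
    unfolding z_def using ij Suc.prems by (intro Fad_weight)
  have a: "a i (\<mu> + (\<alpha> j + of_nat n * \<alpha> i)) = c * a i \<mu>"
    using a_add_mult[of i i "\<mu> + \<alpha> j" n] a_add[of i j \<mu>] ij by (simp add: c_def algebra_simps)
  have b: "b i (\<mu> + (\<alpha> j + of_nat n * \<alpha> i)) = inverse (p j i * p i i ^ n) * b i \<mu>"
    using b_add_mult[of i i "\<mu> + \<alpha> j" n] b_add[of i j \<mu>] ij p_nonzero[of i i] p_nonzero[of j i]
    by (simp add: field_simps)
  have 1: "E i (F i z) = F i (E i z) + (c * a i \<mu> - inverse (p j i * p i i ^ n) * b i \<mu>) *s z"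
    using EF[OF ij(1) ij(1) z] by (simp add: a b)
  have 2: "E i z = Fad i j n (E i x) + (\<kappa> i j n * b i \<mu>) *s Fad i j (n - 1) x"
    unfolding z_def by (rule Suc.IH[OF Suc.prems])
  have 3: "E i (Fad i j n (F i x)) = Fad i j n (F i (E i x)) + (a i \<mu> - b i \<mu>) *s z
      + (\<kappa> i j n * b i (\<mu> + \<alpha> i)) *s Fad i j (n - 1) (F i x)"
    using Suc.IH[OF F_weight[OF ij(1) Suc.prems]] EF[OF ij(1) ij(1) Suc.prems]
    by (simp add: linear_simps[OF lin(1)] z_def)
  \<comment> \<open>The two terms of order n - 1 recombine to \<open>Fad i j n\<close>: passing from
    \<open>b i (\<mu> + \<alpha> i)\<close> to \<open>b i \<mu>\<close> absorbs one factor
    \<open>p i i\<close>, which lowers the twist from exponent n to n - 1. For n = 0 the scalar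
    \<kappa> is 0.\<close>
  have 4: "(\<kappa> i j n * b i \<mu>) *s F i (Fad i j (n - 1) x)
      - (c * (\<kappa> i j n * b i (\<mu> + \<alpha> i))) *s Fad i j (n - 1) (F i x) = (\<kappa> i j n * b i \<mu>) *s z"
  proof (cases n)
    case (Suc k)
    have "c * (\<kappa> i j n * b i (\<mu> + \<alpha> i)) = \<kappa> i j n * b i \<mu> * (p i j * p i i ^ k)"
      using b_add[of i i \<mu>] ij by (simp add: c_def Suc)
    then show ?thesis
      by (simp only: z_def Suc braided_ad.simps diff_Suc_1 scale_right_diff_distrib scale_scale)
  qed (simp add: \<kappa>_def)
  have \<kappa>: "\<kappa> i j (Suc n) = \<kappa> i j n + c - inverse (p j i * p i i ^ n)"
    by (simp add: \<kappa>_def c_def)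
  have "E i (Fad i j (Suc n) x) = E i (F i z) - c *s E i (Fad i j n (F i x))"
    by (simp add: linear_simps[OF lin(3)] z_def c_def)
  also have "\<dots> = Fad i j (Suc n) (E i x) + (c * a i \<mu> - inverse (p j i * p i i ^ n) * b i \<mu>) *s z
      - (c * (a i \<mu> - b i \<mu>)) *s z
      + ((\<kappa> i j n * b i \<mu>) *s F i (Fad i j (n - 1) x)
      - (c * (\<kappa> i j n * b i (\<mu> + \<alpha> i))) *s Fad i j (n - 1) (F i x))"
    unfolding 1 2 3 by (simp add: linear_simps[OF lin(2)] c_def algebra_simps)
  also have "\<dots> = Fad i j (Suc n) (E i x) + (\<kappa> i j (Suc n) * b i \<mu>) *s z"
    unfolding 4 \<kappa> by (simp add: algebra_simps)
  finally show ?case by (simp add: z_def)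
qed

lemma E_Fad_other:
  assumes "i \<in> I" "j \<in> I" "k \<in> I" "k \<noteq> i" "k \<noteq> j"
  shows "x \<in> L \<mu> \<Longrightarrow> E k (Fad i j n x) = Fad i j n (E k x)"
proof (induction n arbitrary: x \<mu>)
  case 0
  then show ?case using EF assms by simp
next
  case (Suc n)
  have "E k (F i (Fad i j n x)) = F i (E k (Fad i j n x))"
    using EF[of k i "Fad i j n x"] Fad_weight[of i j x] assms Suc.prems by auto
  moreover have "E k (Fad i j n (F i x)) = Fad i j n (F i (E k x))"
    using Suc.IH[OF F_weight[OF assms(1) Suc.prems]] EF[of k i x] assms Suc.prems by auto
  ultimately show ?case
    using Suc by (simp add: linear_simps[OF linear_E[OF assms(3)]])
qed

lemma linear_F_power: "i \<in> I \<Longrightarrow> lin_endo scale (F i ^^ n)"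
proof (induction n)
  case 0
  show ?case using linear_id by (simp add: id_def)
next
  case (Suc n)
  show ?case
    unfolding funpow.simps using Suc by (intro Vector_Spaces.linear_compose[where ?s2.0 = scale] linear_F)
qed

lemma F_power_weight: "i \<in> I \<Longrightarrow> x \<in> L \<mu> \<Longrightarrow> (F i ^^ n) x \<in> L (\<mu> + of_nat n * \<alpha> i)"
proof (induction n)
  case (Suc n)
  then have "F i ((F i ^^ n) x) \<in> L (\<mu> + of_nat n * \<alpha> i + \<alpha> i)"
    by (intro F_weight) auto
  then show ?case by (simp add: algebra_simps)
qed simp

definition \<xi> :: "'i \<Rightarrow> 'i \<Rightarrow> nat \<Rightarrow> complex" where
  "\<xi> i j n = (\<Prod>r<n. 1 - p i j * p j i * p i i ^ r)"

text \<open>One braided commutator already cancels the \<open>b j\<close> part, which is why the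
  exponent is a successor. Each further one contributes the next factor of \<open>\<xi>\<close>, and
  what remains is a power of \<open>F i\<close>.\<close>

lemma E_Fad_same:
  assumes ij: "i \<in> I" "j \<in> I" "i \<noteq> j"
  shows "x \<in> L \<mu> \<Longrightarrow> E j (Fad i j (Suc n) x) =
    Fad i j (Suc n) (E j x) + (\<xi> i j (Suc n) * a j \<mu>) *s (F i ^^ Suc n) x"
proof (induction n arbitrary: x \<mu>)
  case 0
  have "a j (\<mu> + \<alpha> i) = p j i * a j \<mu>" "b j \<mu> = p i j * b j (\<mu> + \<alpha> i)"
    by (rule a_add[OF ij(2,1)] b_add[OF ij(2,1)])+
  note 1 = this
  have 2: "E j (F i (F j x)) = F i (F j (E j x) + (a j \<mu> - b j \<mu>) *s x)"
    using EF[of j i "F j x"] F_weight[of j x \<mu>] EF[of j j x \<mu>] 0 ij by auto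
  have 3: "E j (F j (F i x)) = F j (F i (E j x)) + (a j (\<mu> + \<alpha> i) - b j (\<mu> + \<alpha> i)) *s F i x"
    using EF[of j j "F i x"] F_weight[of i x \<mu>] EF[of j i x \<mu>] 0 ij by auto
  have 4: "p i j *s b j (\<mu> + \<alpha> i) *s F i x = b j \<mu> *s F i x"
    unfolding b_add[OF ij(2,1), of \<mu>] by simp
  show ?case
    by (simp add: 2 3 linear_simps[OF linear_F[OF ij(1)]] linear_simps[OF linear_E[OF ij(2)]] \<xi>_def 1(1)
        scale_right_distrib scale_right_diff_distrib scale_left_distrib scale_left_diff_distrib 4
        flip: scale_scale)
next
  case (Suc n)
  define y where "y = Fad i j (Suc n)"
  have lin: "lin_endo scale (F i)" "lin_endo scale (E j)"
    "lin_endo scale y"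
    using linear_F linear_E linear_Fad ij by (auto simp: y_def simp del: braided_ad.simps)
  have yx: "y x \<in> L (\<mu> + (\<alpha> j + of_nat (Suc n) * \<alpha> i))"
    unfolding y_def using Suc.prems ij by (intro Fad_weight)
  have 1: "E j (F i (y x)) = F i (E j (y x))"
    using EF[of j i "y x"] yx ij by auto
  have 2: "E j (y (F i x)) = y (F i (E j x)) + (\<xi> i j (Suc n) * (p j i * a j \<mu>)) *s (F i ^^ Suc n) (F i x)"
    using Suc.IH[OF F_weight[OF ij(1) Suc.prems]] EF[of j i x] ij Suc.prems a_add[of j i \<mu>]
    by (auto simp: y_def simp del: braided_ad.simps funpow.simps)
  have 3: "E j (y x) = y (E j x) + (\<xi> i j (Suc n) * a j \<mu>) *s (F i ^^ Suc n) x"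
    using Suc.IH[OF Suc.prems] by (simp add: y_def del: braided_ad.simps funpow.simps)
  have 4: "(F i ^^ Suc n) (F i x) = (F i ^^ Suc (Suc n)) x" "F i ((F i ^^ Suc n) x) = (F i ^^ Suc (Suc n)) x"
    by (simp_all add: funpow_swap1)
  have 5: "braided_ad scale (F i) (F j) (p i j) (p i i) (Suc (Suc n)) = (\<lambda>x. F i (y x) - (p i j * p i i ^ Suc n) *s y (F i x))"
    by (simp add: y_def)
  have 6: "\<xi> i j (Suc (Suc n)) = \<xi> i j (Suc n) * (1 - p i j * p j i * p i i ^ Suc n)"
    by (simp add: \<xi>_def)
  show ?case
    unfolding 5 6 by (simp add: linear_simps[OF lin(2)] 1 2 3 linear_simps[OF lin(1)] 4 algebra_simps del: funpow.simps)
qed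

lemma E_F_power:
  assumes i: "i \<in> I"
  shows "x \<in> L \<mu> \<Longrightarrow> E i ((F i ^^ n) x) = (F i ^^ n) (E i x)
     + (q_nat (p i i) n * a i \<mu> - q_nat (inverse (p i i)) n * b i \<mu>) *s (F i ^^ (n - 1)) x"
proof (induction n)
  case (Suc n)
  have lin: "lin_endo scale (F i)" by (rule linear_F[OF i])
  have a: "a i (\<mu> + of_nat n * \<alpha> i) = p i i ^ n * a i \<mu>"
    and b: "b i (\<mu> + of_nat n * \<alpha> i) = inverse (p i i) ^ n * b i \<mu>"
    using a_add_mult[OF i i] b_add_mult[OF i i, of \<mu> n] p_nonzero[OF i i] by (auto simp: field_simps)
  have "E i (F i ((F i ^^ n) x)) = F i (E i ((F i ^^ n) x))
      + (p i i ^ n * a i \<mu> - inverse (p i i) ^ n * b i \<mu>) *s (F i ^^ n) x"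
    using EF[OF i i F_power_weight[OF i Suc.prems]] by (simp add: a b)
  also have "F i (E i ((F i ^^ n) x)) = (F i ^^ Suc n) (E i x)
      + (q_nat (p i i) n * a i \<mu> - q_nat (inverse (p i i)) n * b i \<mu>) *s (F i ^^ n) x"
    using Suc by (cases n) (simp_all add: linear_simps[OF lin])
  finally show ?case by (simp add: q_nat_Suc algebra_simps)
qed simp

lemma E_F_power_other:
  assumes "i \<in> I" "k \<in> I" "k \<noteq> i"
  shows "x \<in> L \<mu> \<Longrightarrow> E k ((F i ^^ n) x) = (F i ^^ n) (E k x)"
proof (induction n)
  case (Suc n)
  then show ?case using EF[of k i "(F i ^^ n) x"] F_power_weight[of i x] assms by auto
qed simp

text \<open>Downward induction: commuting \<open>E i\<close> with \<open>Fad i j (Suc k)\<close>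
  gives \<open>Fad i j k\<close> up to a nonzero scalar, so a family stable under \<open>E i\<close>
  and the top commutator is stable under \<open>F j\<close>. This recovers the old generators from
  the reflected ones.\<close>

lemma Fad_descent:
  assumes ij: "i \<in> I" "j \<in> I" "i \<noteq> j"
    and sub: "\<And>\<mu>. subspace (Y \<mu>)" and L: "\<And>\<mu>. Y \<mu> \<subseteq> L \<mu>"
    and E: "\<And>x \<mu>. x \<in> Y \<mu> \<Longrightarrow> E i x \<in> Y (\<mu> - \<alpha> i)"
    and top: "\<And>x \<mu>. x \<in> Y \<mu> \<Longrightarrow> Fad i j n x \<in> Y (\<mu> + (\<alpha> j + of_nat n * \<alpha> i))"
    and nz: "\<And>k. k < n \<Longrightarrow> \<kappa> i j (Suc k) \<noteq> 0" "\<And>\<mu>. b i \<mu> \<noteq> 0"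
    and x: "x \<in> Y \<mu>"
  shows "F j x \<in> Y (\<mu> + \<alpha> j)"
proof -
  have "\<forall>\<mu>. \<forall>x\<in>Y \<mu>. Fad i j 0 x \<in> Y (\<mu> + (\<alpha> j + of_nat 0 * \<alpha> i))"
  proof (rule inc_induct[of 0 n])
    show "\<forall>\<mu>. \<forall>x\<in>Y \<mu>. Fad i j n x \<in> Y (\<mu> + (\<alpha> j + of_nat n * \<alpha> i))"
      using top by blast
  next
    fix k assume k: "k < n"
      and IH: "\<forall>\<mu>. \<forall>x\<in>Y \<mu>. Fad i j (Suc k) x \<in> Y (\<mu> + (\<alpha> j + of_nat (Suc k) * \<alpha> i))"
    show "\<forall>\<mu>. \<forall>x\<in>Y \<mu>. Fad i j k x \<in> Y (\<mu> + (\<alpha> j + of_nat k * \<alpha> i))"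
    proof (intro allI ballI)
      fix \<mu> x assume x: "x \<in> Y \<mu>"
      let ?\<nu> = "\<mu> + (\<alpha> j + of_nat k * \<alpha> i)"
      have \<nu>: "\<mu> + (\<alpha> j + of_nat (Suc k) * \<alpha> i) - \<alpha> i = ?\<nu>"
        "\<mu> - \<alpha> i + (\<alpha> j + of_nat (Suc k) * \<alpha> i) = ?\<nu>"
        by (simp_all add: algebra_simps)
      have "E i (Fad i j (Suc k) x) \<in> Y ?\<nu>"
        using E[OF IH[rule_format, OF x]] unfolding \<nu> .
      moreover have "Fad i j (Suc k) (E i x) \<in> Y ?\<nu>"
        using IH[rule_format, OF E[OF x]] unfolding \<nu> .
      ultimately have "E i (Fad i j (Suc k) x) - Fad i j (Suc k) (E i x) \<in> Y ?\<nu>"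
        by (rule subspace_diff[OF sub])
      moreover define d where "d = \<kappa> i j (Suc k) * b i \<mu>"
      ultimately have 1: "d *s Fad i j k x \<in> Y ?\<nu>"
        using E_Fad[OF ij L[THEN subsetD, OF x], of "Suc k"] by (simp del: braided_ad.simps)
      have "d \<noteq> 0" using nz(1)[OF k] nz(2)[of \<mu>] by (simp add: d_def)
      then show "Fad i j k x \<in> Y ?\<nu>"
        using subspace_scale[OF sub 1, of "inverse d"] by simp
    qed
  qed simp
  from this[rule_format, OF x] show ?thesis by simp
qed

section \<open>Commutators between the braided adjoint powers of E and of F\<close>

interpretation dual: double_relations scale I L "\<lambda>i. - \<alpha> i" F E b a "\<lambda>i j. p j i"
  by (rule dual)

lemma Ead_weight:
  assumes "i \<in> I" "j \<in> I" "x \<in> L \<mu>"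
  shows "Ead i j n x \<in> L (\<mu> - (\<alpha> j + of_nat n * \<alpha> i))"
proof -
  have "\<mu> + (- \<alpha> j + of_nat n * - \<alpha> i) = \<mu> - (\<alpha> j + of_nat n * \<alpha> i)"
    by (simp add: algebra_simps)
  from dual.Fad_weight[OF assms, of n, unfolded this] show ?thesis .
qed

lemma b_Ead_weight:
  assumes ij: "i \<in> I" "j \<in> I"
  shows "b i (\<mu> - (\<alpha> j + of_nat n * \<alpha> i)) = p j i * p i i ^ n * b i \<mu>"
  using b_add_mult[OF ij(1) ij(1), of "\<mu> - (\<alpha> j + of_nat n * \<alpha> i)" n] b_add[OF ij, of "\<mu> - \<alpha> j"]
  by (simp add: algebra_simps)

lemma E_Fad_Ead:
  assumes ij: "i \<in> I" "j \<in> I" "k \<in> I" "i \<noteq> k" and x: "x \<in> L \<mu>"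
  shows "E i (Fad i k n (Ead i j m x)) = Fad i k n (E i (Ead i j m x))
     + (\<kappa> i k n * (p j i * p i i ^ m * b i \<mu>)) *s Fad i k (n - 1) (Ead i j m x)"
  using E_Fad[OF ij(1,3,4) Ead_weight[OF ij(1,2) x]] b_Ead_weight[OF ij(1,2)] by simp

text \<open>\<open>E j\<close> commutes with \<open>Fad i k n\<close>, and the \<kappa>-terms that
  \<open>E i\<close> produces cancel in the next braided commutator: on the weight lowered by
  \<alpha> j + m \<alpha> i the character \<open>b i\<close> changes by exactly the twist.\<close>

lemma Ead_Fad_other:
  assumes ij: "i \<in> I" "j \<in> I" "k \<in> I" "i \<noteq> j" "i \<noteq> k" "j \<noteq> k"
  shows "x \<in> L \<mu> \<Longrightarrow> Ead i j m (Fad i k n x) = Fad i k n (Ead i j m x)"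
proof (induction m arbitrary: x \<mu> n)
  case 0
  then show ?case using E_Fad_other[OF ij(1,3,2)] ij by simp
next
  case (Suc m)
  have lin: "lin_endo scale (Ead i j m)" "lin_endo scale (Fad i k n)"
    using linear_Ead linear_Fad ij by auto
  have 1: "Ead i j m (E i (Fad i k n x)) = Fad i k n (Ead i j m (E i x))
      + (\<kappa> i k n * b i \<mu>) *s Fad i k (n - 1) (Ead i j m x)"
    by (simp add: E_Fad[OF ij(1,3,5) Suc.prems] linear_simps[OF lin(1)]
        Suc.IH[OF E_weight[OF ij(1) Suc.prems]] Suc.IH[OF Suc.prems])
  show ?case
    by (simp add: Suc.IH[OF Suc.prems] E_Fad_Ead[OF ij(1-3,5) Suc.prems] 1 linear_simps[OF lin(2)]
        scale_right_distrib mult_ac)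
qed

text \<open>The coefficient of \<open>F i ^^ (n - m)\<close> when m braided commutators of E meet n
  of F: \<open>\<xi>\<close> times a falling q-factorial, which for m = n is the full
  q-factorial.\<close>

definition ad_const :: "'i \<Rightarrow> 'i \<Rightarrow> nat \<Rightarrow> nat \<Rightarrow> complex" where
  "ad_const i j m n = \<xi> i j n * (\<Prod>r<m. q_nat (p i i) (n - r))"

text \<open>Both sums in \<kappa> are geometric, and \<open>q_nat_inverse\<close> merges them into
  one q-integer with a factor 1 - p_ij p_ji p_ii^n. The zeros of \<kappa> are read off from these
  two factors.\<close>

lemma \<kappa>_alt:
  assumes ij: "i \<in> I" "j \<in> I"
  shows "- (\<kappa> i j (Suc n) * p j i) = q_nat (inverse (p i i)) (Suc n) * (1 - p i j * p j i * p i i ^ n)"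
proof -
  have "- (\<kappa> i j (Suc n) * p j i)
      = (\<Sum>r<Suc n. inverse (p i i) ^ r - p i j * p j i * p i i ^ r)"
    unfolding \<kappa>_def sum_distrib_right sum_negf[symmetric]
    using p_nonzero[of j i] p_nonzero[of i i] ij by (intro sum.cong) (auto simp: field_simps)
  also have "\<dots> = q_nat (inverse (p i i)) (Suc n) - p i j * p j i * q_nat (p i i) (Suc n)"
    by (simp only: sum_subtractf q_nat_def sum_distrib_left)
  also have "q_nat (p i i) (Suc n) = p i i ^ n * q_nat (inverse (p i i)) (Suc n)"
    using q_nat_inverse[of "p i i" n] p_nonzero ij by simp
  finally show ?thesis by (simp add: algebra_simps)
qed

text \<open>This identity cancels the \<open>b i\<close> terms in \<open>Ead_Fad_same\<close>. The
  left side comes from \<open>E i\<close> acting on a power of \<open>F i\<close>, the right side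
  from \<open>E i\<close> passing the braided commutator.\<close>

lemma ad_const_rec:
  assumes ij: "i \<in> I" "j \<in> I"
  shows "m \<le> n \<Longrightarrow> ad_const i j m (Suc n) * q_nat (inverse (p i i)) (Suc n - m)
     = - (\<kappa> i j (Suc n) * (p j i * p i i ^ m)) * ad_const i j m n"
proof (induction m)
  case 0
  have "ad_const i j 0 (Suc n) = ad_const i j 0 n * (1 - p i j * p j i * p i i ^ n)"
    by (simp add: ad_const_def \<xi>_def)
  then show ?case using \<kappa>_alt[OF ij, of n] by simp
next
  case (Suc m)
  define d where "d = n - Suc m"
  have d: "n - m = Suc d" "Suc n - m = Suc (Suc d)" "Suc n - Suc m = Suc d"
    using Suc.prems by (auto simp: d_def)
  let ?q = "p i i"
  have q: "q_nat ?q (Suc (Suc d)) = ?q ^ Suc d * q_nat (inverse ?q) (Suc (Suc d))"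
    "q_nat ?q (Suc d) = ?q ^ d * q_nat (inverse ?q) (Suc d)"
    using q_nat_inverse[of ?q "Suc d"] q_nat_inverse[of ?q d] p_nonzero ij by auto
  have 1: "ad_const i j (Suc m) (Suc n) = ad_const i j m (Suc n) * q_nat ?q (Suc (Suc d))"
    and 2: "ad_const i j (Suc m) n = ad_const i j m n * q_nat ?q (Suc d)"
    by (simp_all add: ad_const_def d)
  have "ad_const i j (Suc m) (Suc n) * q_nat (inverse ?q) (Suc d)
     = (ad_const i j m (Suc n) * q_nat (inverse ?q) (Suc (Suc d))) * ?q ^ Suc d * q_nat (inverse ?q) (Suc d)"
    unfolding 1 q by (simp only: mult_ac)
  also have "\<dots> = - (\<kappa> i j (Suc n) * (p j i * ?q ^ m)) * ad_const i j m n * ?q ^ Suc d * q_nat (inverse ?q) (Suc d)"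
    using Suc d by simp
  also have "\<dots> = - (\<kappa> i j (Suc n) * (p j i * ?q ^ Suc m)) * ad_const i j (Suc m) n"
    unfolding 2 q by simp
  finally show ?case unfolding d .
qed

text \<open>For m < n only the characters a survive, in front of a power of \<open>F i\<close>. At m
  = n the commutator is again a difference of two characters, those of the root \<alpha> j + m
  \<alpha> i, which is the relation required of the reflected generators.\<close>

lemma Ead_Fad_same:
  assumes ij: "i \<in> I" "j \<in> I" "i \<noteq> j"
  shows "x \<in> L \<mu> \<Longrightarrow> m \<le> n \<Longrightarrow> Ead i j m (Fad i j n x) = Fad i j n (Ead i j m x) +
     (if m = n then (ad_const i j m m * (a i \<mu> ^ m * a j \<mu> - b i \<mu> ^ m * b j \<mu>)) *s x
      else (ad_const i j m n * (a i \<mu> ^ m * a j \<mu>)) *s (F i ^^ (n - m)) x)"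
proof (induction m arbitrary: x \<mu> n)
  case 0
  show ?case
  proof (cases n)
    case 0
    then show ?thesis using EF[OF ij(2,2)] "0.prems" by (simp add: ad_const_def \<xi>_def)
  next
    case (Suc k)
    then show ?thesis using E_Fad_same[OF ij "0.prems"(1), of k]
      by (simp add: ad_const_def del: braided_ad.simps(2) funpow.simps)
  qed
next
  case (Suc m)
  then obtain k where n: "n = Suc k" "m \<le> k"
    by (cases n) auto
  define d where "d = k - m"
  have d: "Suc k - m = Suc d" "k - m = d"
    using n by (auto simp: d_def)
  define A B Aj Bj c1 c2 K y where defs: "A = a i \<mu>" "B = b i \<mu>" "Aj = a j \<mu>" "Bj = b j \<mu>"
    "c1 = ad_const i j m (Suc k)" "c2 = ad_const i j m k" "K = \<kappa> i j (Suc k)" "y = p j i * p i i ^ m"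
  have lin: "lin_endo scale (Ead i j m)" "lin_endo scale (Fad i j (Suc k))"
      "lin_endo scale (E i)"
    using linear_Ead linear_Fad linear_E ij by blast+
  have nk: "m \<le> Suc k" "m \<noteq> Suc k" using n by auto
  have h1: "Ead i j m (Fad i j (Suc k) x) = Fad i j (Suc k) (Ead i j m x) + (c1 * (A ^ m * Aj)) *s (F i ^^ Suc d) x"
    using Suc.IH[OF Suc.prems(1) nk(1)] nk(2) by (simp only: defs d if_False)
  have h2: "E i (Fad i j (Suc k) (Ead i j m x)) = Fad i j (Suc k) (E i (Ead i j m x))
     + (K * y * B) *s Fad i j k (Ead i j m x)"
    using E_Fad_Ead[OF ij(1,2,2,3) Suc.prems(1), of "Suc k" m]
    by (simp only: defs diff_Suc_1 mult.assoc)
  have h3: "E i ((F i ^^ Suc d) x) = (F i ^^ Suc d) (E i x)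
     + (q_nat (p i i) (Suc d) * A - q_nat (inverse (p i i)) (Suc d) * B) *s (F i ^^ d) x"
    using E_F_power[OF ij(1) Suc.prems(1), of "Suc d"] by (simp only: defs diff_Suc_1)
  have h4: "Ead i j m (E i (Fad i j (Suc k) x)) = Ead i j m (Fad i j (Suc k) (E i x)) + (K * B) *s Ead i j m (Fad i j k x)"
    using E_Fad[OF ij Suc.prems(1), of "Suc k"]
    by (simp only: linear_simps[OF lin(1)] defs diff_Suc_1)
  \<comment> \<open>Lowering the weight by \<alpha> i divides this product of characters by exactly
    the twist y.\<close>
  have "y * (a i (\<mu> - \<alpha> i) ^ m * a j (\<mu> - \<alpha> i)) = A ^ m * Aj"
  proof -
    have "A = p i i * a i (\<mu> - \<alpha> i)" "Aj = p j i * a j (\<mu> - \<alpha> i)"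
      using a_add[OF ij(1,1), of "\<mu> - \<alpha> i"] a_add[OF ij(2,1), of "\<mu> - \<alpha> i"] by (simp_all add: defs)
    then show ?thesis by (simp add: defs(8) power_mult_distrib)
  qed
  then have h5: "y *s Ead i j m (Fad i j (Suc k) (E i x)) = y *s Fad i j (Suc k) (Ead i j m (E i x))
      + (c1 * (A ^ m * Aj)) *s (F i ^^ Suc d) (E i x)"
    using Suc.IH[OF E_weight[OF ij(1) Suc.prems(1)] nk(1)] nk(2)
    by (simp only: d if_False scale_right_distrib scale_scale defs(5) mult.left_commute[of y])
  define T where "T = (if m = k then (c2 * (A ^ m * Aj - B ^ m * Bj)) *s x else (c2 * (A ^ m * Aj)) *s (F i ^^ d) x)"
  have h6: "Ead i j m (Fad i j k x) = Fad i j k (Ead i j m x) + T"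
    using Suc.IH[OF Suc.prems(1) n(2)] by (simp only: T_def defs(1-4,6) d) simp
  have K: "c1 * q_nat (inverse (p i i)) (Suc d) = - (K * y) * c2"
    using ad_const_rec[OF ij(1,2) n(2)] d by (simp add: defs)
  have rec: "ad_const i j (Suc m) (Suc k) = c1 * q_nat (p i i) (Suc d)"
    using d by (simp add: ad_const_def defs)
  have e1: "Ead i j (Suc m) z = E i (Ead i j m z) - y *s Ead i j m (E i z)" for z
    by (simp add: defs)
  define U1 U2 W Z R h where U: "U1 = Fad i j (Suc k) (E i (Ead i j m x))"
    "U2 = Fad i j (Suc k) (Ead i j m (E i x))" "W = (F i ^^ Suc d) (E i x)"
    "Z = Fad i j k (Ead i j m x)" "R = (F i ^^ d) x"
    "h = q_nat (p i i) (Suc d) * A - q_nat (inverse (p i i)) (Suc d) * B"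
  have e2: "E i (Ead i j m (Fad i j (Suc k) x)) = U1 + (K * y * B) *s Z + (c1 * (A ^ m * Aj)) *s (W + h *s R)"
    unfolding h1 linear_simps[OF lin(3)] h2 h3 U ..
  have e3: "y *s Ead i j m (E i (Fad i j (Suc k) x)) = y *s U2 + (c1 * (A ^ m * Aj)) *s W + y *s (K * B) *s (Z + T)"
    unfolding h4 scale_right_distrib[of y] h5 h6 U ..
  have e4: "Fad i j (Suc k) (Ead i j (Suc m) x) = U1 - y *s U2"
    unfolding e1 linear_simps[OF lin(2)] U ..
  have "Ead i j (Suc m) (Fad i j (Suc k) x) = Fad i j (Suc k) (Ead i j (Suc m) x)
     + ((c1 * (A ^ m * Aj)) *s h *s R - (K * y * B) *s T)"
    unfolding e4 unfolding e1 e2 e3 by (simp add: scale_right_distrib mult_ac)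
  also have "(c1 * (A ^ m * Aj)) *s h *s R - (K * y * B) *s T = (if Suc m = n then (ad_const i j (Suc m) (Suc m) * (A ^ Suc m * Aj - B ^ Suc m * Bj)) *s x
      else (ad_const i j (Suc m) n * (A ^ Suc m * Aj)) *s (F i ^^ (n - Suc m)) x)"
  \<comment> \<open>At m = k the power of \<open>F i\<close> has exponent 0 and \<open>T\<close>
    also carries the part with \<open>b\<close>; for m < k the relation \<open>K\<close> removes the
    term with \<open>B\<close>.\<close>
  proof (cases "m = k")
    case True
    then have "d = 0" by (simp add: d_def)
    then have K': "K * y * c2 = - c1" using K by (simp add: q_nat_def)
    have "(c1 * (A ^ m * Aj)) * (A - B) - B * (A ^ m * Aj - B ^ m * Bj) * (K * y * c2)
       = c1 * (A ^ Suc m * Aj - B ^ Suc m * Bj)"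
      unfolding K' by (simp add: algebra_simps)
    then show ?thesis
      using True rec n \<open>d = 0\<close>
      by (simp add: T_def U q_nat_def mult_ac flip: scale_left_diff_distrib)
  next
    case False
    then have T: "T = (c2 * (A ^ m * Aj)) *s (F i ^^ d) x" by (simp add: T_def)
    have "(c1 * (A ^ m * Aj)) * (q_nat (p i i) (Suc d) * A - q_nat (inverse (p i i)) (Suc d) * B)
       - (K * y * B) * (c2 * (A ^ m * Aj))
       = (c1 * q_nat (p i i) (Suc d)) * (A ^ Suc m * Aj)
         - (c1 * q_nat (inverse (p i i)) (Suc d) + (K * y) * c2) * (B * (A ^ m * Aj))"
      by (simp add: algebra_simps)
    also have "\<dots> = ad_const i j (Suc m) (Suc k) * (A ^ Suc m * Aj)"
      unfolding K rec by simp
    finally show ?thesis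
      using False n by (simp add: T U d_def flip: scale_left_diff_distrib)
  qed
  finally show ?case unfolding defs(1-4) n(1) .
qed

end

section \<open>Highest weight modules\<close>

text \<open>Everything that reflections leave unchanged: weights, bicharacter, height, torus
  operators, weight spaces and the numbers m, the negatives of the off-diagonal Cartan entries.
  Roots, generators and highest weight are left to \<open>stage\<close>.\<close>

locale root_setting = vector_space scale
  for scale :: "complex \<Rightarrow> 'v::ab_group_add \<Rightarrow> 'v" (infixr "*s" 75) +
  fixes I :: "'i set" and chi :: "'w::comm_ring_1 \<Rightarrow> 'w \<Rightarrow> complex" and ht :: "'w \<Rightarrow> int"
    and Kl Kr :: "'w \<Rightarrow> 'v \<Rightarrow> 'v" and L :: "'w \<Rightarrow> 'v set" and q :: complex and N :: nat
    and m :: "'i \<Rightarrow> 'i \<Rightarrow> nat"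
  assumes finite_I: "finite I"
    and subspace_L': "subspace (L \<mu>)"
    and chi_add_left: "chi (x + y) z = chi x z * chi y z"
    and chi_add_right: "chi x (y + z) = chi x y * chi x z"
    and norm_chi: "norm (chi x y) = 1"
    and ht_add: "ht (x + y) = ht x + ht y"
    and linear_Kl: "lin_endo scale (Kl \<gamma>)"
    and linear_Kr: "lin_endo scale (Kr \<gamma>)"
    and Kl: "u \<in> L \<mu> \<Longrightarrow> Kl \<gamma> u = chi \<gamma> \<mu> *s u"
    and Kr: "u \<in> L \<mu> \<Longrightarrow> Kr \<gamma> u = chi \<mu> \<gamma> *s u"
    and q_order: "q ^ N = 1" "\<And>n. 0 < n \<Longrightarrow> n < N \<Longrightarrow> q ^ n \<noteq> 1" "2 \<le> N"
    and m_sym: "m i j = m j i" and m_less: "m i j < N"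
begin

lemma chi_nonzero: "chi x y \<noteq> 0"
  using norm_chi[of x y] by auto

lemma chi_zero: "chi 0 x = 1" "chi x 0 = 1"
  using chi_add_left[of 0 0 x] chi_add_right[of x 0 0] chi_nonzero[of 0 x] chi_nonzero[of x 0] by auto

lemma chi_uminus: "chi (- x) y = inverse (chi x y)" "chi x (- y) = inverse (chi x y)"
  using chi_add_left[of "- x" x y] chi_add_right[of x "- y" y] by (simp_all add: chi_zero chi_nonzero field_simps)

lemma chi_diff: "chi (x - y) z = chi x z / chi y z" "chi x (y - z) = chi x y / chi x z"
  using chi_add_left[of x "- y" z] chi_add_right[of x y "- z"] by (simp_all add: chi_uminus divide_inverse)

lemma chi_mult: "chi (of_nat n * x) y = chi x y ^ n" "chi x (of_nat n * y) = chi x y ^ n"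
  by (induction n) (simp_all add: chi_zero chi_add_left chi_add_right distrib_right)

lemma ht_zero: "ht 0 = 0"
  using ht_add[of 0 0] by simp

lemma ht_uminus: "ht (- x) = - ht x"
  using ht_add[of "- x" x] ht_zero by simp

lemma ht_mult: "ht (of_nat n * x) = int n * ht x"
  by (induction n) (simp_all add: ht_zero ht_add distrib_right)

lemma q_nonzero: "q \<noteq> 0"
  using q_order(1,3) by (auto simp: power_0_left)

text \<open>
  The factor \<open>2 powi ht \<gamma>\<close> makes the highest weight generic: \<open>A \<gamma> \<mu>\<close> and \<open>B \<gamma> \<mu>\<close> have different norms
  unless \<open>\<gamma>\<close> has height zero.
\<close>

definition A :: "'w \<Rightarrow> 'w \<Rightarrow> complex" where "A \<gamma> \<mu> = 2 powi ht \<gamma> * chi \<gamma> \<mu>"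

definition B :: "'w \<Rightarrow> 'w \<Rightarrow> complex" where "B \<gamma> \<mu> = inverse (chi \<mu> \<gamma>)"

lemma A_nonzero: "A \<gamma> \<mu> \<noteq> 0" and B_nonzero: "B \<gamma> \<mu> \<noteq> 0"
  by (simp_all add: A_def B_def chi_nonzero)

lemma A_add: "A (\<beta> + \<gamma>) \<mu> = A \<beta> \<mu> * A \<gamma> \<mu>" and B_add: "B (\<beta> + \<gamma>) \<mu> = B \<beta> \<mu> * B \<gamma> \<mu>"
  by (simp_all add: A_def B_def ht_add chi_add_left chi_add_right power_int_add)

lemma A_mult: "A (of_nat n * \<gamma>) \<mu> = A \<gamma> \<mu> ^ n" and B_mult: "B (of_nat n * \<gamma>) \<mu> = B \<gamma> \<mu> ^ n"
  by (simp_all add: A_def B_def ht_mult chi_mult power_mult_distrib power_inverse power_int_mult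
      power_int_power[symmetric] mult.commute[of "int n"])

lemma A_uminus: "A (- \<gamma>) \<mu> = inverse (A \<gamma> \<mu>)" and B_uminus: "B (- \<gamma>) \<mu> = inverse (B \<gamma> \<mu>)"
  by (simp_all add: A_def B_def ht_uminus chi_uminus power_int_minus)

text \<open>A submodule is the family of its weight components; simplicity is stated for such
  families, so no direct sum has to be formed.\<close>

definition graded_submodule ::
  "('i \<Rightarrow> 'w) \<Rightarrow> ('i \<Rightarrow> 'v \<Rightarrow> 'v) \<Rightarrow> ('i \<Rightarrow> 'v \<Rightarrow> 'v) \<Rightarrow> ('w \<Rightarrow> 'v set) \<Rightarrow> bool" where
  "graded_submodule \<alpha> E F Y \<longleftrightarrow> (\<forall>\<mu>. subspace (Y \<mu>) \<and> Y \<mu> \<subseteq> L \<mu>) \<and>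
     (\<forall>i\<in>I. \<forall>\<mu>. \<forall>x\<in>Y \<mu>. E i x \<in> Y (\<mu> - \<alpha> i) \<and> F i x \<in> Y (\<mu> + \<alpha> i))"

end

text \<open>
  The functionals \<open>c\<close> are the coordinates with respect to the roots \<open>\<alpha>\<close>, which need not be positive.
\<close>

locale stage = root_setting scale I chi ht Kl Kr L q N m
  for scale :: "complex \<Rightarrow> 'v::ab_group_add \<Rightarrow> 'v" (infixr "*s" 75)
    and I :: "'i set" and chi :: "'w::comm_ring_1 \<Rightarrow> 'w \<Rightarrow> complex" and ht Kl Kr L q N m +
  fixes \<alpha> :: "'i \<Rightarrow> 'w" and c :: "'i \<Rightarrow> 'w \<Rightarrow> int" and E F :: "'i \<Rightarrow> 'v \<Rightarrow> 'v" and w :: 'w and v :: 'v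
  assumes lin_E: "i \<in> I \<Longrightarrow> lin_endo scale (E i)"
    and lin_F: "i \<in> I \<Longrightarrow> lin_endo scale (F i)"
    and E_wt: "i \<in> I \<Longrightarrow> x \<in> L \<mu> \<Longrightarrow> E i x \<in> L (\<mu> - \<alpha> i)"
    and F_wt: "i \<in> I \<Longrightarrow> x \<in> L \<mu> \<Longrightarrow> F i x \<in> L (\<mu> + \<alpha> i)"
    and EF_rel: "i \<in> I \<Longrightarrow> j \<in> I \<Longrightarrow> x \<in> L \<mu> \<Longrightarrow>
       E i (F j x) = F j (E i x) + (if i = j then (A (\<alpha> i) \<mu> - B (\<alpha> i) \<mu>) *s x else 0)"
    and simple: "graded_submodule \<alpha> E F Y \<Longrightarrow> (\<forall>\<mu>. Y \<mu> \<subseteq> {0}) \<or> Y = L"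
    and c_add: "i \<in> I \<Longrightarrow> c i (\<mu> + \<nu>) = c i \<mu> + c i \<nu>"
    and c_\<alpha>: "i \<in> I \<Longrightarrow> j \<in> I \<Longrightarrow> c i (\<alpha> j) = (if i = j then 1 else 0)"
    and chi_self: "i \<in> I \<Longrightarrow> chi (\<alpha> i) (\<alpha> i) = q"
    and chi_pair: "i \<in> I \<Longrightarrow> j \<in> I \<Longrightarrow> i \<noteq> j \<Longrightarrow>
       chi (\<alpha> i) (\<alpha> j) * chi (\<alpha> j) (\<alpha> i) * q ^ m i j = 1"
    and v_wt: "v \<in> L w" and v_nonzero: "v \<noteq> 0" and E_v: "i \<in> I \<Longrightarrow> E i v = 0"
begin

sublocale double_relations scale I L \<alpha> E F "\<lambda>i. A (\<alpha> i)" "\<lambda>i. B (\<alpha> i)" "\<lambda>i j. chi (\<alpha> i) (\<alpha> j)"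
proof (intro double_relations.intro vector_space_axioms double_relations_axioms.intro)
  show "A (\<alpha> i) (\<mu> + \<alpha> j) = chi (\<alpha> i) (\<alpha> j) * A (\<alpha> i) \<mu>" for i j \<mu>
    by (simp add: A_def chi_add_right)
  show "B (\<alpha> i) \<mu> = chi (\<alpha> j) (\<alpha> i) * B (\<alpha> i) (\<mu> + \<alpha> j)" for i j \<mu>
    using chi_nonzero by (simp add: B_def chi_add_left field_simps)
qed (use lin_E lin_F E_wt F_wt EF_rel subspace_L' chi_nonzero in auto)

interpretation dual: double_relations scale I L "\<lambda>i. - \<alpha> i" F E "\<lambda>i. B (\<alpha> i)" "\<lambda>i. A (\<alpha> i)"
    "\<lambda>i j. chi (\<alpha> j) (\<alpha> i)"
  by (rule dual)

lemma c_zero: "i \<in> I \<Longrightarrow> c i 0 = 0"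
  using c_add[of i 0 0] by simp

lemma c_uminus: "i \<in> I \<Longrightarrow> c i (- \<mu>) = - c i \<mu>"
  using c_add[of i "- \<mu>" \<mu>] c_zero by simp

lemma c_diff: "i \<in> I \<Longrightarrow> c i (\<mu> - \<nu>) = c i \<mu> - c i \<nu>"
  using c_add[of i \<mu> "- \<nu>"] c_uminus by simp

lemma c_mult: "i \<in> I \<Longrightarrow> c i (of_nat n * \<mu>) = int n * c i \<mu>"
  by (induction n) (simp_all add: c_zero c_add distrib_right)

section \<open>Generated submodules and vanishing criteria\<close>

inductive gen :: "('w \<Rightarrow> 'v set) \<Rightarrow> 'w \<Rightarrow> 'v \<Rightarrow> bool" for S where
  base: "x \<in> S \<mu> \<Longrightarrow> gen S \<mu> x"
| step: "gen S \<mu> x \<Longrightarrow> i \<in> I \<Longrightarrow> gen S (\<mu> + \<alpha> i) (F i x)"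

lemma gen_L: "gen S \<mu> x \<Longrightarrow> (\<And>\<mu>. S \<mu> \<subseteq> L \<mu>) \<Longrightarrow> x \<in> L \<mu>"
  by (induction rule: gen.induct) (auto intro: F_wt)

text \<open>\<open>E k\<close> moves past each \<open>F i\<close> up to a scalar, hence the span of
  all F-words applied to an E-stable family is E-stable.\<close>

lemma graded_submodule_gen:
  assumes S: "\<And>\<mu>. S \<mu> \<subseteq> L \<mu>" and ES: "\<And>k \<mu> x. k \<in> I \<Longrightarrow> x \<in> S \<mu> \<Longrightarrow> E k x \<in> S (\<mu> - \<alpha> k)"
  shows "graded_submodule \<alpha> E F (\<lambda>\<mu>. span {x. gen S \<mu> x})"
proof -
  define Y where "Y = (\<lambda>\<mu>. span {x. gen S \<mu> x})"
  have Y: "subspace (Y \<mu>)" "Y \<mu> \<subseteq> L \<mu>" for \<mu>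
  proof -
    show "subspace (Y \<mu>)" unfolding Y_def by (rule subspace_span)
    show "Y \<mu> \<subseteq> L \<mu>" unfolding Y_def
      by (rule span_minimal[OF _ subspace_L']) (use gen_L[OF _ S] in blast)
  qed
  have FY: "F i x \<in> Y (\<mu> + \<alpha> i)" if "i \<in> I" "x \<in> Y \<mu>" for i \<mu> x
    using that(2) unfolding Y_def
    by (rule linear_span_subset[OF lin_F[OF that(1)] _ subspace_span, rotated])
      (auto intro: span_base step that(1))
  have EG: "E k x \<in> Y (\<mu> - \<alpha> k)" if k: "k \<in> I" and "gen S \<mu> x" for k \<mu> x
    using that(2)
  proof (induction rule: gen.induct)
    case (base x \<mu>)
    then show ?case using ES[OF k] by (auto simp: Y_def intro: span_base gen.base)
  next
    case (step \<mu> x i)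
    have "F i (E k x) \<in> Y (\<mu> - \<alpha> k + \<alpha> i)"
      by (intro FY step)
    moreover have "\<mu> - \<alpha> k + \<alpha> i = \<mu> + \<alpha> i - \<alpha> k" by simp
    moreover have "x \<in> Y \<mu>" using step(1) by (auto simp: Y_def intro: span_base)
    ultimately show ?case
      using EF_rel[OF k step(2) gen_L[OF step(1) S]]
      by (auto simp: subspace_add subspace_scale Y)
  qed
  have EY: "E k x \<in> Y (\<mu> - \<alpha> k)" if "k \<in> I" "x \<in> Y \<mu>" for k \<mu> x
    using that(2) unfolding Y_def
    by (rule linear_span_subset[OF lin_E[OF that(1)] _ subspace_span, rotated])
      (use EG[OF that(1)] in \<open>auto simp: Y_def\<close>)
  show ?thesis
    using Y EY FY unfolding Y_def[symmetric] graded_submodule_def by blast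
qed

text \<open>Every component contains 0 because E-stability of the family requires that
  \<open>E i v = 0\<close> lie in it.\<close>

definition top_set :: "'w \<Rightarrow> 'v set" where "top_set \<mu> = (if \<mu> = w then {v, 0} else {0})"

lemma L_eq: "L \<mu> = span {x. gen top_set \<mu> x}"
proof -
  have "graded_submodule \<alpha> E F (\<lambda>\<mu>. span {x. gen top_set \<mu> x})"
    by (rule graded_submodule_gen)
      (auto simp: top_set_def v_wt subspace_0[OF subspace_L'] E_v linear_simps(4)[OF lin_E] split: if_splits)
  moreover have "v \<in> span {x. gen top_set w x}"
    by (auto simp: top_set_def intro!: span_base gen.base)
  ultimately have "(\<lambda>\<mu>. span {x. gen top_set \<mu> x}) = L"
    using simple v_nonzero by blast
  then show ?thesis by metis
qed

lemma gen_top_weight: "gen top_set \<mu> x \<Longrightarrow> x = 0 \<or> (\<forall>k\<in>I. 0 \<le> c k (\<mu> - w))"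
proof (induction rule: gen.induct)
  case (base x \<mu>)
  then show ?case by (auto simp: top_set_def c_zero split: if_splits)
next
  case (step \<mu> x i)
  then show ?case
    by (auto simp: linear_simps(4)[OF lin_F] c_diff c_add c_\<alpha>)
qed

lemma L_vanish:
  assumes "k \<in> I" "c k (\<mu> - w) < 0" "x \<in> L \<mu>" shows "x = 0"
proof -
  have "{x. gen top_set \<mu> x} \<subseteq> {0}"
    using gen_top_weight[of \<mu>] assms(1,2) by force
  then have "span {x. gen top_set \<mu> x} \<subseteq> {0}"
    by (rule span_minimal) (rule subspace_single_0)
  then show ?thesis using assms(3) L_eq by blast
qed

text \<open>The image of Z is E-stable, so it generates a submodule whose nonzero components have a
  strictly larger k-th coordinate than w. This submodule misses v, and simplicity makes it
  zero.\<close>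

lemma raising_eq_zero:
  assumes lin: "lin_endo scale Z"
    and wt: "\<And>x \<mu>. x \<in> L \<mu> \<Longrightarrow> Z x \<in> L (\<mu> + \<gamma>)"
    and comm: "\<And>x \<mu> k. k \<in> I \<Longrightarrow> x \<in> L \<mu> \<Longrightarrow> E k (Z x) = Z (E k x)"
    and k: "k \<in> I" "0 < c k \<gamma>" and x: "x \<in> L \<mu>"
  shows "Z x = 0"
proof -
  define S where "S = (\<lambda>\<mu>. Z ` L (\<mu> - \<gamma>))"
  have S: "S \<mu> \<subseteq> L \<mu>" for \<mu> using wt[of _ "\<mu> - \<gamma>"] by (auto simp: S_def)
  have ES: "E k x \<in> S (\<mu> - \<alpha> k)" if k: "k \<in> I" and x: "x \<in> S \<mu>" for k x \<mu>
  proof -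
    obtain y where y: "y \<in> L (\<mu> - \<gamma>)" "x = Z y" using x by (auto simp: S_def)
    have "E k y \<in> L (\<mu> - \<gamma> - \<alpha> k)" by (intro E_wt k y)
    moreover have "\<mu> - \<gamma> - \<alpha> k = \<mu> - \<alpha> k - \<gamma>" by simp
    ultimately show ?thesis using comm[OF k y(1)] y(2) by (auto simp: S_def)
  qed
  have sub: "graded_submodule \<alpha> E F (\<lambda>\<mu>. span {x. gen S \<mu> x})"
    using S ES by (rule graded_submodule_gen)
  have *: "x = 0 \<or> 0 < c k (\<mu> - w)" if "gen S \<mu> x" for x \<mu>
    using that
  proof (induction rule: gen.induct)
    case (base x \<mu>)
    then obtain y where y: "y \<in> L (\<mu> - \<gamma>)" "x = Z y" by (auto simp: S_def)
    show ?case
    proof (cases "y = 0")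
      case False
      then have "\<not> c k (\<mu> - \<gamma> - w) < 0" using L_vanish[OF k(1) _ y(1)] by blast
      then show ?thesis using k by (simp add: c_diff)
    qed (simp add: y linear_simps(4)[OF lin])
  next
    case (step \<mu> x i)
    then show ?case
      using k(1) by (auto simp: linear_simps(4)[OF lin_F] c_diff c_add c_\<alpha>)
  qed
  have "{x. gen S w x} \<subseteq> {0}"
    using * k c_zero by force
  then have "span {x. gen S w x} \<subseteq> {0}"
    by (rule span_minimal) (rule subspace_single_0)
  then have "(\<lambda>\<mu>. span {x. gen S \<mu> x}) \<noteq> L"
    using v_wt v_nonzero by blast
  then have "span {x. gen S (\<mu> + \<gamma>) x} \<subseteq> {0}"
    using simple[OF sub] by blast
  moreover have "Z x \<in> span {x. gen S (\<mu> + \<gamma>) x}"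
    using x by (auto simp: S_def intro!: span_base gen.base)
  ultimately show ?thesis by blast
qed

text \<open>Z kills v because no weight lies below w in direction k, and since it commutes with all
  F it kills everything that they generate from v.\<close>

lemma lowering_eq_zero:
  assumes lin: "lin_endo scale Z"
    and wt: "\<And>x \<mu>. x \<in> L \<mu> \<Longrightarrow> Z x \<in> L (\<mu> - \<gamma>)"
    and comm: "\<And>x \<mu> k. k \<in> I \<Longrightarrow> x \<in> L \<mu> \<Longrightarrow> F k (Z x) = Z (F k x)"
    and k: "k \<in> I" "0 < c k \<gamma>" and x: "x \<in> L \<mu>"
  shows "Z x = 0"
proof -
  have top_L: "top_set \<mu> \<subseteq> L \<mu>" for \<mu>
    by (simp add: top_set_def v_wt subspace_0[OF subspace_L'])
  have "Z x = 0" if "gen top_set \<mu> x" for x \<mu>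
    using that
  proof (induction rule: gen.induct)
    case (base x \<mu>)
    have "Z v \<in> L (w - \<gamma>)" by (intro wt v_wt)
    then have "Z v = 0" using L_vanish[OF k(1), of "w - \<gamma>"] k by (simp add: c_diff c_uminus)
    then show ?case using base linear_simps(4)[OF lin] by (auto simp: top_set_def split: if_splits)
  next
    case (step \<mu> x i)
    then show ?case
      using comm[OF step(2) gen_L[OF step(1) top_L]] linear_simps(4)[OF lin_F] by simp
  qed
  note 1 = this
  have "Z x \<in> {0}"
    by (rule linear_span_subset[OF lin _ subspace_single_0, of "{x. gen top_set \<mu> x}"])
      (use 1 x L_eq[of \<mu>] in auto)
  then show ?thesis by simp
qed

end

section \<open>Reflections\<close>

context stage begin

interpretation dual: double_relations scale I L "\<lambda>i. - \<alpha> i" F E "\<lambda>i. B (\<alpha> i)" "\<lambda>i. A (\<alpha> i)"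
    "\<lambda>i j. chi (\<alpha> j) (\<alpha> i)"
  by (rule dual)

section \<open>Nilpotency and quantum Serre relations\<close>

lemma q_nat_order: "q_nat q N = 0" "q_nat (inverse q) N = 0"
proof -
  have *: "q_nat z N = 0" if "z ^ N = 1" "z \<noteq> 1" for z :: complex
  proof -
    have "(1 - z) * q_nat z N = 1 - z ^ N"
      unfolding q_nat_def by (rule one_diff_power_eq[symmetric])
    then show ?thesis using that by simp
  qed
  have "q \<noteq> 1" using q_order(2)[of 1] q_order(3) by auto
  then show "q_nat q N = 0" "q_nat (inverse q) N = 0"
    using q_order(1) by (auto intro!: * simp: power_inverse)
qed

lemma q_nat_nonzero': "0 < n \<Longrightarrow> n < N \<Longrightarrow> q_nat q n \<noteq> 0 \<and> q_nat (inverse q) n \<noteq> 0"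
  using q_order(2)[of n] by (auto intro!: q_nat_nonzero simp: power_inverse)

text \<open>The q-integers of N in q and in 1/q vanish, so this power commutes with every
  \<open>E k\<close>, while it raises the degree.\<close>

lemma F_power_N:
  assumes "i \<in> I" "x \<in> L \<mu>" shows "(F i ^^ N) x = 0"
proof (rule raising_eq_zero[OF linear_F_power[OF assms(1)] F_power_weight[OF assms(1)] _ assms(1) _ assms(2)])
  fix x \<mu> k assume k: "k \<in> I" and x: "x \<in> L \<mu>"
  show "E k ((F i ^^ N) x) = (F i ^^ N) (E k x)"
  proof (cases "k = i")
    case True
    then show ?thesis
      using E_F_power[OF k x, of N] chi_self[OF k] by (simp add: q_nat_order)
  qed (use E_F_power_other assms(1) k x in blast)
qed (use assms q_order(3) in \<open>simp_all add: c_mult c_\<alpha>\<close>)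

lemma chi_pair':
  assumes "i \<in> I" "j \<in> I" "i \<noteq> j"
  shows "chi (\<alpha> i) (\<alpha> j) * chi (\<alpha> j) (\<alpha> i) * q ^ n = 1 \<longleftrightarrow> q ^ n = q ^ m i j"
  using chi_pair[OF assms] chi_nonzero by (metis mult_cancel_left mult_eq_0_iff zero_neq_one)

lemma \<kappa>_top:
  assumes ij: "i \<in> I" "j \<in> I" "i \<noteq> j" shows "\<kappa> i j (Suc (m i j)) = 0"
  using \<kappa>_alt[OF ij(1,2), of "m i j"] chi_self[OF ij(1)] chi_pair[OF ij] chi_nonzero by simp

lemma q_power_inj: "r < n \<Longrightarrow> n < N \<Longrightarrow> q ^ r \<noteq> q ^ n"
  using q_order(2)[of "n - r"] q_nonzero power_add[of q r "n - r"] by auto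

text \<open>Below \<open>m i j\<close> neither factor of \<open>\<kappa>_alt\<close> vanishes, since
  \<open>m i j < N\<close> and q has exact order N.\<close>

lemma \<kappa>_nonzero:
  assumes ij: "i \<in> I" "j \<in> I" "i \<noteq> j" and n: "n < m i j" shows "\<kappa> i j (Suc n) \<noteq> 0"
  using \<kappa>_alt[OF ij(1,2), of n] chi_self[OF ij(1)] chi_pair'[OF ij, of n]
    q_power_inj[OF n m_less] q_nat_nonzero'[of "Suc n"] m_less[of i j] n by auto

lemma \<xi>_top:
  assumes ij: "i \<in> I" "j \<in> I" "i \<noteq> j" shows "\<xi> i j (Suc (m i j)) = 0"
  using chi_self[OF ij(1)] chi_pair[OF ij] by (simp add: \<xi>_def)

lemma ad_const_nonzero:
  assumes ij: "i \<in> I" "j \<in> I" "i \<noteq> j" shows "ad_const i j (m i j) (m i j) \<noteq> 0"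
proof -
  have "1 - chi (\<alpha> i) (\<alpha> j) * chi (\<alpha> j) (\<alpha> i) * q ^ r \<noteq> 0" if "r < m i j" for r
    using chi_pair'[OF ij, of r] q_power_inj[OF that m_less] by auto
  moreover have "q_nat q (m i j - r) \<noteq> 0" if "r < m i j" for r
    using q_nat_nonzero'[of "m i j - r"] that m_less[of i j] by (auto simp: less_imp_diff_less)
  ultimately show ?thesis
    using chi_self[OF ij(1)] by (simp add: ad_const_def \<xi>_def)
qed

text \<open>Quantum Serre relation. The obstructions to commuting with E vanish one step above
  \<open>m i j\<close>: the scalar \<kappa> for k = i and the product \<xi> for k = j; for other k
  there is none.\<close>

lemma Fad_top:
  assumes ij: "i \<in> I" "j \<in> I" "i \<noteq> j" and x: "x \<in> L \<mu>" shows "Fad i j (Suc (m i j)) x = 0"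
proof (rule raising_eq_zero[OF linear_Fad[OF ij(1,2)] Fad_weight[OF ij(1,2)] _ ij(2) _ x])
  fix x \<mu> k assume k: "k \<in> I" and x: "x \<in> L \<mu>"
  consider "k = i" | "k = j" | "k \<noteq> i" "k \<noteq> j" by blast
  then show "E k (Fad i j (Suc (m i j)) x) = Fad i j (Suc (m i j)) (E k x)"
  proof cases
    case 1
    then show ?thesis using E_Fad[OF ij x, of "Suc (m i j)"] \<kappa>_top[OF ij]
      by (simp del: braided_ad.simps)
  next
    case 2
    then show ?thesis using E_Fad_same[OF ij x, of "m i j"] \<xi>_top[OF ij]
      by (simp del: braided_ad.simps funpow.simps)
  next
    case 3
    then show ?thesis using E_Fad_other[OF ij(1,2) k 3 x] by blast
  qed
qed (use ij in \<open>simp_all add: c_add c_mult c_\<alpha> del: of_nat_Suc\<close>)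

lemma dual_\<kappa>:
  assumes ij: "i \<in> I" "j \<in> I" "i \<noteq> j"
  shows "dual.\<kappa> i j (Suc (m i j)) = 0" "n < m i j \<Longrightarrow> dual.\<kappa> i j (Suc n) \<noteq> 0"
  using dual.\<kappa>_alt[OF ij(1,2), of "m i j"] chi_self[OF ij(1)] chi_pair[OF ij] chi_nonzero
    dual.\<kappa>_alt[OF ij(1,2), of n] chi_pair'[OF ij, of n]
    q_power_inj[OF _ m_less, of n i j] q_nat_nonzero'[of "Suc n"] m_less[of i j]
  by (auto simp: mult.commute)

lemma Ead_top:
  assumes ij: "i \<in> I" "j \<in> I" "i \<noteq> j" and x: "x \<in> L \<mu>" shows "Ead i j (Suc (m i j)) x = 0"
proof (rule lowering_eq_zero[OF linear_Ead[OF ij(1,2)] Ead_weight[OF ij(1,2)] _ ij(2) _ x])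
  fix x \<mu> k assume k: "k \<in> I" and x: "x \<in> L \<mu>"
  consider "k = i" | "k = j" | "k \<noteq> i" "k \<noteq> j" by blast
  then show "F k (Ead i j (Suc (m i j)) x) = Ead i j (Suc (m i j)) (F k x)"
  proof cases
    case 1
    then show ?thesis using dual.E_Fad[OF ij x, of "Suc (m i j)"] dual_\<kappa>(1)[OF ij]
      by (simp del: braided_ad.simps)
  next
    case 2
    have "dual.\<xi> i j (Suc (m i j)) = 0"
      using \<xi>_top[OF ij] by (simp add: dual.\<xi>_def \<xi>_def mult.commute)
    then show ?thesis using dual.E_Fad_same[OF ij x, of "m i j"] 2
      by (simp del: braided_ad.simps funpow.simps)
  next
    case 3
    then show ?thesis using dual.E_Fad_other[OF ij(1,2) k 3 x] by blast
  qed
qed (use ij in \<open>simp_all add: c_add c_mult c_\<alpha> del: of_nat_Suc\<close>)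

section \<open>Reflected roots, coordinates and generators\<close>

definition r_\<alpha> :: "'i \<Rightarrow> 'i \<Rightarrow> 'w" where
  "r_\<alpha> i j = (if j = i then - \<alpha> i else \<alpha> j + of_nat (m i j) * \<alpha> i)"

text \<open>Coordinates dual to \<open>r_\<alpha> i\<close>, found by substituting
  \<open>\<alpha> i = - r_\<alpha> i i\<close> and
  \<open>\<alpha> j = r_\<alpha> i j + m i j * r_\<alpha> i i\<close>.\<close>

definition r_c :: "'i \<Rightarrow> 'i \<Rightarrow> 'w \<Rightarrow> int" where
  "r_c i k = (if k = i then \<lambda>\<mu>. (\<Sum>j\<in>I - {i}. int (m i j) * c j \<mu>) - c i \<mu> else c k)"

text \<open>
  The factors \<open>Kl\<close> and \<open>Kr\<close> normalise the exchanged generators such that their commutator has again the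
  form \<open>A - B\<close>, now for the root \<open>- \<alpha> i\<close>.
\<close>

definition r_E :: "'i \<Rightarrow> 'i \<Rightarrow> 'v \<Rightarrow> 'v" where
  "r_E i j = (if j = i then \<lambda>x. (2 powi (- ht (\<alpha> i))) *s F i (Kl (- \<alpha> i) x)
     else (\<lambda>x. inverse (ad_const i j (m i j) (m i j)) *s Ead i j (m i j) x))"

definition r_F :: "'i \<Rightarrow> 'i \<Rightarrow> 'v \<Rightarrow> 'v" where
  "r_F i j = (if j = i then \<lambda>x. Kr (\<alpha> i) (E i x) else Fad i j (m i j))"

lemma linear_compose_scale:
  assumes "lin_endo scale f" "lin_endo scale g"
  shows "lin_endo scale (\<lambda>x. d *s f (g x))"
  by (simp add: Vector_Spaces.linear_iff vector_space_axioms linear_simps[OF assms(1)]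
      linear_simps[OF assms(2)] scale_right_distrib mult.commute)

lemma linear_r_E: "i \<in> I \<Longrightarrow> j \<in> I \<Longrightarrow> lin_endo scale (r_E i j)"
  using linear_compose_scale[OF lin_F linear_Kl] linear_compose_scale[OF linear_Ead linear_ident]
  by (auto simp: r_E_def)

lemma linear_r_F: "i \<in> I \<Longrightarrow> j \<in> I \<Longrightarrow> lin_endo scale (r_F i j)"
  using linear_compose_scale[OF linear_Kr lin_E, of _ 1] linear_Fad by (auto simp: r_F_def)

lemma r_E_self: "i \<in> I \<Longrightarrow> x \<in> L \<mu> \<Longrightarrow> r_E i i x = inverse (A (\<alpha> i) \<mu>) *s F i x"
  by (simp add: r_E_def Kl linear_simps[OF lin_F] A_def chi_uminus power_int_minus)

lemma r_F_self: "i \<in> I \<Longrightarrow> x \<in> L \<mu> \<Longrightarrow> r_F i i x = inverse (B (\<alpha> i) (\<mu> - \<alpha> i)) *s E i x"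
  using E_wt[of i x \<mu>] by (simp add: r_F_def Kr B_def)

lemma r_E_wt:
  assumes "i \<in> I" "j \<in> I" "x \<in> L \<mu>" shows "r_E i j x \<in> L (\<mu> - r_\<alpha> i j)"
proof (cases "j = i")
  case True
  then show ?thesis
    using F_wt[of i x \<mu>] assms by (simp add: r_E_self r_\<alpha>_def subspace_scale[OF subspace_L'])
next
  case False
  then show ?thesis
    using Ead_weight[OF assms, of "m i j"] by (simp add: r_E_def r_\<alpha>_def subspace_scale[OF subspace_L'])
qed

lemma r_F_wt:
  assumes "i \<in> I" "j \<in> I" "x \<in> L \<mu>" shows "r_F i j x \<in> L (\<mu> + r_\<alpha> i j)"
proof (cases "j = i")
  case True
  then show ?thesis
    using E_wt[of i x \<mu>] assms by (simp add: r_F_self r_\<alpha>_def subspace_scale[OF subspace_L'])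
next
  case False
  then show ?thesis
    using Fad_weight[OF assms, of "m i j"] by (simp add: r_F_def r_\<alpha>_def)
qed

lemma A_wt: "A \<gamma> (\<mu> + \<nu>) = chi \<gamma> \<nu> * A \<gamma> \<mu>" "A \<gamma> (\<mu> - \<nu>) = inverse (chi \<gamma> \<nu>) * A \<gamma> \<mu>"
  and B_wt: "B \<gamma> (\<mu> + \<nu>) = inverse (chi \<nu> \<gamma>) * B \<gamma> \<mu>" "B \<gamma> (\<mu> - \<nu>) = chi \<nu> \<gamma> * B \<gamma> \<mu>"
  by (simp_all add: A_def B_def chi_add_left chi_add_right chi_diff divide_inverse)

text \<open>Pairs containing i once use the Serre relations, two distinct indices other than i use
  \<open>Ead_Fad_other\<close>, and equal indices other than i reproduce the relation because A and
  B are multiplicative in the root.\<close>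

lemma r_EF:
  assumes i: "i \<in> I" and jk: "j \<in> I" "k \<in> I" and x: "x \<in> L \<mu>"
  shows "r_E i j (r_F i k x) = r_F i k (r_E i j x)
     + (if j = k then (A (r_\<alpha> i j) \<mu> - B (r_\<alpha> i j) \<mu>) *s x else 0)"
proof -
  have cancel: "inverse (d * d') *s d *s y = inverse d' *s y" if "d \<noteq> 0" for d d' y
    using that by simp
  consider "j = i" "k = i" | "j = i" "k \<noteq> i" | "j \<noteq> i" "k = i" | "j \<noteq> i" "k \<noteq> i" "j \<noteq> k"
    | "j \<noteq> i" "k \<noteq> i" "j = k" by blast
  then show ?thesis
  proof cases
    case 1
    have "r_E i i (r_F i i x) = (inverse (A (\<alpha> i) (\<mu> - \<alpha> i)) * inverse (B (\<alpha> i) (\<mu> - \<alpha> i))) *s F i (E i x)"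
      using r_E_self[OF i E_wt[OF i x]] linear_simps(3)[OF linear_r_E[OF i i]]
      by (simp add: r_F_self[OF i x] mult.commute)
    moreover have "r_F i i (r_E i i x) = (inverse (A (\<alpha> i) \<mu>) * inverse (B (\<alpha> i) \<mu>)) *s E i (F i x)"
      using r_F_self[OF i F_wt[OF i x]] linear_simps(3)[OF linear_r_F[OF i i]]
      by (simp add: r_E_self[OF i x])
    moreover have "inverse (A (\<alpha> i) (\<mu> - \<alpha> i)) * inverse (B (\<alpha> i) (\<mu> - \<alpha> i))
        = inverse (A (\<alpha> i) \<mu>) * inverse (B (\<alpha> i) \<mu>)"
      using chi_nonzero[of "\<alpha> i" "\<alpha> i"] by (simp add: A_wt B_wt)
    moreover have "(inverse (A (\<alpha> i) \<mu>) * inverse (B (\<alpha> i) \<mu>)) * (A (\<alpha> i) \<mu> - B (\<alpha> i) \<mu>)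
        = - (inverse (A (\<alpha> i) \<mu>) - inverse (B (\<alpha> i) \<mu>))"
      using A_nonzero B_nonzero by (simp add: field_simps)
    moreover have "(d - d') *s x + (d' - d) *s x = 0" for d d'
      by (simp add: scale_left_diff_distrib)
    ultimately show ?thesis
      using 1 EF_rel[OF i i x] by (simp add: r_\<alpha>_def A_uminus B_uminus scale_right_distrib)
  next
    case 2
    let ?n = "m i k"
    \<comment> \<open>The Serre relation is a twisted commutation whose scalar is exactly the change
      of \<open>A (\<alpha> i)\<close> on the weight raised by \<alpha> k + m \<alpha> i.\<close>
    have z: "F i (Fad i k ?n x) = (chi (\<alpha> i) (\<alpha> k) * q ^ ?n) *s Fad i k ?n (F i x)"
      using Fad_top[OF i jk(2) 2(2)[symmetric] x] chi_self[OF i] by simp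
    have "r_E i i (Fad i k ?n x) = inverse (chi (\<alpha> i) (\<alpha> k) * q ^ ?n * A (\<alpha> i) \<mu>) *s F i (Fad i k ?n x)"
      using r_E_self[OF i Fad_weight[OF i jk(2) x, of ?n]] chi_self[OF i]
      by (simp add: A_wt chi_add_right chi_mult)
    also have "\<dots> = inverse (A (\<alpha> i) \<mu>) *s Fad i k ?n (F i x)"
      unfolding z by (rule cancel) (simp add: chi_nonzero q_nonzero)
    finally show ?thesis
      using 2 linear_simps(3)[OF linear_Fad[OF i jk(2)]] by (simp add: r_F_def r_E_self[OF i x])
  next
    case 3
    let ?n = "m i j"
    have z: "E i (Ead i j ?n x) = (chi (\<alpha> j) (\<alpha> i) * q ^ ?n) *s Ead i j ?n (E i x)"
      using Ead_top[OF i jk(1) 3(1)[symmetric] x] chi_self[OF i] by simp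
    have "r_F i i (Ead i j ?n x) = inverse (chi (\<alpha> j) (\<alpha> i) * q ^ ?n * B (\<alpha> i) (\<mu> - \<alpha> i)) *s E i (Ead i j ?n x)"
      using r_F_self[OF i Ead_weight[OF i jk(1) x, of ?n]] chi_self[OF i]
      by (simp add: B_wt chi_add_left chi_mult, (simp add: mult_ac)?)
    also have "\<dots> = inverse (B (\<alpha> i) (\<mu> - \<alpha> i)) *s Ead i j ?n (E i x)"
      unfolding z by (rule cancel) (simp add: chi_nonzero q_nonzero)
    finally show ?thesis
      using 3 linear_simps(3)[OF linear_Ead[OF i jk(1)]] linear_simps(3)[OF linear_r_F[OF i i]]
      by (simp add: r_E_def r_F_self[OF i x] mult.commute)
  next
    case 4
    then show ?thesis
      using Ead_Fad_other[OF i jk _ _ _ x, of "m i j" "m i k"] linear_simps(3)[OF linear_Fad[OF i jk(2)]]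
      by (auto simp: r_E_def r_F_def)
  next
    case 5
    let ?c = "ad_const i j (m i j) (m i j)"
    have AB: "A (r_\<alpha> i j) \<mu> = A (\<alpha> i) \<mu> ^ m i j * A (\<alpha> j) \<mu>"
      "B (r_\<alpha> i j) \<mu> = B (\<alpha> i) \<mu> ^ m i j * B (\<alpha> j) \<mu>"
      using 5 by (simp_all add: r_\<alpha>_def A_add B_add A_mult B_mult)
    have "Ead i j (m i j) (Fad i j (m i j) x) = Fad i j (m i j) (Ead i j (m i j) x)
       + (?c * (A (r_\<alpha> i j) \<mu> - B (r_\<alpha> i j) \<mu>)) *s x"
      using Ead_Fad_same[OF i jk(1) 5(1)[symmetric] x order_refl, of "m i j"]
      unfolding AB by (simp only: refl if_True)
    then show ?thesis
      using 5 ad_const_nonzero[OF i jk(1) 5(1)[symmetric]] linear_simps(3)[OF linear_Fad[OF i jk(1)]]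
      by (simp add: r_E_def r_F_def scale_right_distrib)
  qed
qed

text \<open>This carries simplicity over to the new generators. On weight spaces the new generators
  at i are nonzero multiples of \<open>F i\<close> and \<open>E i\<close>, and the other old
  generators come back by descent from the top braided commutators.\<close>

lemma r_graded_submodule:
  assumes i: "i \<in> I" and Y: "graded_submodule (r_\<alpha> i) (r_E i) (r_F i) Y"
  shows "graded_submodule \<alpha> E F Y"
proof -
  have sub: "subspace (Y \<mu>)" and L: "Y \<mu> \<subseteq> L \<mu>" for \<mu>
    using Y by (auto simp: graded_submodule_def)
  have rE: "r_E i j x \<in> Y (\<mu> - r_\<alpha> i j)" and rF: "r_F i j x \<in> Y (\<mu> + r_\<alpha> i j)"
    if "j \<in> I" "x \<in> Y \<mu>" for j x \<mu>
    using Y that by (auto simp: graded_submodule_def)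
  have unscale: "x \<in> Y \<mu>" if "d *s x \<in> Y \<mu>" "d \<noteq> 0" for d x \<mu>
    using subspace_scale[OF sub that(1), of "inverse d"] that(2) by simp
  have Ei: "E i x \<in> Y (\<mu> - \<alpha> i)" if x: "x \<in> Y \<mu>" for x \<mu>
    using rF[OF i x] r_F_self[OF i L[THEN subsetD, OF x]] B_nonzero
    by (auto simp: r_\<alpha>_def intro: unscale)
  have Fi: "F i x \<in> Y (\<mu> + \<alpha> i)" if x: "x \<in> Y \<mu>" for x \<mu>
    using rE[OF i x] r_E_self[OF i L[THEN subsetD, OF x]] A_nonzero
    by (auto simp: r_\<alpha>_def intro: unscale)
  have Fj: "F j x \<in> Y (\<mu> + \<alpha> j)" if j: "j \<in> I" "j \<noteq> i" and x: "x \<in> Y \<mu>" for j x \<mu>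
  proof (rule Fad_descent[OF i j(1) j(2)[symmetric] sub L Ei _ \<kappa>_nonzero[OF i j(1) j(2)[symmetric]] B_nonzero x])
    show "Fad i j (m i j) x \<in> Y (\<mu> + (\<alpha> j + of_nat (m i j) * \<alpha> i))" if "x \<in> Y \<mu>" for x \<mu>
      using rF[OF j(1) that] j(2) by (simp add: r_F_def r_\<alpha>_def)
  qed
  have Ej: "E j x \<in> Y (\<mu> - \<alpha> j)" if j: "j \<in> I" "j \<noteq> i" and x: "x \<in> Y \<mu>" for j x \<mu>
  proof -
    note ij = i j(1) j(2)[symmetric]
    have Fi': "F i x \<in> Y (\<mu> - - \<alpha> i)" if "x \<in> Y \<mu>" for x \<mu>
      using Fi[OF that] by simp
    have "E j x \<in> Y (\<mu> + - \<alpha> j)"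
    proof (rule dual.Fad_descent[OF ij sub L Fi' _ dual_\<kappa>(2)[OF ij] A_nonzero x])
      fix x \<mu> assume x: "x \<in> Y \<mu>"
      have "Ead i j (m i j) x \<in> Y (\<mu> - (\<alpha> j + of_nat (m i j) * \<alpha> i))"
        by (rule unscale[of "inverse (ad_const i j (m i j) (m i j))"])
          (use rE[OF j(1) x] j(2) ad_const_nonzero[OF ij] in \<open>auto simp: r_E_def r_\<alpha>_def\<close>)
      moreover have "\<mu> - (\<alpha> j + of_nat (m i j) * \<alpha> i) = \<mu> + (- \<alpha> j + of_nat (m i j) * - \<alpha> i)"
        by (simp add: algebra_simps)
      ultimately show "Ead i j (m i j) x \<in> Y (\<mu> + (- \<alpha> j + of_nat (m i j) * - \<alpha> i))" by (simp only:)
    qed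
    then show ?thesis by simp
  qed
  show ?thesis
    unfolding graded_submodule_def using sub L Ei Fi Ej Fj by metis
qed

text \<open>\<open>E i\<close> maps \<open>F i ^ (n + 1) v\<close> to a multiple of
  \<open>F i ^ n v\<close>. Times q^n, the scalar is a nonzero q-integer times q^n A - B, and these
  two terms have moduli \<open>2 powi ht (\<alpha> i)\<close> and 1.\<close>

lemma F_power_v_nonzero:
  assumes i: "i \<in> I" and ht: "ht (\<alpha> i) \<noteq> 0"
  shows "n < N \<Longrightarrow> (F i ^^ n) v \<noteq> 0"
proof (induction n)
  case (Suc n)
  let ?A = "A (\<alpha> i) w" and ?B = "B (\<alpha> i) w"
  have "norm (q ^ n * ?A) \<noteq> norm ?B"
  proof -
    have "norm q = 1" using norm_chi[of "\<alpha> i" "\<alpha> i"] chi_self[OF i] by simp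
    moreover have "2 powi ht (\<alpha> i) \<noteq> (1 :: real)"
      using ht power_int_strict_increasing[of 0 "ht (\<alpha> i)" "2 :: real"]
        power_int_strict_increasing[of "ht (\<alpha> i)" 0 "2 :: real"] by (cases "ht (\<alpha> i) > 0") auto
    ultimately show ?thesis
      by (simp add: A_def B_def norm_mult norm_chi norm_inverse norm_power norm_power_int)
  qed
  then have ne: "q ^ n * ?A - ?B \<noteq> 0" by auto
  have "q ^ n * (q_nat q (Suc n) * ?A - q_nat (inverse q) (Suc n) * ?B)
      = q_nat q (Suc n) * (q ^ n * ?A - ?B)"
    using q_nat_inverse[OF q_nonzero, of n] by (simp add: algebra_simps)
  also have "\<dots> \<noteq> 0"
    using ne q_nat_nonzero'[of "Suc n"] Suc.prems by simp
  finally have "q_nat q (Suc n) * ?A - q_nat (inverse q) (Suc n) * ?B \<noteq> 0" by auto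
  then have "E i ((F i ^^ Suc n) v) \<noteq> 0"
    using E_F_power[OF i v_wt, of "Suc n"] Suc E_v[OF i] chi_self[OF i] linear_simps(4)[OF linear_F_power[OF i]]
    by (simp del: funpow.simps)
  then show ?case using linear_simps(4)[OF lin_E[OF i]] by auto
qed (simp add: v_nonzero)

text \<open>\<open>F i ^ (N - 1) v\<close> ends the i-string of v, so \<open>r_E i i\<close>, a
  multiple of \<open>F i\<close> on weight spaces, kills it. The other \<open>r_E i j\<close> kill
  it for weight reasons.\<close>

theorem reflection:
  assumes i: "i \<in> I" and ht: "ht (\<alpha> i) \<noteq> 0"
  shows "stage scale I chi ht Kl Kr L q N m (r_\<alpha> i) (r_c i) (r_E i) (r_F i)
    (w + of_nat (N - 1) * \<alpha> i) ((F i ^^ (N - 1)) v)"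
proof (intro stage.intro root_setting_axioms stage_axioms.intro)
  fix j assume j: "j \<in> I"
  show "lin_endo scale (r_E i j)" "lin_endo scale (r_F i j)"
    using linear_r_E linear_r_F i j by auto
  show "r_c i j (\<mu> + \<nu>) = r_c i j \<mu> + r_c i j \<nu>" for \<mu> \<nu>
    using c_add i j by (simp add: r_c_def sum.distrib algebra_simps)
  show "chi (r_\<alpha> i j) (r_\<alpha> i j) = q"
  proof (cases "j = i")
    case False
    \<comment> \<open>Expansion gives the exponent 1 + m^2 of q, and m^2 is absorbed by the m-th
      power of the pairing relation.\<close>
    have "chi (r_\<alpha> i j) (r_\<alpha> i j)
      = q * (chi (\<alpha> i) (\<alpha> j) * chi (\<alpha> j) (\<alpha> i) * q ^ m i j) ^ m i j"
      using False chi_self i j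
      by (simp add: r_\<alpha>_def chi_add_left chi_add_right chi_mult, (simp add: power_mult_distrib mult_ac flip: power_mult)?)
    then show ?thesis using chi_pair[OF i j] False by simp
  qed (simp add: r_\<alpha>_def chi_uminus chi_self i)
  have v': "(F i ^^ (N - 1)) v \<in> L (w + of_nat (N - 1) * \<alpha> i)"
    by (rule F_power_weight[OF i v_wt])
  show "r_E i j ((F i ^^ (N - 1)) v) = 0"
  proof (cases "j = i")
    case True
    have "F i ((F i ^^ (N - 1)) v) = (F i ^^ Suc (N - 1)) v" by simp
    also have "\<dots> = 0" using F_power_N[OF i v_wt] q_order(3) by simp
    finally show ?thesis using True r_E_self[OF i v'] by simp
  next
    case False
    \<comment> \<open>Relative to w the weight of the image has j-th coordinate -1.\<close>
    show ?thesis
      by (rule L_vanish[OF j _ r_E_wt[OF i j v']])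
        (use False i j in \<open>simp add: r_\<alpha>_def c_add c_diff c_mult c_uminus c_\<alpha>\<close>)
  qed
  fix k assume k: "k \<in> I"
  show "r_c i j (r_\<alpha> i k) = (if j = k then 1 else 0)"
  proof (cases "j = i")
    case True
    have "(\<Sum>l\<in>I - {i}. int (m i l) * c l (r_\<alpha> i k)) = (\<Sum>l\<in>I - {i}. if k = l then int (m i l) else 0)"
      using i k by (intro sum.cong) (auto simp: r_\<alpha>_def c_add c_mult c_uminus c_\<alpha>)
    also have "\<dots> = (if k = i then 0 else int (m i k))"
      using k finite_I by (auto simp: sum.delta)
    finally show ?thesis
      using True i k by (simp add: r_c_def) (auto simp: r_\<alpha>_def c_add c_mult c_uminus c_\<alpha>)
  next
    case False
    then show ?thesis
      using i j k by (simp add: r_c_def) (auto simp: r_\<alpha>_def c_add c_mult c_uminus c_\<alpha>)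
  qed
  assume "j \<noteq> k"
  then consider "j = i" "k \<noteq> i" | "k = i" "j \<noteq> i" | "j \<noteq> i" "k \<noteq> i" by blast
  then show "chi (r_\<alpha> i j) (r_\<alpha> i k) * chi (r_\<alpha> i k) (r_\<alpha> i j) * q ^ m j k = 1"
  proof cases
    case 1
    have "chi (r_\<alpha> i j) (r_\<alpha> i k) * chi (r_\<alpha> i k) (r_\<alpha> i j) * q ^ m j k
      = inverse (chi (\<alpha> i) (\<alpha> k) * chi (\<alpha> k) (\<alpha> i) * q ^ m i k)"
      using 1 chi_self[OF i] q_nonzero
      by (simp add: r_\<alpha>_def chi_add_left chi_add_right chi_mult chi_uminus, simp add: field_simps)
    then show ?thesis using chi_pair[OF i k] 1 by simp
  next
    case 2
    have "chi (r_\<alpha> i j) (r_\<alpha> i k) * chi (r_\<alpha> i k) (r_\<alpha> i j) * q ^ m j k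
      = inverse (chi (\<alpha> i) (\<alpha> j) * chi (\<alpha> j) (\<alpha> i) * q ^ m i j)"
      using 2 chi_self[OF i] q_nonzero
      by (simp add: r_\<alpha>_def chi_add_left chi_add_right chi_mult chi_uminus m_sym[of j i], simp add: field_simps)
    then show ?thesis using chi_pair[OF i j] 2 by simp
  next
    case 3
    \<comment> \<open>Bilinear expansion produces q to the power 2 m_ij m_ik, shared evenly by the
      relations of i with j and of i with k. So the pair j, k keeps its number m.\<close>
    have "chi (r_\<alpha> i j) (r_\<alpha> i k) * chi (r_\<alpha> i k) (r_\<alpha> i j) * q ^ m j k
      = (chi (\<alpha> j) (\<alpha> k) * chi (\<alpha> k) (\<alpha> j) * q ^ m j k)
        * (chi (\<alpha> i) (\<alpha> j) * chi (\<alpha> j) (\<alpha> i) * q ^ m i j) ^ m i k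
        * (chi (\<alpha> i) (\<alpha> k) * chi (\<alpha> k) (\<alpha> i) * q ^ m i k) ^ m i j"
      using 3 chi_self[OF i]
      by (simp add: r_\<alpha>_def chi_add_left chi_add_right chi_mult, (simp add: power_mult_distrib mult_ac flip: power_mult)?)
    then show ?thesis
      using chi_pair[OF i j] chi_pair[OF i k] chi_pair[OF j k \<open>j \<noteq> k\<close>] 3 by simp
  qed
next
  fix Y assume "graded_submodule (r_\<alpha> i) (r_E i) (r_F i) Y"
  then show "(\<forall>\<mu>. Y \<mu> \<subseteq> {0}) \<or> Y = L"
    using r_graded_submodule[OF i] simple by blast
next
  show "(F i ^^ (N - 1)) v \<noteq> 0"
    using F_power_v_nonzero[OF i ht] q_order(3) by simp
  show "(F i ^^ (N - 1)) v \<in> L (w + of_nat (N - 1) * \<alpha> i)"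
    by (rule F_power_weight[OF i v_wt])
qed (use i r_E_wt r_F_wt r_EF in auto)

end

context root_setting begin

text \<open>Reflection at i negates the height of \<open>\<alpha> i\<close> and adds
  \<open>m i j\<close> times the old value to the height of each other root, so the sum of heights
  grows by the row sum minus 2, times \<open>ht (\<alpha> i)\<close>. This is the origin of the
  bound 2.\<close>

theorem heights_unbounded:
  assumes "stage scale I chi ht Kl Kr L q N m \<alpha> c E F w v"
    and pos: "0 < (\<Sum>i\<in>I. ht (\<alpha> i))"
    and row: "\<And>i. i \<in> I \<Longrightarrow> 2 \<le> (\<Sum>j\<in>I - {i}. m i j)"
  shows "\<exists>\<alpha> c E F w' v. stage scale I chi ht Kl Kr L q N m \<alpha> c E F w' v \<and>
    0 < (\<Sum>i\<in>I. ht (\<alpha> i)) \<and> ht w + int n \<le> ht w'"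
proof (induction n)
  case 0
  show ?case using assms(1,2) by (metis add_0_right of_nat_0 order_refl)
next
  case (Suc n)
  then obtain \<alpha> c E F w' v where st: "stage scale I chi ht Kl Kr L q N m \<alpha> c E F w' v"
    and pos: "0 < (\<Sum>i\<in>I. ht (\<alpha> i))" and w': "ht w + int n \<le> ht w'" by blast
  interpret stage scale I chi ht Kl Kr L q N m \<alpha> c E F w' v by (rule st)
  obtain i where i: "i \<in> I" "0 < ht (\<alpha> i)"
    using pos by (meson linorder_not_le sum_nonpos)
  let ?w = "w' + of_nat (N - 1) * \<alpha> i"
  \<comment> \<open>The highest weight moves by N - 1, hence at least one, copies of a root of
    positive height.\<close>
  have "1 * 1 \<le> int (N - 1) * ht (\<alpha> i)"
    using q_order(3) i by (intro mult_mono) auto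
  then have h1: "ht w + int (Suc n) \<le> ht ?w"
    using w' unfolding ht_add ht_mult by linarith
  have h2: "0 < (\<Sum>j\<in>I. ht (r_\<alpha> i j))"
  proof -
    have "(\<Sum>j\<in>I. ht (r_\<alpha> i j)) = - ht (\<alpha> i) + (\<Sum>j\<in>I - {i}. ht (\<alpha> j) + int (m i j) * ht (\<alpha> i))"
      using i by (simp add: sum.remove[OF finite_I] r_\<alpha>_def ht_uminus ht_add ht_mult)
    also have "\<dots> = (\<Sum>j\<in>I. ht (\<alpha> j)) + (int (\<Sum>j\<in>I - {i}. m i j) - 2) * ht (\<alpha> i)"
      using i by (simp add: sum.remove[OF finite_I] sum.distrib left_diff_distrib flip: sum_distrib_right)
    finally have "(\<Sum>j\<in>I. ht (r_\<alpha> i j)) = \<dots>" .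
    moreover have "0 \<le> (int (\<Sum>j\<in>I - {i}. m i j) - 2) * ht (\<alpha> i)"
      using row[OF i(1)] i(2) by (intro mult_nonneg_nonneg) linarith+
    ultimately show ?thesis using pos by linarith
  qed
  have ne: "ht (\<alpha> i) \<noteq> 0" using i(2) by simp
  show ?case
    by (intro exI conjI) (rule reflection[OF i(1) ne], rule h2, rule h1)
qed

end

section \<open>Quantum shuffles\<close>

type_synonym 'i wfun = "'i list \<Rightarrow> complex"

definition fscale :: "complex \<Rightarrow> ('x \<Rightarrow> complex) \<Rightarrow> 'x \<Rightarrow> complex" where
  "fscale d f = (\<lambda>w. d * f w)"

interpretation fs: vector_space "fscale :: complex \<Rightarrow> ('x \<Rightarrow> complex) \<Rightarrow> _"
  by unfold_locales (auto simp: fscale_def algebra_simps fun_eq_iff)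

lemma fscale_apply: "fscale d f w = d * f w"
  by (simp add: fscale_def)

definition shift :: "'i \<Rightarrow> 'i wfun \<Rightarrow> 'i wfun" where
  "shift k f = (\<lambda>w. f (k # w))"

text \<open>
  For a function \<open>f\<close> on words, \<open>lsh Q j w f\<close> and \<open>rsh Q j w f\<close> are the coefficients at the word \<open>w\<close>
  of the products \<open>j * f\<close> and \<open>f * j\<close> in the quantum shuffle algebra with braiding matrix \<open>Q\<close>. On
  functions of fixed degree \<open>csh Q j w f\<close> is a combination of the two, chosen so that its commutator
  with the removal of a first letter is a difference of two characters, as in a quantum double.
\<close>

primrec lsh :: "('i \<Rightarrow> 'i \<Rightarrow> complex) \<Rightarrow> 'i \<Rightarrow> 'i list \<Rightarrow> 'i wfun \<Rightarrow> complex" where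
  "lsh Q j [] = (\<lambda>f. 0)"
| "lsh Q j (k # w) = (\<lambda>f. (if j = k then f w else 0) + Q j k * lsh Q j w (shift k f))"

primrec rsh :: "('i \<Rightarrow> 'i \<Rightarrow> complex) \<Rightarrow> 'i \<Rightarrow> 'i list \<Rightarrow> 'i wfun \<Rightarrow> complex" where
  "rsh Q j [] = (\<lambda>f. 0)"
| "rsh Q j (k # w) = (\<lambda>f. (if j = k then (\<Prod>l\<leftarrow>w. Q l j) * f w else 0) + rsh Q j w (shift k f))"

primrec csh :: "('i \<Rightarrow> 'i \<Rightarrow> complex) \<Rightarrow> 'i \<Rightarrow> 'i list \<Rightarrow> 'i wfun \<Rightarrow> complex" where
  "csh Q j [] = (\<lambda>f. 0)"
| "csh Q j (k # w) = (\<lambda>f. (if j = k then (2 * (\<Prod>l\<leftarrow>w. Q l j) - inverse (\<Prod>l\<leftarrow>w. Q j l)) * f w else 0)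
     + csh Q j w (shift k f))"

definition unit_wfun :: "'i wfun" where "unit_wfun w = (if w = [] then 1 else 0)"

text \<open>The product of the letters of u in the quantum shuffle algebra. Its coefficients turn
  out to be those of the quantum symmetrizer at the word u.\<close>

definition lshuffle :: "('i \<Rightarrow> 'i \<Rightarrow> complex) \<Rightarrow> 'i list \<Rightarrow> 'i wfun" where
  "lshuffle Q u = foldr (\<lambda>j f w. lsh Q j w f) u unit_wfun"

definition cshuffle :: "('i \<Rightarrow> 'i \<Rightarrow> complex) \<Rightarrow> 'i list \<Rightarrow> 'i wfun" where
  "cshuffle Q u = foldr (\<lambda>j f w. csh Q j w f) u unit_wfun"

lemma lshuffle_simps: "lshuffle Q [] = unit_wfun" "lshuffle Q (j # u) = (\<lambda>w. lsh Q j w (lshuffle Q u))"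
  by (simp_all add: lshuffle_def)

lemma cshuffle_simps: "cshuffle Q [] = unit_wfun" "cshuffle Q (j # u) = (\<lambda>w. csh Q j w (cshuffle Q u))"
  by (simp_all add: cshuffle_def)

lemma shift_simps [simp]: "shift k (f + g) = shift k f + shift k g" "shift k (fscale d f) = fscale d (shift k f)"
  "shift k 0 = 0"
  by (simp_all add: shift_def fscale_def fun_eq_iff)

lemma linear_shift: "lin_endo fscale (shift k)"
  by (simp add: Vector_Spaces.linear_iff fs.vector_space_axioms)

lemma lsh_linear: "lsh Q j w (f + g) = lsh Q j w f + lsh Q j w g" "lsh Q j w (fscale d f) = d * lsh Q j w f"
  by (induction w arbitrary: f g) (simp_all add: fscale_apply algebra_simps)

lemma rsh_linear: "rsh Q j w (f + g) = rsh Q j w f + rsh Q j w g" "rsh Q j w (fscale d f) = d * rsh Q j w f"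
  by (induction w arbitrary: f g) (simp_all add: fscale_apply algebra_simps)

lemma csh_linear: "csh Q j w (f + g) = csh Q j w f + csh Q j w g" "csh Q j w (fscale d f) = d * csh Q j w f"
  by (induction w arbitrary: f g) (simp_all add: fscale_apply algebra_simps)

lemma linear_csh: "lin_endo fscale (\<lambda>f w. csh Q j w f)"
  by (simp add: Vector_Spaces.linear_iff fs.vector_space_axioms csh_linear fun_eq_iff fscale_apply)

lemma linear_lsh: "lin_endo fscale (\<lambda>f w. lsh Q j w f)"
  by (simp add: Vector_Spaces.linear_iff fs.vector_space_axioms lsh_linear fun_eq_iff fscale_apply)

lemma linear_rsh: "lin_endo fscale (\<lambda>f w. rsh Q j w f)"
  by (simp add: Vector_Spaces.linear_iff fs.vector_space_axioms rsh_linear fun_eq_iff fscale_apply)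

lemma sh_zero [simp]: "lsh Q j w 0 = 0" "rsh Q j w 0 = 0" "csh Q j w 0 = 0"
  using lsh_linear(2)[of Q j w 0 0] rsh_linear(2)[of Q j w 0 0] csh_linear(2)[of Q j w 0 0]
  by (simp_all add: fscale_def zero_fun_def)

text \<open>The weight is multiplicative in the letters, so it passes left multiplication by j at
  the cost of one factor \<open>Q j i\<close>. This supplies the boundary term in
  \<open>rsh_lsh\<close>.\<close>

lemma lsh_weighted:
  "Q j i * lsh Q j w (\<lambda>u. (\<Prod>l\<leftarrow>u. Q l i) * f u) = (\<Prod>l\<leftarrow>w. Q l i) * lsh Q j w f"
proof (induction w arbitrary: f)
  case (Cons k w)
  have 1: "shift k (\<lambda>u. (\<Prod>l\<leftarrow>u. Q l i) * f u) = fscale (Q k i) (\<lambda>u. (\<Prod>l\<leftarrow>u. Q l i) * shift k f u)"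
    by (simp add: shift_def fscale_apply fun_eq_iff)
  have "Q j i * lsh Q j (k # w) (\<lambda>u. (\<Prod>l\<leftarrow>u. Q l i) * f u)
      = Q j i * (if j = k then (\<Prod>l\<leftarrow>w. Q l i) * f w else 0)
        + Q j k * (Q k i * (Q j i * lsh Q j w (\<lambda>u. (\<Prod>l\<leftarrow>u. Q l i) * shift k f u)))"
    unfolding lsh.simps 1 lsh_linear by (simp only: distrib_left mult.left_commute)
  then show ?case
    unfolding Cons.IH by (simp add: distrib_left mult_ac)
qed simp

text \<open>Associativity (j * f) * i = j * (f * i) of the quantum shuffle product, when one factor
  on each side is a letter.\<close>

lemma rsh_lsh: "rsh Q i w (\<lambda>u. lsh Q j u f) = lsh Q j w (\<lambda>u. rsh Q i u f)"
proof (induction w arbitrary: f)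
  case (Cons k w)
  have 1: "shift k (\<lambda>u. lsh Q j u f)
      = (if j = k then f else 0) + fscale (Q j k) (\<lambda>u. lsh Q j u (shift k f))"
    by (auto simp: shift_def fscale_def)
  have 2: "shift k (\<lambda>u. rsh Q i u f)
      = (if i = k then (\<lambda>u. (\<Prod>l\<leftarrow>u. Q l i) * f u) else 0) + (\<lambda>u. rsh Q i u (shift k f))"
    by (auto simp: shift_def)
  show ?case
    using lsh_weighted[of Q j i w f, symmetric]
    by (auto simp: 1 2 rsh_linear lsh_linear Cons.IH distrib_left)
qed simp

lemma rsh_lshuffle: "(\<lambda>w. rsh Q j w (lshuffle Q u)) = lshuffle Q (u @ [j])"
proof (induction u)
  case Nil
  have "rsh Q j w unit_wfun = lsh Q j w unit_wfun" for w
  proof (cases w)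
    case (Cons k w')
    have "shift k unit_wfun = 0" by (simp add: shift_def unit_wfun_def fun_eq_iff)
    then show ?thesis by (simp add: Cons unit_wfun_def)
  qed simp
  then show ?case by (simp add: lshuffle_simps)
next
  case (Cons i u)
  show ?case
    by (simp add: lshuffle_simps rsh_lsh Cons.IH[symmetric])
qed

definition word_deg :: "'i list \<Rightarrow> 'i \<Rightarrow> int" where "word_deg w = (\<lambda>k. int (count_list w k))"

definition unit_vec :: "'i \<Rightarrow> 'i \<Rightarrow> int" where "unit_vec k = (\<lambda>l. if l = k then 1 else 0)"

lemma word_deg_simps: "word_deg [] = 0" "word_deg (k # w) = unit_vec k + word_deg w"
  by (auto simp: word_deg_def unit_vec_def fun_eq_iff)

lemma word_deg_eq_0: "word_deg w = 0 \<longleftrightarrow> w = []"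
proof
  assume "word_deg w = 0"
  then have "count_list w k = 0" for k by (simp add: word_deg_def fun_eq_iff)
  then show "w = []" by (cases w) (force split: if_splits)+
qed (simp add: word_deg_simps)

section \<open>The highest weight module of a diagonal braiding of Cartan type\<close>

locale diag =
  fixes I :: "'i set" and Q :: "'i \<Rightarrow> 'i \<Rightarrow> complex" and q :: complex and N :: nat
    and m :: "'i \<Rightarrow> 'i \<Rightarrow> nat"
  assumes finite_I: "finite I" and nonempty_I: "I \<noteq> {}"
    and norm_Q: "i \<in> I \<Longrightarrow> j \<in> I \<Longrightarrow> norm (Q i j) = 1"
    and Q_self: "i \<in> I \<Longrightarrow> Q i i = q"
    and Q_pair: "i \<in> I \<Longrightarrow> j \<in> I \<Longrightarrow> i \<noteq> j \<Longrightarrow> Q i j * Q j i * q ^ m i j = 1"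
    and q_order: "q ^ N = 1" "\<And>n. 0 < n \<Longrightarrow> n < N \<Longrightarrow> q ^ n \<noteq> 1" "2 \<le> N"
    and m_sym: "m i j = m j i" and m_less: "m i j < N"
begin

text \<open>Q enters transposed, so that pairing the degree of a letter j with the degree of a word
  w gives the product of the \<open>Q l j\<close>, the factor that right multiplication by j
  collects.\<close>

definition chi :: "('i \<Rightarrow> int) \<Rightarrow> ('i \<Rightarrow> int) \<Rightarrow> complex" where
  "chi \<mu> \<nu> = (\<Prod>k\<in>I. \<Prod>l\<in>I. Q l k powi (\<mu> k * \<nu> l))"

definition ht :: "('i \<Rightarrow> int) \<Rightarrow> int" where "ht \<mu> = (\<Sum>k\<in>I. \<mu> k)"

lemma Q_nonzero: "i \<in> I \<Longrightarrow> j \<in> I \<Longrightarrow> Q i j \<noteq> 0"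
  using norm_Q[of i j] by auto

lemma chi_add: "chi (x + y) z = chi x z * chi y z" "chi x (y + z) = chi x y * chi x z"
  by (auto simp: chi_def Q_nonzero power_int_add distrib_left distrib_right simp flip: prod.distrib intro!: prod.cong)

lemma norm_chi: "norm (chi \<mu> \<nu>) = 1"
  by (simp add: chi_def norm_Q norm_power_int flip: prod_norm)

lemma chi_unit_vec:
  assumes "j \<in> I" "k \<in> I" shows "chi (unit_vec j) (unit_vec k) = Q k j"
proof -
  have "chi (unit_vec j) (unit_vec k) = (\<Prod>i\<in>I. if i = j then (\<Prod>l\<in>I. if l = k then Q l i else 1) else 1)"
    unfolding chi_def by (intro prod.cong refl) (auto simp: unit_vec_def intro!: prod.cong)
  then show ?thesis using assms finite_I by (simp add: prod.delta)
qed

lemma chi_zero: "chi 0 x = 1" "chi x 0 = 1"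
  by (simp_all add: chi_def)

lemma chi_word_deg:
  assumes "j \<in> I" "set w \<subseteq> I"
  shows "chi (unit_vec j) (word_deg w) = (\<Prod>l\<leftarrow>w. Q l j)" "chi (word_deg w) (unit_vec j) = (\<Prod>l\<leftarrow>w. Q j l)"
  using assms(2) by (induction w) (simp_all add: word_deg_simps chi_zero chi_add chi_unit_vec assms(1))

lemma ht_word_deg: "set w \<subseteq> I \<Longrightarrow> ht (word_deg w) = int (length w)"
  by (induction w) (simp_all add: word_deg_simps ht_def sum.distrib unit_vec_def sum.delta finite_I)

definition Wt :: "('i \<Rightarrow> int) \<Rightarrow> 'i wfun set" where
  "Wt \<mu> = {f. \<forall>w. f w \<noteq> 0 \<longrightarrow> set w \<subseteq> I \<and> word_deg w = \<mu>}"

text \<open>The weight component of the module that the operators \<open>csh\<close> generate from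
  the empty word, inside the functions \<open>Wt \<mu>\<close>.\<close>

definition L :: "('i \<Rightarrow> int) \<Rightarrow> 'i wfun set" where
  "L \<mu> = fs.span {cshuffle Q J | J. set J \<subseteq> I \<and> word_deg J = \<mu>}"

lemma subspace_Wt: "fs.subspace (Wt \<mu>)"
proof (rule fs.subspaceI)
  fix f g d assume f: "f \<in> Wt \<mu>" and g: "g \<in> Wt \<mu>"
  have "(f + g) w \<noteq> 0 \<Longrightarrow> f w \<noteq> 0 \<or> g w \<noteq> 0" for w by auto
  then show "f + g \<in> Wt \<mu>" using f g unfolding Wt_def by blast
  have "fscale d f w \<noteq> 0 \<Longrightarrow> f w \<noteq> 0" for w by (simp add: fscale_apply)
  then show "fscale d f \<in> Wt \<mu>" using f unfolding Wt_def by blast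
qed (simp add: Wt_def)

lemma shift_Wt: "f \<in> Wt \<mu> \<Longrightarrow> shift k f \<in> Wt (\<mu> - unit_vec k)"
proof -
  assume f: "f \<in> Wt \<mu>"
  have "set w \<subseteq> I \<and> word_deg w = \<mu> - unit_vec k" if "f (k # w) \<noteq> 0" for w
  proof -
    have "set (k # w) \<subseteq> I" "unit_vec k + word_deg w = \<mu>"
      using f that unfolding Wt_def word_deg_simps(2)[symmetric] by blast+
    then show ?thesis by (metis add_diff_cancel_left' insert_subset list.simps(15))
  qed
  then show ?thesis unfolding Wt_def shift_def by blast
qed

lemma shift_Wt_0: "f \<in> Wt \<mu> \<Longrightarrow> k \<notin> I \<Longrightarrow> shift k f = 0"
  by (auto simp: Wt_def shift_def fun_eq_iff)

lemma csh_Wt: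
  assumes "j \<in> I" shows "f \<in> Wt \<mu> \<Longrightarrow> csh Q j w f \<noteq> 0 \<Longrightarrow> set w \<subseteq> I \<and> word_deg w = \<mu> + unit_vec j"
proof (induction w arbitrary: f \<mu>)
  case (Cons k w)
  have "j = k \<and> f w \<noteq> 0 \<or> csh Q j w (shift k f) \<noteq> 0"
    using Cons.prems(2) by (auto split: if_splits)
  then consider "j = k" "f w \<noteq> 0" | "csh Q j w (shift k f) \<noteq> 0" by blast
  then show ?case
  proof cases
    case 1
    then show ?thesis using Cons.prems(1) assms by (auto simp: Wt_def word_deg_simps)
  next
    case 2
    then have "k \<in> I" using shift_Wt_0[OF Cons.prems(1)] by fastforce
    then show ?thesis using Cons.IH[OF shift_Wt[OF Cons.prems(1)] 2]
      by (auto simp: word_deg_simps algebra_simps)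
  qed
qed simp

lemma cshuffle_Wt: "set J \<subseteq> I \<Longrightarrow> cshuffle Q J \<in> Wt (word_deg J)"
proof (induction J)
  case Nil
  show ?case by (auto simp: Wt_def cshuffle_simps unit_wfun_def word_deg_simps)
next
  case (Cons j J)
  then show ?case
    using csh_Wt[of j "cshuffle Q J" "word_deg J"] by (auto simp: Wt_def cshuffle_simps word_deg_simps add.commute)
qed

lemma L_Wt: "L \<mu> \<subseteq> Wt \<mu>"
  unfolding L_def by (rule fs.span_minimal[OF _ subspace_Wt]) (auto intro: cshuffle_Wt)

text \<open>The recursion of \<open>csh\<close> is already the commutator formula; on
  \<open>Wt \<mu>\<close> the products over the remaining word depend only on its degree, so they
  are values of \<open>chi\<close>.\<close>

lemma shift_csh:
  assumes "j \<in> I" "f \<in> Wt \<mu>"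
  shows "shift i (\<lambda>w. csh Q j w f) = (\<lambda>w. csh Q j w (shift i f)) +
    (if i = j then fscale (2 * chi (unit_vec j) \<mu> - inverse (chi \<mu> (unit_vec j))) f else 0)"
proof
  fix w
  have "f w \<noteq> 0 \<Longrightarrow> chi (unit_vec j) \<mu> = (\<Prod>l\<leftarrow>w. Q l j) \<and> chi \<mu> (unit_vec j) = (\<Prod>l\<leftarrow>w. Q j l)"
    using assms chi_word_deg[OF assms(1), of w] by (auto simp: Wt_def)
  then show "shift i (\<lambda>w. csh Q j w f) w = ((\<lambda>w. csh Q j w (shift i f)) +
    (if i = j then fscale (2 * chi (unit_vec j) \<mu> - inverse (chi \<mu> (unit_vec j))) f else 0)) w"
    by (cases "f w = 0") (auto simp: fscale_def shift_def[of i "\<lambda>w. csh Q j w f"])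
qed

text \<open>The inverse of the product over the letters behind the insertion point equals the
  product over those in front of it, divided by the value of \<open>chi\<close> at the whole degree.
  This turns the second half of \<open>csh\<close> into left multiplication.\<close>

lemma csh_split:
  assumes "j \<in> I"
  shows "f \<in> Wt \<mu> \<Longrightarrow> csh Q j w f = 2 * rsh Q j w f - inverse (chi \<mu> (unit_vec j)) * lsh Q j w f"
proof (induction w arbitrary: f \<mu>)
  case (Cons k w)
  have 1: "csh Q j w (shift k f) = 2 * rsh Q j w (shift k f)
     - inverse (chi \<mu> (unit_vec j)) * (Q j k * lsh Q j w (shift k f))"
  proof (cases "k \<in> I")
    case True
    define \<nu> where "\<nu> = \<mu> - unit_vec k"
    have "\<mu> = \<nu> + unit_vec k" by (simp add: \<nu>_def)
    then have "chi \<mu> (unit_vec j) = chi \<nu> (unit_vec j) * Q j k"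
      using chi_add(1)[of \<nu> "unit_vec k"] chi_unit_vec[OF True assms] by simp
    then show ?thesis
      using Cons.IH[OF shift_Wt[OF Cons.prems, of k, folded \<nu>_def]] Q_nonzero[OF assms True] by simp
  next
    case False
    then show ?thesis using shift_Wt_0[OF Cons.prems] by simp
  qed
  have 2: "f w \<noteq> 0 \<Longrightarrow> j = k \<Longrightarrow> inverse (\<Prod>l\<leftarrow>w. Q j l) = inverse (chi \<mu> (unit_vec j))"
    using Cons.prems chi_word_deg(2)[OF assms, of w] by (auto simp: Wt_def)
  show ?case
    using 2 by (cases "f w = 0") (auto simp: 1 algebra_simps)
qed simp

text \<open>Right multiplication by a letter appends it and left multiplication prepends it, so
  their combination stays in the span of the shuffle products of the same length.\<close>

lemma cshuffle_in_span:
  "set J \<subseteq> I \<Longrightarrow> cshuffle Q J \<in> fs.span {lshuffle Q u | u. set u \<subseteq> I \<and> length u = length J}"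
proof (induction J)
  case Nil
  have "{lshuffle Q u | u. set u \<subseteq> I \<and> length u = 0} = {unit_wfun}"
    by (auto simp: lshuffle_simps)
  then show ?case unfolding cshuffle_simps list.size by (simp only: fs.span_base insertI1)
next
  case (Cons j J)
  let ?S = "\<lambda>n. {lshuffle Q u | u. set u \<subseteq> I \<and> length u = n}"
  have j: "j \<in> I" and IH: "cshuffle Q J \<in> fs.span (?S (length J))" using Cons by auto
  have 1: "(\<lambda>w. rsh Q j w f) \<in> fs.span (?S (Suc (length J)))" if f: "f \<in> fs.span (?S (length J))" for f
  proof (rule fs.linear_span_subset[OF linear_rsh _ fs.subspace_span f])
    fix x assume "x \<in> ?S (length J)"
    then obtain u where u: "x = lshuffle Q u" "set u \<subseteq> I" "length u = length J" by blast
    show "(\<lambda>w. rsh Q j w x) \<in> fs.span (?S (Suc (length J)))"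
      unfolding u(1) rsh_lshuffle using u j by (intro fs.span_base CollectI exI[of _ "u @ [j]"]) auto
  qed
  have 2: "(\<lambda>w. lsh Q j w f) \<in> fs.span (?S (Suc (length J)))" if f: "f \<in> fs.span (?S (length J))" for f
  proof (rule fs.linear_span_subset[OF linear_lsh _ fs.subspace_span f])
    fix x assume "x \<in> ?S (length J)"
    then obtain u where u: "x = lshuffle Q u" "set u \<subseteq> I" "length u = length J" by blast
    show "(\<lambda>w. lsh Q j w x) \<in> fs.span (?S (Suc (length J)))"
      unfolding u(1) lshuffle_simps(2)[symmetric] using u j by (intro fs.span_base CollectI exI[of _ "j # u"]) auto
  qed
  have "cshuffle Q (j # J) = fscale 2 (\<lambda>w. rsh Q j w (cshuffle Q J))
      - fscale (inverse (chi (word_deg J) (unit_vec j))) (\<lambda>w. lsh Q j w (cshuffle Q J))"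
    using csh_split[OF j cshuffle_Wt[of J]] Cons.prems by (auto simp: cshuffle_simps fscale_def)
  also have "\<dots> \<in> fs.span (?S (Suc (length J)))"
    by (intro fs.span_diff fs.span_scale 1 2 IH)
  finally show ?case by simp
qed

end

context diag begin

definition Kl :: "('i \<Rightarrow> int) \<Rightarrow> 'i wfun \<Rightarrow> 'i wfun" where "Kl \<gamma> f = (\<lambda>w. chi \<gamma> (word_deg w) * f w)"

definition Kr :: "('i \<Rightarrow> int) \<Rightarrow> 'i wfun \<Rightarrow> 'i wfun" where "Kr \<gamma> f = (\<lambda>w. chi (word_deg w) \<gamma> * f w)"

lemma root_setting: "root_setting fscale I chi ht Kl Kr L q N m"
proof (intro root_setting.intro fs.vector_space_axioms root_setting_axioms.intro)
  show "fs.subspace (L \<mu>)" for \<mu> unfolding L_def by (rule fs.subspace_span)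
  show "ht (x + y) = ht x + ht y" for x y by (simp add: ht_def sum.distrib)
  show "lin_endo fscale (Kl \<gamma>)" "lin_endo fscale (Kr \<gamma>)" for \<gamma>
    by (simp_all add: Vector_Spaces.linear_iff fs.vector_space_axioms Kl_def Kr_def fun_eq_iff fscale_apply algebra_simps)
  show "Kl \<gamma> u = fscale (chi \<gamma> \<mu>) u" "Kr \<gamma> u = fscale (chi \<mu> \<gamma>) u" if "u \<in> L \<mu>" for \<gamma> u \<mu>
  proof -
    have "u w \<noteq> 0 \<Longrightarrow> word_deg w = \<mu>" for w using that L_Wt[of \<mu>] unfolding Wt_def by blast
    then have "Kl \<gamma> u w = fscale (chi \<gamma> \<mu>) u w \<and> Kr \<gamma> u w = fscale (chi \<mu> \<gamma>) u w" for w
      by (cases "u w = 0") (auto simp: Kl_def Kr_def fscale_apply)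
    then show "Kl \<gamma> u = fscale (chi \<gamma> \<mu>) u" "Kr \<gamma> u = fscale (chi \<mu> \<gamma>) u" by blast+
  qed
qed (use finite_I chi_add norm_chi q_order m_sym m_less in auto)

interpretation root_setting fscale I chi ht Kl Kr L q N m
  by (rule root_setting)

lemma ht_unit_vec: "i \<in> I \<Longrightarrow> ht (unit_vec i) = 1"
  using finite_I by (simp add: ht_def unit_vec_def sum.delta)

lemma subspace_L: "fs.subspace (L \<mu>)"
  unfolding L_def by (rule fs.subspace_span)

lemma csh_L:
  assumes j: "j \<in> I" and x: "x \<in> L \<mu>" shows "(\<lambda>w. csh Q j w x) \<in> L (\<mu> + unit_vec j)"
proof (rule fs.linear_span_subset[OF linear_csh _ subspace_L x[unfolded L_def]])
  fix f assume "f \<in> {cshuffle Q J | J. set J \<subseteq> I \<and> word_deg J = \<mu>}"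
  then obtain J where J: "f = cshuffle Q J" "set J \<subseteq> I" "word_deg J = \<mu>" by blast
  have "cshuffle Q (j # J) \<in> L (\<mu> + unit_vec j)"
    unfolding L_def using J j
    by (intro fs.span_base CollectI exI[of _ "j # J"]) (simp add: word_deg_simps add.commute)
  then show "(\<lambda>w. csh Q j w f) \<in> L (\<mu> + unit_vec j)"
    unfolding J cshuffle_simps .
qed

lemma shift_cshuffle_L:
  assumes k: "k \<in> I" shows "set J \<subseteq> I \<Longrightarrow> shift k (cshuffle Q J) \<in> L (word_deg J - unit_vec k)"
proof (induction J)
  case Nil
  have "shift k unit_wfun = 0" by (simp add: shift_def unit_wfun_def fun_eq_iff)
  then show ?case using fs.subspace_0[OF subspace_L] by (simp only: cshuffle_simps)
next
  case (Cons j J)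
  have j: "j \<in> I" and J: "set J \<subseteq> I" using Cons.prems by auto
  have eq: "word_deg J - unit_vec k + unit_vec j = word_deg (j # J) - unit_vec k"
    by (simp add: word_deg_simps)
  have 1: "(\<lambda>w. csh Q j w (shift k (cshuffle Q J))) \<in> L (word_deg (j # J) - unit_vec k)"
    using csh_L[OF j Cons.IH[OF J]] unfolding eq .
  have 2: "(if k = j then fscale d (cshuffle Q J) else 0) \<in> L (word_deg (j # J) - unit_vec k)" for d
  proof -
    have "fscale d (cshuffle Q J) \<in> L (word_deg J)"
      using J unfolding L_def by (intro fs.span_scale fs.span_base) auto
    then show ?thesis using fs.subspace_0[OF subspace_L] by (simp add: word_deg_simps)
  qed
  show ?case
    unfolding cshuffle_simps shift_csh[OF j cshuffle_Wt[OF J]]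
    by (rule fs.subspace_add[OF subspace_L 1 2])
qed

lemma shift_L:
  assumes k: "k \<in> I" and x: "x \<in> L \<mu>" shows "shift k x \<in> L (\<mu> - unit_vec k)"
  by (rule fs.linear_span_subset[OF linear_shift _ subspace_L x[unfolded L_def]])
    (use shift_cshuffle_L[OF k] in blast)

text \<open>A nonzero element has a nonzero coefficient at some word u. Stripping the letters of u
  leaves a nonzero multiple of the empty word, and this generates the module.\<close>

lemma graded_simple:
  assumes Y: "graded_submodule unit_vec shift (\<lambda>j f w. csh Q j w f) Y"
  shows "(\<forall>\<mu>. Y \<mu> \<subseteq> {0}) \<or> Y = L"
proof (rule disjCI)
  assume "Y \<noteq> L"
  have sub: "fs.subspace (Y \<mu>)" and YL: "Y \<mu> \<subseteq> L \<mu>" for \<mu>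
    using Y by (auto simp: graded_submodule_def)
  have sh: "shift i x \<in> Y (\<mu> - unit_vec i)" and cs: "(\<lambda>w. csh Q i w x) \<in> Y (\<mu> + unit_vec i)"
    if "i \<in> I" "x \<in> Y \<mu>" for i x \<mu>
    using Y that by (auto simp: graded_submodule_def)
  have down: "(\<lambda>w. x (u @ w)) \<in> Y (\<mu> - word_deg u)" if "set u \<subseteq> I" "x \<in> Y \<mu>" for u x \<mu>
    using that
  proof (induction u arbitrary: x \<mu>)
    case (Cons k u)
    then have "(\<lambda>w. shift k x (u @ w)) \<in> Y (\<mu> - unit_vec k - word_deg u)"
      by (intro Cons.IH sh) auto
    moreover have "\<mu> - unit_vec k - word_deg u = \<mu> - word_deg (k # u)"
      unfolding word_deg_simps by (rule diff_diff_add)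
    ultimately show ?case unfolding shift_def by (simp only: append_Cons)
  qed (simp add: word_deg_simps)
  show "\<forall>\<mu>. Y \<mu> \<subseteq> {0}"
  proof (rule ccontr)
    assume "\<not> (\<forall>\<mu>. Y \<mu> \<subseteq> {0})"
    then obtain \<mu> x where x: "x \<in> Y \<mu>" "x \<noteq> 0" by blast
    have Wt: "x \<in> Wt \<mu>" using x YL L_Wt by blast
    obtain u where u: "x u \<noteq> 0" using x(2) by (auto simp: fun_eq_iff)
    then have uI: "set u \<subseteq> I" "word_deg u = \<mu>" using Wt by (auto simp: Wt_def)
    have y: "(\<lambda>w. x (u @ w)) \<in> Y 0"
      using down[OF uI(1) x(1)] uI(2) by simp
    then have "(\<lambda>w. x (u @ w)) \<in> Wt 0" using YL L_Wt by blast
    then have "x (u @ w) \<noteq> 0 \<Longrightarrow> w = []" for w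
      using word_deg_eq_0[of w] unfolding Wt_def by blast
    then have "(\<lambda>w. x (u @ w)) = fscale (x u) unit_wfun"
      by (auto simp: fscale_apply unit_wfun_def fun_eq_iff)
    then have "fscale (inverse (x u)) (fscale (x u) unit_wfun) \<in> Y 0"
      using fs.subspace_scale[OF sub y] by metis
    then have v: "unit_wfun \<in> Y 0" using u by simp
    have "cshuffle Q J \<in> Y (word_deg J)" if "set J \<subseteq> I" for J
      using that
    proof (induction J)
      case Nil
      show ?case unfolding cshuffle_simps word_deg_simps by (rule v)
    next
      case (Cons j J)
      then have "(\<lambda>w. csh Q j w (cshuffle Q J)) \<in> Y (word_deg J + unit_vec j)"
        by (intro cs) auto
      then show ?case unfolding cshuffle_simps word_deg_simps by (simp only: add.commute)
    qed
    then have "L \<mu> \<subseteq> Y \<mu>" for \<mu>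
      unfolding L_def by (intro fs.span_minimal sub) auto
    then have "Y = L" using YL by blast
    then show False using \<open>Y \<noteq> L\<close> by blast
  qed
qed

lemma initial_stage:
  "stage fscale I chi ht Kl Kr L q N m unit_vec (\<lambda>i \<mu>. \<mu> i) shift (\<lambda>j f w. csh Q j w f) 0 unit_wfun"
proof (intro stage.intro root_setting stage_axioms.intro)
  show "unit_wfun \<in> L 0"
    unfolding L_def using cshuffle_simps(1)[of Q]
    by (intro fs.span_base CollectI exI[of _ "[]"]) (simp add: word_deg_simps)
  show "(unit_wfun :: 'i wfun) \<noteq> 0"
    by (auto simp: unit_wfun_def fun_eq_iff)
  show "shift i (unit_wfun :: 'i wfun) = 0" for i
    by (simp add: shift_def unit_wfun_def fun_eq_iff)
  fix i j :: 'i and x \<mu> assume i: "i \<in> I" and j: "j \<in> I" and x: "x \<in> L \<mu>"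
  \<comment> \<open>Simple roots have height 1, which is the origin of the factor 2 in
    \<open>csh\<close>.\<close>
  have "A (unit_vec i) \<mu> = 2 * chi (unit_vec i) \<mu>" "B (unit_vec i) \<mu> = inverse (chi \<mu> (unit_vec i))"
    using ht_unit_vec[OF i] by (simp_all add: A_def B_def)
  then show "shift i (\<lambda>w. csh Q j w x) = (\<lambda>w. csh Q j w (shift i x)) +
     (if i = j then fscale (A (unit_vec i) \<mu> - B (unit_vec i) \<mu>) x else 0)"
    using shift_csh[OF j subsetD[OF L_Wt x], of i] by auto
qed (use linear_shift linear_csh shift_L csh_L graded_simple Q_self Q_pair chi_unit_vec in
    \<open>auto simp: unit_vec_def mult.commute\<close>)

text \<open>Heights of weights are word lengths, so unbounded highest weights force nonzero values
  of \<open>cshuffle\<close>, and with them of \<open>lshuffle\<close>, on arbitrarily long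
  words.\<close>

theorem lshuffle_nonzero:
  assumes row: "\<And>i. i \<in> I \<Longrightarrow> 2 \<le> (\<Sum>j\<in>I - {i}. m i j)"
  shows "\<exists>u w. set u \<subseteq> I \<and> n < length u \<and> lshuffle Q u w \<noteq> 0"
proof -
  have "(\<Sum>i\<in>I. ht (unit_vec i)) = int (card I)"
    using ht_unit_vec by simp
  moreover have "0 < card I" using finite_I nonempty_I by (simp add: card_gt_0_iff)
  ultimately have "0 < (\<Sum>i\<in>I. ht (unit_vec i))" by simp
  from heights_unbounded[OF initial_stage this row, of "Suc n"]
  obtain \<alpha> c E F w v where st: "stage fscale I chi ht Kl Kr L q N m \<alpha> c E F w v"
    and w: "ht 0 + int (Suc n) \<le> ht w" by blast
  have v: "v \<in> L w" "v \<noteq> 0"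
    using stage.v_wt[OF st] stage.v_nonzero[OF st] by auto
  have "\<exists>J. set J \<subseteq> I \<and> word_deg J = w \<and> cshuffle Q J \<noteq> 0"
  proof (rule ccontr)
    assume "\<not> ?thesis"
    then have "{cshuffle Q J | J. set J \<subseteq> I \<and> word_deg J = w} \<subseteq> {0}" by blast
    then have "L w \<subseteq> {0}"
      unfolding L_def by (rule fs.span_minimal) (rule fs.subspace_single_0)
    then show False using v by blast
  qed
  then obtain J where J: "set J \<subseteq> I" "word_deg J = w" "cshuffle Q J \<noteq> 0" by blast
  have len: "n < length J"
    using w ht_word_deg[OF J(1)] J(2) by (simp add: ht_def)
  have "\<exists>u. set u \<subseteq> I \<and> length u = length J \<and> lshuffle Q u \<noteq> 0"
  proof (rule ccontr)
    assume "\<not> ?thesis"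
    then have "{lshuffle Q u | u. set u \<subseteq> I \<and> length u = length J} \<subseteq> {0}" by blast
    then have "fs.span {lshuffle Q u | u. set u \<subseteq> I \<and> length u = length J} \<subseteq> {0}"
      by (rule fs.span_minimal) (rule fs.subspace_single_0)
    then show False using cshuffle_in_span[OF J(1)] J(3) by blast
  qed
  then obtain u where u: "set u \<subseteq> I" "length u = length J" "lshuffle Q u \<noteq> 0" by blast
  then obtain w where "lshuffle Q u w \<noteq> 0" by (auto simp: fun_eq_iff)
  then show ?thesis using u len by auto
qed

end

text \<open>On a constant word each insertion sums a geometric series over the slots, so a
  q-factorial results. For \<open>Q i i = 1\<close> it never vanishes, and this rules out q =
  1.\<close>

lemma lshuffle_replicate:
  "lshuffle Q (replicate n i) (replicate n i) = (\<Prod>r<n. q_nat (Q i i) (Suc r))"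
proof (induction n)
  case 0
  show ?case by (simp add: lshuffle_simps unit_wfun_def)
next
  case (Suc n)
  have "lsh Q i (replicate k i) f = q_nat (Q i i) k * f (replicate (k - 1) i)" for k f
  proof (induction k arbitrary: f)
    case (Suc k)
    have "lsh Q i (replicate (Suc k) i) f
        = f (replicate k i) + Q i i * (q_nat (Q i i) k * shift i f (replicate (k - 1) i))"
      by (simp add: Suc.IH)
    then show ?case
      by (cases k) (simp_all add: shift_def q_nat_Suc_shift algebra_simps)
  qed simp
  from this[of "Suc n"] show ?case
    using Suc by (simp add: lshuffle_simps mult.commute del: replicate.simps(2)) (simp add: lshuffle_simps)
qed

section \<open>Shuffles as sums over permutations\<close>

definition skip :: "nat \<Rightarrow> nat \<Rightarrow> nat" where "skip k a = (if a < k then a else Suc a)"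

text \<open>Encodes the choice of a slot for a new first letter, as in the recursion of the shuffle
  product: the letter lands at k and the others keep their order pattern.\<close>

definition perm_cons :: "nat \<Rightarrow> (nat \<Rightarrow> nat) \<Rightarrow> nat \<Rightarrow> nat" where
  "perm_cons k \<pi> = (\<lambda>a. case a of 0 \<Rightarrow> k | Suc a \<Rightarrow> skip k (\<pi> a))"

lemma skip_eq [simp]: "skip k a = skip k b \<longleftrightarrow> a = b" "skip k a \<noteq> k" "k \<noteq> skip k a" "skip k a < k \<longleftrightarrow> a < k"
  "skip k a < skip k b \<longleftrightarrow> a < b"
  by (auto simp: skip_def)

lemma perm_cons_permutes:
  assumes \<pi>: "\<pi> permutes {..<n}" and k: "k \<le> n"
  shows "perm_cons k \<pi> permutes {..<Suc n}"
proof (rule bij_imp_permutes)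
  have inj: "inj_on (perm_cons k \<pi>) {..<Suc n}"
    by (rule inj_onI)
      (auto simp: perm_cons_def split: nat.splits dest: injD[OF permutes_inj[OF \<pi>]])
  have "perm_cons k \<pi> a < Suc n" if "a < Suc n" for a
    using that k permutes_in_image[OF \<pi>] by (auto simp: perm_cons_def skip_def split: nat.splits)
  then have "perm_cons k \<pi> ` {..<Suc n} = {..<Suc n}"
    by (intro endo_inj_surj[OF _ _ inj]) auto
  then show "bij_betw (perm_cons k \<pi>) {..<Suc n} {..<Suc n}"
    using inj by (simp add: bij_betw_def)
  show "perm_cons k \<pi> a = a" if a: "a \<notin> {..<Suc n}" for a
  proof -
    obtain b where "a = Suc b" "n \<le> b" using a by (cases a) auto
    moreover from this have "\<pi> b = b" using permutes_not_in[OF \<pi>, of b] by simp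
    ultimately show ?thesis using k by (simp add: perm_cons_def skip_def)
  qed
qed

text \<open>Injectivity is read off at 0 and at successors; surjectivity follows by counting, since
  (n + 1) n! = (n + 1)!.\<close>

lemma bij_betw_perm_cons:
  "bij_betw (\<lambda>(k, \<pi>). perm_cons k \<pi>) ({..n} \<times> {\<pi>. \<pi> permutes {..<n}}) {\<pi>. \<pi> permutes {..<Suc n}}"
proof -
  let ?f = "\<lambda>(k, \<pi>). perm_cons k \<pi>" and ?S = "{..n} \<times> {\<pi>. \<pi> permutes {..<n}}"
  have inj: "inj_on ?f ?S"
  proof (rule inj_onI, clarsimp)
    fix k \<pi> l \<sigma> assume eq: "perm_cons k \<pi> = perm_cons l \<sigma>"
    have "k = l" using fun_cong[OF eq, of 0] by (simp add: perm_cons_def)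
    moreover have "\<pi> a = \<sigma> a" for a
      using fun_cong[OF eq, of "Suc a"] \<open>k = l\<close> by (simp add: perm_cons_def)
    ultimately show "k = l \<and> \<pi> = \<sigma>" by auto
  qed
  have sub: "?f ` ?S \<subseteq> {\<pi>. \<pi> permutes {..<Suc n}}"
    using perm_cons_permutes by auto
  have "card (?f ` ?S) = card {\<pi>. \<pi> permutes {..<Suc n}}"
    using card_image[OF inj] card_permutations[of "{..<n}" n] card_permutations[of "{..<Suc n}" "Suc n"]
    by (simp add: card_cartesian_product)
  then have "?f ` ?S = {\<pi>. \<pi> permutes {..<Suc n}}"
    using sub finite_permutations[of "{..<Suc n}"] by (intro card_subset_eq) auto
  then show ?thesis using inj by (simp add: bij_betw_def)
qed

text \<open>The new first letter is inverted with exactly those letters that land in front of k.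
  They account for the factors \<open>Q j (w ! l)\<close> with l < k.\<close>

lemma inversions_perm_cons:
  "inversions (Suc n) (perm_cons k \<pi>) =
     (\<lambda>b. (0, Suc b)) ` {b. b < n \<and> \<pi> b < k} \<union> map_prod Suc Suc ` inversions n \<pi>"
proof (intro equalityI subsetI)
  fix z assume "z \<in> inversions (Suc n) (perm_cons k \<pi>)"
  then obtain a b where z: "z = (a, Suc b)" "a < Suc b" "b < n" "perm_cons k \<pi> (Suc b) < perm_cons k \<pi> a"
    by (cases z) (auto simp: inversions_def gr0_conv_Suc dest!: less_imp_Suc_add)
  show "z \<in> (\<lambda>b. (0, Suc b)) ` {b. b < n \<and> \<pi> b < k} \<union> map_prod Suc Suc ` inversions n \<pi>"
  proof (cases a)
    case 0
    then show ?thesis using z by (auto simp: perm_cons_def)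
  next
    case (Suc a')
    then have "(a', b) \<in> inversions n \<pi>" using z by (auto simp: perm_cons_def inversions_def)
    then show ?thesis using z Suc by (auto intro!: image_eqI[of _ "map_prod Suc Suc" "(a', b)"])
  qed
next
  fix z assume "z \<in> (\<lambda>b. (0, Suc b)) ` {b. b < n \<and> \<pi> b < k} \<union> map_prod Suc Suc ` inversions n \<pi>"
  then show "z \<in> inversions (Suc n) (perm_cons k \<pi>)"
    by (auto simp: inversions_def perm_cons_def)
qed

lemma finite_inversions: "finite (inversions n \<pi>)"
  by (rule finite_subset[of _ "{..<n} \<times> {..<n}"]) (auto simp: inversions_def)

definition remove_nth :: "nat \<Rightarrow> 'i list \<Rightarrow> 'i list" where "remove_nth k w = take k w @ drop (Suc k) w"

lemma length_remove_nth: "k < length w \<Longrightarrow> length (remove_nth k w) = length w - 1"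
  by (simp add: remove_nth_def)

lemma nth_remove_nth: "k < length w \<Longrightarrow> a < length w - 1 \<Longrightarrow> remove_nth k w ! a = w ! skip k a"
  by (auto simp: remove_nth_def skip_def nth_append)

lemma lsh_eq_sum:
  "lsh Q j w f = (\<Sum>k<length w. if w ! k = j then (\<Prod>l<k. Q j (w ! l)) * f (remove_nth k w) else 0)"
proof (induction w arbitrary: f)
  case (Cons i w)
  have "(\<Sum>k<length (i # w). if (i # w) ! k = j then (\<Prod>l<k. Q j ((i # w) ! l)) * f (remove_nth k (i # w)) else 0)
    = (if i = j then f w else 0)
      + (\<Sum>k<length w. if w ! k = j then Q j i * (\<Prod>l<k. Q j (w ! l)) * f (i # remove_nth k w) else 0)"
    unfolding list.size(4) add_Suc_right add_0_right Suc_eq_plus1[symmetric] sum.lessThan_Suc_shift prod.lessThan_Suc_shift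
    by (simp add: remove_nth_def cong: if_cong)
  also have "\<dots> = lsh Q j (i # w) f"
    by (simp add: Cons.IH shift_def sum_distrib_left mult.assoc if_distrib cong: if_cong)
  finally show ?case ..
qed simp

text \<open>The coefficient at w of the braid lift of \<pi> applied to u in the diagonal case:
  letter a moves to place \<open>\<pi> a\<close>, and each crossing contributes one entry of
  Q.\<close>

definition perm_coeff :: "('i \<Rightarrow> 'i \<Rightarrow> complex) \<Rightarrow> 'i list \<Rightarrow> 'i list \<Rightarrow> (nat \<Rightarrow> nat) \<Rightarrow> complex" where
  "perm_coeff Q u w \<pi> = (if length w = length u \<and> (\<forall>a<length u. w ! \<pi> a = u ! a)
     then \<Prod>(a, b)\<in>inversions (length u) \<pi>. Q (u ! a) (u ! b) else 0)"

lemma perm_coeff_perm_cons: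
  assumes \<pi>: "\<pi> permutes {..<length u}" and k: "k \<le> length u" and w: "length w = Suc (length u)"
  shows "perm_coeff Q (j # u) w (perm_cons k \<pi>)
    = (if w ! k = j then (\<Prod>l<k. Q j (w ! l)) * perm_coeff Q u (remove_nth k w) \<pi> else 0)"
proof (cases "w ! k = j \<and> (\<forall>a<length u. w ! skip k (\<pi> a) = u ! a)")
  case True
  let ?n = "length u"
  have lt: "\<pi> a < ?n" if "a < ?n" for a using permutes_in_image[OF \<pi>, of a] that by simp
  have nth: "remove_nth k w ! \<pi> a = u ! a" if "a < ?n" for a
    using nth_remove_nth[of k w "\<pi> a"] lt[OF that] k w True that by simp
  have cond: "w ! perm_cons k \<pi> a = (j # u) ! a" if "a < Suc ?n" for a
    using that True by (cases a) (auto simp: perm_cons_def)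
  have "perm_coeff Q (j # u) w (perm_cons k \<pi>)
     = (\<Prod>(a, b)\<in>inversions (Suc ?n) (perm_cons k \<pi>). Q ((j # u) ! a) ((j # u) ! b))"
    using w cond by (simp add: perm_coeff_def)
  also have "\<dots> = (\<Prod>(a, b)\<in>(\<lambda>b. (0, Suc b)) ` {b. b < ?n \<and> \<pi> b < k}. Q ((j # u) ! a) ((j # u) ! b))
     * (\<Prod>(a, b)\<in>map_prod Suc Suc ` inversions ?n \<pi>. Q ((j # u) ! a) ((j # u) ! b))"
    unfolding inversions_perm_cons by (rule prod.union_disjoint) (auto simp: finite_inversions)
  also have "(\<Prod>(a, b)\<in>map_prod Suc Suc ` inversions ?n \<pi>. Q ((j # u) ! a) ((j # u) ! b))
     = (\<Prod>(a, b)\<in>inversions ?n \<pi>. Q (u ! a) (u ! b))"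
    by (subst prod.reindex) (auto simp: inj_on_def case_prod_beta intro!: prod.cong)
  also have "(\<Prod>(a, b)\<in>(\<lambda>b. (0, Suc b)) ` {b. b < ?n \<and> \<pi> b < k}. Q ((j # u) ! a) ((j # u) ! b))
     = (\<Prod>b\<in>{b. b < ?n \<and> \<pi> b < k}. Q j (u ! b))"
    by (subst prod.reindex) (auto simp: inj_on_def)
  also have "\<dots> = (\<Prod>l<k. Q j (w ! l))"
  proof (rule prod.reindex_bij_betw[of \<pi> "{b. b < ?n \<and> \<pi> b < k}" "{..<k}" "\<lambda>l. Q j (w ! l)", THEN trans[rotated]])
    have "\<pi> ` {b. b < ?n \<and> \<pi> b < k} = {..<k}"
    proof (intro equalityI subsetI)
      fix l assume l: "l \<in> {..<k}"
      then have "l \<in> \<pi> ` {..<?n}" using permutes_image[OF \<pi>] k by auto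
      then show "l \<in> \<pi> ` {b. b < ?n \<and> \<pi> b < k}" using l by auto
    qed auto
    then show "bij_betw \<pi> {b. b < ?n \<and> \<pi> b < k} {..<k}"
      using permutes_inj_on[OF \<pi>] by (auto simp: bij_betw_def)
    show "(\<Prod>b\<in>{b. b < ?n \<and> \<pi> b < k}. Q j (u ! b)) = (\<Prod>b\<in>{b. b < ?n \<and> \<pi> b < k}. Q j (w ! \<pi> b))"
    proof (rule prod.cong)
      fix b assume "b \<in> {b. b < ?n \<and> \<pi> b < k}"
      then have "w ! \<pi> b = u ! b" using True by (auto simp: skip_def dest!: spec[of _ b])
      then show "Q j (u ! b) = Q j (w ! \<pi> b)" by simp
    qed simp
  qed
  finally show ?thesis
    using True nth length_remove_nth[of k w] k w by (simp add: perm_coeff_def)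
next
  case False
  have "remove_nth k w ! \<pi> a = w ! skip k (\<pi> a)" if "a < length u" for a
    using nth_remove_nth[of k w "\<pi> a"] permutes_in_image[OF \<pi>, of a] that k w by simp
  then have "w ! k \<noteq> j \<or> perm_coeff Q u (remove_nth k w) \<pi> = 0"
    using False by (auto simp: perm_coeff_def)
  moreover have "perm_coeff Q (j # u) w (perm_cons k \<pi>) = 0"
  proof (rule ccontr)
    assume "perm_coeff Q (j # u) w (perm_cons k \<pi>) \<noteq> 0"
    then have *: "w ! perm_cons k \<pi> a = (j # u) ! a" if "a < Suc (length u)" for a
      using that by (auto simp: perm_coeff_def split: if_splits)
    have "w ! k = j" using *[of 0] by (simp add: perm_cons_def)
    moreover have "w ! skip k (\<pi> a) = u ! a" if "a < length u" for a
      using *[of "Suc a"] that by (simp add: perm_cons_def)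
    ultimately show False using False by blast
  qed
  ultimately show ?thesis by auto
qed

text \<open>Both sides split by the slot k of the first letter, the permutations through
  \<open>perm_cons\<close> and the product through \<open>lsh_eq_sum\<close>.\<close>

theorem lshuffle_eq_sum: "lshuffle Q u w = (\<Sum>\<pi> | \<pi> permutes {..<length u}. perm_coeff Q u w \<pi>)"
proof (induction u arbitrary: w)
  case Nil
  have "{\<pi>. \<pi> permutes {..<length []}} = {id}" by (auto simp: permutes_empty)
  then show ?case by (simp add: lshuffle_simps unit_wfun_def perm_coeff_def inversions_def)
next
  case (Cons j u)
  show ?case
  proof (cases "length w = Suc (length u)")
    case True
    let ?P = "{\<pi>. \<pi> permutes {..<length u}}"
    have "(\<Sum>\<pi> | \<pi> permutes {..<length (j # u)}. perm_coeff Q (j # u) w \<pi>)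
        = (\<Sum>(k, \<pi>)\<in>{..length u} \<times> ?P. perm_coeff Q (j # u) w (perm_cons k \<pi>))"
      using sum.reindex_bij_betw[OF bij_betw_perm_cons[of "length u"], of "perm_coeff Q (j # u) w"]
      by (simp add: case_prod_beta)
    also have "\<dots> = (\<Sum>k\<le>length u. \<Sum>\<pi>\<in>?P. perm_coeff Q (j # u) w (perm_cons k \<pi>))"
      by (rule sum.cartesian_product[symmetric])
    also have "\<dots> = (\<Sum>k\<le>length u. if w ! k = j then (\<Prod>l<k. Q j (w ! l)) * lshuffle Q u (remove_nth k w) else 0)"
      using True by (intro sum.cong refl) (simp add: perm_coeff_perm_cons Cons.IH sum_distrib_left)
    also have "\<dots> = lshuffle Q (j # u) w"
      using True by (simp add: lshuffle_simps lsh_eq_sum lessThan_Suc_atMost)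
    finally show ?thesis ..
  next
    case False
    have "lshuffle Q u (remove_nth k w) = 0" if "k < length w" for k
    proof -
      have "length (remove_nth k w) \<noteq> length u" using False that by (simp add: length_remove_nth)
      then show ?thesis by (simp add: Cons.IH perm_coeff_def)
    qed
    then have "lshuffle Q (j # u) w = 0"
      unfolding lshuffle_simps lsh_eq_sum by (intro sum.neutral) auto
    then show ?thesis using False by (simp add: perm_coeff_def)
  qed
qed

lemma lshuffle_nonzeroD:
  assumes "lshuffle Q u w \<noteq> 0" shows "length w = length u" "set w \<subseteq> set u"
proof -
  obtain \<pi> where \<pi>: "\<pi> permutes {..<length u}" "perm_coeff Q u w \<pi> \<noteq> 0"
    by (rule sum.not_neutral_contains_not_neutral[OF assms[unfolded lshuffle_eq_sum]]) auto
  then have *: "length w = length u" "\<And>a. a < length u \<Longrightarrow> w ! \<pi> a = u ! a"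
    by (auto simp: perm_coeff_def split: if_splits)
  then show "length w = length u" by simp
  show "set w \<subseteq> set u"
  proof
    fix y assume "y \<in> set w"
    then obtain b where b: "b < length u" "y = w ! b" using *(1) by (auto simp: in_set_conv_nth)
    then obtain a where "a < length u" "b = \<pi> a"
      using permutes_image[OF \<pi>(1)] by (metis imageE lessThan_iff)
    then show "y \<in> set u" using * b by auto
  qed
qed

section \<open>Reduced words and functionals on the tensor algebra\<close>

abbreviation adj_swap :: "nat \<Rightarrow> nat \<Rightarrow> nat" where
  "adj_swap i \<equiv> Transposition.transpose i (Suc i)"

text \<open>Swapping two adjacent values affects only the comparison of the two places that carry
  them.\<close>

lemma perm_swap_inversions:
  assumes \<sigma>: "\<sigma> permutes {..<n}" and i: "Suc i < n" and p: "\<sigma> p = i" "\<sigma> p' = Suc i" "p < p'"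
  shows "inversions n (adj_swap i \<circ> \<sigma>) = insert (p, p') (inversions n \<sigma>)"
    and "(p, p') \<notin> inversions n \<sigma>"
proof -
  have p': "p' < n" using permutes_in_image[OF \<sigma>, of p'] p i by simp
  have inj: "\<sigma> a = \<sigma> b \<longleftrightarrow> a = b" for a b using permutes_inj[OF \<sigma>] by (auto dest: injD)
  have eq: "\<sigma> a = i \<longleftrightarrow> a = p" "\<sigma> a = Suc i \<longleftrightarrow> a = p'" for a using inj p by metis+
  have "(a, b) \<in> inversions n (adj_swap i \<circ> \<sigma>) \<longleftrightarrow> (a, b) \<in> insert (p, p') (inversions n \<sigma>)" for a b
  proof (cases "a < b")
    case True
    have "adj_swap i (\<sigma> b) < adj_swap i (\<sigma> a)
        \<longleftrightarrow> ((\<sigma> b < \<sigma> a) \<noteq> ({\<sigma> a, \<sigma> b} = {i, Suc i}))"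
      using True inj[of a b] by (simp add: Transposition.transpose_def doubleton_eq_iff) linarith
    moreover have "{\<sigma> a, \<sigma> b} = {i, Suc i} \<longleftrightarrow> a = p \<and> b = p'"
      using True p(3) by (auto simp: doubleton_eq_iff eq)
    ultimately show ?thesis
      using True p' p by (auto simp: inversions_def)
  next
    case False
    then show ?thesis using p(3) by (auto simp: inversions_def)
  qed
  then show "inversions n (adj_swap i \<circ> \<sigma>) = insert (p, p') (inversions n \<sigma>)" by auto
  show "(p, p') \<notin> inversions n \<sigma>" using p by (simp add: inversions_def)
qed

lemma perm_of_word_simps: "perm_of_word [] = id"
  "perm_of_word (i # is) = adj_swap i \<circ> perm_of_word is"
  by (simp_all add: perm_of_word_def)

lemma perm_of_word_permutes:
  "(\<forall>i\<in>set is. Suc i < n) \<Longrightarrow> perm_of_word is permutes {..<n}"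
proof (induction "is")
  case (Cons i "is")
  then have "adj_swap i permutes {..<n}" by (intro permutes_swap_id) auto
  moreover have "perm_of_word is permutes {..<n}" using Cons by simp
  ultimately show ?case unfolding perm_of_word_simps by (intro permutes_compose)
qed (simp only: perm_of_word_simps permutes_id)

lemma card_inversions_swap_le:
  assumes \<sigma>: "\<sigma> permutes {..<n}" and i: "Suc i < n"
  shows "card (inversions n (adj_swap i \<circ> \<sigma>)) \<le> Suc (card (inversions n \<sigma>))"
    and "card (inversions n (adj_swap i \<circ> \<sigma>)) = Suc (card (inversions n \<sigma>)) \<Longrightarrow>
      \<exists>p p'. \<sigma> p = i \<and> \<sigma> p' = Suc i \<and> p < p'"
proof -
  obtain p p' where p: "\<sigma> p = i" "\<sigma> p' = Suc i" using permutes_surj[OF \<sigma>] by (metis surjD)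
  let ?\<tau> = "adj_swap i \<circ> \<sigma>"
  have "p < p' \<or> card (inversions n \<sigma>) = Suc (card (inversions n ?\<tau>))"
  proof (cases "p < p'")
    case False
    have "?\<tau> permutes {..<n}" using i by (intro permutes_compose[OF \<sigma>] permutes_swap_id) auto
    moreover have "p' < p" using False p by (metis n_not_Suc_n linorder_neqE_nat)
    ultimately have "inversions n (adj_swap i \<circ> ?\<tau>) = insert (p', p) (inversions n ?\<tau>)"
      "(p', p) \<notin> inversions n ?\<tau>"
      using perm_swap_inversions[of ?\<tau> n i p' p] i p by simp_all
    moreover have "adj_swap i \<circ> ?\<tau> = \<sigma>" by (simp flip: comp_assoc)
    ultimately show ?thesis by (simp add: finite_inversions)
  qed simp
  moreover have "card (inversions n ?\<tau>) = Suc (card (inversions n \<sigma>))" if "p < p'"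
    using perm_swap_inversions[OF \<sigma> i p that] by (simp add: finite_inversions)
  ultimately show "card (inversions n ?\<tau>) \<le> Suc (card (inversions n \<sigma>))"
    and "card (inversions n ?\<tau>) = Suc (card (inversions n \<sigma>)) \<Longrightarrow> \<exists>p p'. \<sigma> p = i \<and> \<sigma> p' = Suc i \<and> p < p'"
    using p by auto
qed

lemma card_inversions_le_length:
  "(\<forall>i\<in>set is. Suc i < n) \<Longrightarrow> card (inversions n (perm_of_word is)) \<le> length is"
proof (induction "is")
  case Nil
  have "inversions n id = {}" by (auto simp: inversions_def)
  then show ?case unfolding perm_of_word_simps by (simp only: card.empty)
next
  case (Cons i "is")
  then have "card (inversions n (perm_of_word is)) \<le> length is"
    and "perm_of_word is permutes {..<n}" and "Suc i < n"
    using perm_of_word_permutes by auto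
  then show ?case
    unfolding perm_of_word_simps list.size using card_inversions_swap_le(1)[of "perm_of_word is" n i] by linarith
qed

text \<open>Each letter adds at most one inversion, so in a word as long as its number of inversions
  every letter adds exactly one. Hence the tail is reduced, and the value i still stands in front of
  the value i + 1 before the swap.\<close>

lemma is_reduced_word_Cons:
  assumes "is_reduced_word n \<pi> (i # is)"
  obtains \<sigma> p p' where "is_reduced_word n \<sigma> is" "\<pi> = adj_swap i \<circ> \<sigma>"
    "\<sigma> permutes {..<n}" "\<sigma> p = i" "\<sigma> p' = Suc i" "p < p'" "Suc i < n"
proof -
  define \<sigma> where "\<sigma> = perm_of_word is"
  have i: "Suc i < n" and "is": "\<forall>i\<in>set is. Suc i < n" and \<pi>: "\<pi> = adj_swap i \<circ> \<sigma>"
    and len: "Suc (length is) = card (inversions n \<pi>)"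
    using assms by (auto simp: is_reduced_word_def perm_of_word_def \<sigma>_def)
  have \<sigma>: "\<sigma> permutes {..<n}" unfolding \<sigma>_def by (rule perm_of_word_permutes[OF "is"])
  have "card (inversions n \<sigma>) \<le> length is"
    unfolding \<sigma>_def by (rule card_inversions_le_length[OF "is"])
  then have eq: "card (inversions n \<pi>) = Suc (card (inversions n \<sigma>))" "length is = card (inversions n \<sigma>)"
    using card_inversions_swap_le(1)[OF \<sigma> i] len \<pi> by auto
  then show thesis
    using that[of \<sigma>] card_inversions_swap_le(2)[OF \<sigma> i] i "is" \<pi> \<sigma> by (auto simp: is_reduced_word_def \<sigma>_def)
qed

section \<open>Linear maps and functionals on the free tensor space\<close>

lemma keys_lin_ext: "Poly_Mapping.keys (lin_ext f p) \<subseteq> (\<Union>u\<in>Poly_Mapping.keys p. Poly_Mapping.keys (f u))"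
proof
  fix w assume "w \<in> Poly_Mapping.keys (lin_ext f p)"
  then have "(\<Sum>u\<in>Poly_Mapping.keys p. Poly_Mapping.lookup p u * Poly_Mapping.lookup (f u) w) \<noteq> 0"
    by (simp add: lin_ext_def Poly_Mapping.lookup_sum lookup_tscale in_keys_iff)
  then obtain u where "u \<in> Poly_Mapping.keys p" "Poly_Mapping.lookup p u * Poly_Mapping.lookup (f u) w \<noteq> 0"
    by (rule sum.not_neutral_contains_not_neutral)
  then show "w \<in> (\<Union>u\<in>Poly_Mapping.keys p. Poly_Mapping.keys (f u))"
    by (auto simp: in_keys_iff)
qed

lemma lin_ext_superset:
  assumes "finite S" "Poly_Mapping.keys p \<subseteq> S"
  shows "lin_ext f p = (\<Sum>u\<in>S. tscale (Poly_Mapping.lookup p u) (f u))"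
  unfolding lin_ext_def using assms by (intro sum.mono_neutral_left) (auto simp: in_keys_iff)

lemma linear_lin_ext: "lin_endo tscale (lin_ext f)"
proof -
  have "lin_ext f (p + q) = lin_ext f p + lin_ext f q" for p q
  proof -
    let ?S = "Poly_Mapping.keys p \<union> Poly_Mapping.keys q"
    have "Poly_Mapping.keys (p + q) \<subseteq> ?S" by (rule Poly_Mapping.keys_add)
    then show ?thesis
      by (simp add: lin_ext_superset[of ?S] Poly_Mapping.lookup_add tens.scale_left_distrib sum.distrib)
  qed
  moreover have "lin_ext f (tscale a p) = tscale a (lin_ext f p)" for a p
  proof -
    have "Poly_Mapping.keys (tscale a p) \<subseteq> Poly_Mapping.keys p"
      by (auto simp: in_keys_iff lookup_tscale)
    then have "lin_ext f (tscale a p)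
        = (\<Sum>u\<in>Poly_Mapping.keys p. tscale (Poly_Mapping.lookup (tscale a p) u) (f u))"
      by (intro lin_ext_superset) auto
    then show ?thesis
      by (simp add: lin_ext_def lookup_tscale tens.scale_sum_right)
  qed
  ultimately show ?thesis
    by (simp add: Vector_Spaces.linear_iff tens.vector_space_axioms)
qed

lemma lin_ext_word: "lin_ext f (word u) = f u"
  by (simp add: lin_ext_def word_def)

definition word_functional :: "('m list \<Rightarrow> complex) \<Rightarrow> 'm tens \<Rightarrow> complex" where
  "word_functional g p = (\<Sum>u\<in>Poly_Mapping.keys p. Poly_Mapping.lookup p u * g u)"

lemma word_functional_superset:
  assumes "finite S" "Poly_Mapping.keys p \<subseteq> S"
  shows "word_functional g p = (\<Sum>u\<in>S. Poly_Mapping.lookup p u * g u)"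
  unfolding word_functional_def using assms by (intro sum.mono_neutral_left) (auto simp: in_keys_iff)

lemma word_functional_add: "word_functional g (p + q) = word_functional g p + word_functional g q"
proof -
  let ?S = "Poly_Mapping.keys p \<union> Poly_Mapping.keys q"
  have "Poly_Mapping.keys (p + q) \<subseteq> ?S" by (rule Poly_Mapping.keys_add)
  then show ?thesis
    by (simp add: word_functional_superset[of ?S] Poly_Mapping.lookup_add distrib_right sum.distrib)
qed

lemma word_functional_scale: "word_functional g (tscale a p) = a * word_functional g p"
proof -
  have "Poly_Mapping.keys (tscale a p) \<subseteq> Poly_Mapping.keys p"
    by (auto simp: in_keys_iff lookup_tscale)
  then have "word_functional g (tscale a p)
      = (\<Sum>u\<in>Poly_Mapping.keys p. Poly_Mapping.lookup (tscale a p) u * g u)"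
    by (intro word_functional_superset) auto
  then show ?thesis
    by (simp add: word_functional_def lookup_tscale sum_distrib_left mult.assoc)
qed

lemma word_functional_zero: "word_functional g 0 = 0"
  by (simp add: word_functional_def)

lemma word_functional_minus: "word_functional g (p - q) = word_functional g p - word_functional g q"
  using word_functional_add[of g "p - q" q] by simp

lemma word_functional_sum: "word_functional g (\<Sum>x\<in>S. f x) = (\<Sum>x\<in>S. word_functional g (f x))"
  by (induction S rule: infinite_finite_induct) (simp_all add: word_functional_zero word_functional_add)

lemma word_functional_word: "word_functional g (word u) = g u"
  by (simp add: word_functional_def word_def)

lemma word_functional_lin_ext:
  "word_functional g (lin_ext f p) = word_functional (\<lambda>u. word_functional g (f u)) p"
  by (simp add: lin_ext_def word_functional_sum word_functional_scale word_functional_def[of _ p])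

lemma word_functional_cong:
  "(\<And>u. u \<in> Poly_Mapping.keys p \<Longrightarrow> g u = h u) \<Longrightarrow> word_functional g p = word_functional h p"
  by (simp add: word_functional_def)

lemma word_functional_mult: "word_functional (\<lambda>u. d * g u) p = d * word_functional g p"
  by (simp add: word_functional_def sum_distrib_left mult.left_commute)

section \<open>Diagonal parts of a braiding\<close>

definition act :: "(nat \<Rightarrow> nat) \<Rightarrow> 'i list \<Rightarrow> 'i list" where
  "act \<pi> w = map (\<lambda>k. w ! \<pi> k) [0..<length w]"

lemma length_act [simp]: "length (act \<pi> w) = length w"
  by (simp add: act_def)

lemma nth_act: "k < length w \<Longrightarrow> act \<pi> w ! k = w ! \<pi> k"
  by (simp add: act_def)

lemma set_act:
  assumes "\<pi> permutes {..<length w}" shows "set (act \<pi> w) \<subseteq> set w"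
proof
  fix y assume "y \<in> set (act \<pi> w)"
  then obtain k where "k < length w" "y = w ! \<pi> k" by (auto simp: act_def)
  then show "y \<in> set w" using permutes_in_image[OF assms, of k] by simp
qed

lemma act_id: "act id w = w"
  by (simp add: act_def map_nth)

lemma act_act:
  assumes "\<sigma> permutes {..<length w}" shows "act \<sigma> (act \<tau> w) = act (\<tau> \<circ> \<sigma>) w"
proof (rule nth_equalityI)
  fix k assume "k < length (act \<sigma> (act \<tau> w))"
  then show "act \<sigma> (act \<tau> w) ! k = act (\<tau> \<circ> \<sigma>) w ! k"
    using permutes_in_image[OF assms, of k] by (simp add: nth_act)
qed simp

lemma is_reduced_wordD: "is_reduced_word n \<pi> is \<Longrightarrow> \<forall>i\<in>set is. Suc i < n"
  by (simp add: is_reduced_word_def)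

text \<open>The braiding returns representatives, so on multiples of the \<open>x i\<close> it is
  diagonal only up to words with a letter 0. These represent zero and have to stay recognisable
  under further braidings, hence \<open>c_zero\<close>. The scalars a and b appear because braided
  letters are themselves multiples of the \<open>x i\<close>.\<close>

locale diagonal_part =
  fixes sc :: "complex \<Rightarrow> 'm::ab_group_add \<Rightarrow> 'm" and M :: "'m set" and c :: "'m \<Rightarrow> 'm \<Rightarrow> 'm tens"
    and I :: "'i set" and x :: "'i \<Rightarrow> 'm" and \<phi> :: "'i \<Rightarrow> 'm \<Rightarrow> complex" and Q :: "'i \<Rightarrow> 'i \<Rightarrow> complex"
  assumes \<phi>_add: "\<phi> i (y + z) = \<phi> i y + \<phi> i z" and \<phi>_sc: "\<phi> i (sc a y) = a * \<phi> i y"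
    and \<phi>_x: "i \<in> I \<Longrightarrow> j \<in> I \<Longrightarrow> \<phi> i (x j) = (if i = j then 1 else 0)"
    and x_M: "i \<in> I \<Longrightarrow> x i \<in> M" and sc_one: "sc 1 y = y"
    and c_length: "v \<in> Poly_Mapping.keys (c y z) \<Longrightarrow> length v = 2"
    and c_zero: "y = 0 \<or> z = 0 \<Longrightarrow> v \<in> Poly_Mapping.keys (c y z) \<Longrightarrow> 0 \<in> set v"
    and c_letter: "i \<in> I \<Longrightarrow> j \<in> I \<Longrightarrow> \<exists>r. c (sc a (x i)) (sc b (x j))
       = word [sc (Q i j * b) (x j), sc a (x i)] + r \<and> (\<forall>v\<in>Poly_Mapping.keys r. length v = 2 \<and> 0 \<in> set v)"
begin

lemma \<phi>_zero: "\<phi> i 0 = 0"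
  using \<phi>_add[of i 0 0] by simp

definition letter :: "'m \<Rightarrow> bool" where "letter y \<longleftrightarrow> (\<exists>a. \<exists>i\<in>I. y = sc a (x i))"

text \<open>The invariant kept by \<open>braid_at\<close>: a word that is not made of multiples of
  the \<open>x i\<close> contains 0 and is invisible to the functionals \<open>ev\<close>.\<close>

definition good :: "nat \<Rightarrow> 'm tens \<Rightarrow> bool" where
  "good n p \<longleftrightarrow> (\<forall>u\<in>Poly_Mapping.keys p. length u = n \<and> (0 \<in> set u \<or> (\<forall>y\<in>set u. letter y)))"

definition evw :: "'i list \<Rightarrow> 'm list \<Rightarrow> complex" where
  "evw w u = (if length u = length w then \<Prod>k<length w. \<phi> (w ! k) (u ! k) else 0)"

abbreviation ev :: "'i list \<Rightarrow> 'm tens \<Rightarrow> complex" where "ev w \<equiv> word_functional (evw w)"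

lemma split_at:
  assumes "Suc i < length u" shows "u = take i u @ [u ! i, u ! Suc i] @ drop (i + 2) u"
  using assms by (metis Cons_nth_drop_Suc Suc_lessD add_2_eq_Suc' append_Cons append_Nil append_take_drop_id)

lemma keys_braid_at:
  assumes "v \<in> Poly_Mapping.keys (braid_at c i p)"
  obtains u t where "u \<in> Poly_Mapping.keys p" "t \<in> Poly_Mapping.keys (c (u ! i) (u ! (i + 1)))"
    "v = take i u @ t @ drop (i + 2) u"
proof -
  obtain u where u: "u \<in> Poly_Mapping.keys p"
    "v \<in> Poly_Mapping.keys (lin_ext (\<lambda>t. word (take i u @ t @ drop (i + 2) u)) (c (u ! i) (u ! (i + 1))))"
    using assms keys_lin_ext unfolding braid_at_def by fastforce
  then obtain t where "t \<in> Poly_Mapping.keys (c (u ! i) (u ! (i + 1)))"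
    "v \<in> Poly_Mapping.keys (word (take i u @ t @ drop (i + 2) u))"
    using keys_lin_ext by fastforce
  then show thesis using that u by (simp add: word_def)
qed

lemma length_braid_at:
  assumes "\<And>u. u \<in> Poly_Mapping.keys p \<Longrightarrow> length u = n" "Suc i < n" "v \<in> Poly_Mapping.keys (braid_at c i p)"
  shows "length v = n"
  using assms(3)
proof (rule keys_braid_at)
  fix u t assume "u \<in> Poly_Mapping.keys p" "t \<in> Poly_Mapping.keys (c (u ! i) (u ! (i + 1)))"
    and v: "v = take i u @ t @ drop (i + 2) u"
  then have "length u = n" "length t = 2" using assms(1) c_length by auto
  then show "length v = n" using assms(2) v by simp
qed

lemma good_braid_at:
  assumes p: "good n p" and i: "Suc i < n" shows "good n (braid_at c i p)"
  unfolding good_def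
proof
  fix v assume v: "v \<in> Poly_Mapping.keys (braid_at c i p)"
  have "length v = n" using length_braid_at[OF _ i v] p by (auto simp: good_def)
  moreover have "0 \<in> set v \<or> (\<forall>y\<in>set v. letter y)"
    using v
  proof (rule keys_braid_at)
    fix u t assume u: "u \<in> Poly_Mapping.keys p" and t: "t \<in> Poly_Mapping.keys (c (u ! i) (u ! (i + 1)))"
      and v: "v = take i u @ t @ drop (i + 2) u"
    have len: "length u = n" using p u by (auto simp: good_def)
    have set_u: "set u = set (take i u) \<union> {u ! i, u ! Suc i} \<union> set (drop (i + 2) u)"
      by (subst split_at[of i u]) (use i len in auto)
    consider "0 \<in> set u" | "\<forall>y\<in>set u. letter y" using p u by (auto simp: good_def)
    then show ?thesis
    proof cases
      case 1
      then consider "0 \<in> set (take i u) \<union> set (drop (i + 2) u)" | "u ! i = 0 \<or> u ! Suc i = 0"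
        unfolding set_u by auto
      then show ?thesis
      proof cases
        case 2
        then have "0 \<in> set t" using c_zero t by fastforce
        then show ?thesis using v by simp
      qed (auto simp: v)
    next
      case 2
      have "letter (u ! i)" "letter (u ! Suc i)" using 2 set_u by auto
      then obtain a b k l where k: "k \<in> I" "u ! i = sc a (x k)" and l: "l \<in> I" "u ! Suc i = sc b (x l)"
        unfolding letter_def by blast
      from c_letter[OF k(1) l(1), of a b] obtain r where
        r: "c (u ! i) (u ! (i + 1)) = word [sc (Q k l * b) (x l), sc a (x k)] + r"
          "\<And>v. v \<in> Poly_Mapping.keys r \<Longrightarrow> 0 \<in> set v"
        using k l by auto
      have "t = [sc (Q k l * b) (x l), sc a (x k)] \<or> t \<in> Poly_Mapping.keys r"
        using t Poly_Mapping.keys_add[of "word [sc (Q k l * b) (x l), sc a (x k)]" r] unfolding r(1)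
        by (auto simp: word_def)
      then show ?thesis
      proof
        assume "t = [sc (Q k l * b) (x l), sc a (x k)]"
        then have "\<forall>y\<in>set t. letter y" using k l by (auto simp: letter_def)
        then show ?thesis using 2 unfolding v set_u by auto
      next
        assume "t \<in> Poly_Mapping.keys r"
        then show ?thesis using r(2) v by auto
      qed
    qed
  qed
  ultimately show "length v = n \<and> (0 \<in> set v \<or> (\<forall>y\<in>set v. letter y))" by blast
qed

lemma prod_split_at:
  fixes f :: "nat \<Rightarrow> complex"
  assumes "Suc i < n" shows "(\<Prod>k<n. f k) = (\<Prod>k\<in>{..<n} - {i, Suc i}. f k) * (f i * f (Suc i))"
proof -
  have "(\<Prod>k<n. f k) = (\<Prod>k\<in>{..<n} - {i, Suc i}. f k) * (\<Prod>k\<in>{i, Suc i}. f k)"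
    using assms by (intro prod.subset_diff) auto
  then show ?thesis by simp
qed

text \<open>The transpose of the braiding acts on functionals. After the crossing the places i and i
  + 1 carry the old second and first letter, so the index \<open>w ! Suc i\<close> comes first in
  Q.\<close>

lemma ev_braid_at:
  assumes p: "good n p" and i: "Suc i < n" and w: "length w = n" "set w \<subseteq> I"
  shows "ev w (braid_at c i p) = Q (w ! Suc i) (w ! i) * ev (act (adj_swap i) w) p"
proof -
  let ?\<tau> = "adj_swap i"
  have wI: "w ! i \<in> I" "w ! Suc i \<in> I" using w i by (auto intro: nth_mem[THEN subsetD[OF w(2)]])
  have "word_functional (\<lambda>t. evw w (take i u @ t @ drop (i + 2) u)) (c (u ! i) (u ! (i + 1)))
      = Q (w ! Suc i) (w ! i) * evw (act ?\<tau> w) u" if u: "u \<in> Poly_Mapping.keys p" for u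
  proof -
    have len: "length u = n" and good: "0 \<in> set u \<or> (\<forall>y\<in>set u. letter y)" using p u by (auto simp: good_def)
    define rest where "rest = (\<Prod>k\<in>{..<n} - {i, Suc i}. \<phi> (w ! k) (u ! k))"
    define e where "e = word_functional (\<lambda>t. \<phi> (w ! i) (t ! 0) * \<phi> (w ! Suc i) (t ! 1)) (c (u ! i) (u ! (i + 1)))"
    have "evw w (take i u @ t @ drop (i + 2) u) = rest * (\<phi> (w ! i) (t ! 0) * \<phi> (w ! Suc i) (t ! 1))"
      if t: "t \<in> Poly_Mapping.keys (c (u ! i) (u ! (i + 1)))" for t
    proof -
      have t2: "length t = 2" using c_length t by blast
      have nth: "(take i u @ t @ drop (i + 2) u) ! k = u ! k" if "k \<in> {..<n} - {i, Suc i}" for k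
      proof (cases "k < i")
        case False
        then have "i + 2 \<le> k" "k < n" using that by auto
        then obtain d where "k = i + 2 + d" "k < n" using le_Suc_ex by blast
        then show ?thesis using t2 len i by (simp add: nth_append)
      qed (use len i in \<open>simp add: nth_append\<close>)
      have nth_i: "(take i u @ t @ drop (i + 2) u) ! i = t ! 0" "(take i u @ t @ drop (i + 2) u) ! Suc i = t ! 1"
        using t2 len i by (simp_all add: nth_append)
      have "evw w (take i u @ t @ drop (i + 2) u) = (\<Prod>k<n. \<phi> (w ! k) ((take i u @ t @ drop (i + 2) u) ! k))"
        using t2 len i w(1) by (simp add: evw_def)
      also have "\<dots> = rest * (\<phi> (w ! i) (t ! 0) * \<phi> (w ! Suc i) (t ! 1))"
        unfolding prod_split_at[OF i] nth_i rest_def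
        by (intro arg_cong2[where f = "(*)"] refl prod.cong) (simp only: nth)
      finally show ?thesis .
    qed
    then have "word_functional (\<lambda>t. evw w (take i u @ t @ drop (i + 2) u)) (c (u ! i) (u ! (i + 1))) = rest * e"
      unfolding e_def word_functional_mult[symmetric] by (rule word_functional_cong)
    moreover have "evw (act ?\<tau> w) u = rest * (\<phi> (w ! Suc i) (u ! i) * \<phi> (w ! i) (u ! Suc i))"
    proof -
      have nth: "act ?\<tau> w ! k = w ! k" if "k \<in> {..<n} - {i, Suc i}" for k
        using that w(1) by (simp add: nth_act Transposition.transpose_def)
      have nth_i: "act ?\<tau> w ! i = w ! Suc i" "act ?\<tau> w ! Suc i = w ! i"
        using i w(1) by (simp_all add: nth_act)
      have "evw (act ?\<tau> w) u = (\<Prod>k<n. \<phi> (act ?\<tau> w ! k) (u ! k))"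
        using len w(1) by (simp add: evw_def)
      also have "\<dots> = rest * (\<phi> (w ! Suc i) (u ! i) * \<phi> (w ! i) (u ! Suc i))"
        unfolding prod_split_at[OF i] nth_i rest_def
        by (intro arg_cong2[where f = "(*)"] refl prod.cong) (simp only: nth)
      finally show ?thesis .
    qed
    \<comment> \<open>If u contains 0 both sides vanish. Otherwise only the diagonal term of the
      braiding is seen, as every word of the remainder contains 0.\<close>
    moreover have "rest * e = Q (w ! Suc i) (w ! i) * (rest * (\<phi> (w ! Suc i) (u ! i) * \<phi> (w ! i) (u ! Suc i)))"
    proof (cases "0 \<in> set u")
      case True
      then obtain k where k: "k < n" "u ! k = 0" using len by (auto simp: in_set_conv_nth)
      show ?thesis
      proof (cases "k \<in> {i, Suc i}")
        case True
        have "\<phi> (w ! i) (t ! 0) * \<phi> (w ! Suc i) (t ! 1) = 0" if t: "t \<in> Poly_Mapping.keys (c (u ! i) (u ! (i + 1)))" for t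
        proof -
          have "0 \<in> set t" using c_zero[OF _ t] True k(2) by auto
          moreover have "t = [t ! 0, t ! 1]"
            using c_length[OF t] by (auto simp: numeral_2_eq_2 length_Suc_conv)
          ultimately have "t ! 0 = 0 \<or> t ! 1 = 0" by (metis empty_iff insert_iff list.set)
          then show ?thesis by (auto simp: \<phi>_zero)
        qed
        then have "e = 0"
          unfolding e_def word_functional_def by (intro sum.neutral ballI) (simp only: mult_zero_right)
        then show ?thesis using True k(2) by (auto simp: \<phi>_zero)
      next
        case False
        then have "\<exists>k\<in>{..<n} - {i, Suc i}. \<phi> (w ! k) (u ! k) = 0"
          using k \<phi>_zero by (intro bexI[of _ k]) auto
        then have "rest = 0" unfolding rest_def by (intro prod_zero) auto
        then show ?thesis by simp
      qed
    next
      case False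
      then have "letter (u ! i)" "letter (u ! Suc i)" using good len i by auto
      then obtain a b k l where k: "k \<in> I" "u ! i = sc a (x k)" and l: "l \<in> I" "u ! Suc i = sc b (x l)"
        unfolding letter_def by blast
      from c_letter[OF k(1) l(1), of a b] obtain r where
        r: "c (u ! i) (u ! (i + 1)) = word [sc (Q k l * b) (x l), sc a (x k)] + r"
          "\<And>v. v \<in> Poly_Mapping.keys r \<Longrightarrow> length v = 2 \<and> 0 \<in> set v"
        using k l by auto
      have "\<phi> (w ! i) (t ! 0) * \<phi> (w ! Suc i) (t ! 1) = 0" if t: "t \<in> Poly_Mapping.keys r" for t
      proof -
        have "0 \<in> set t" using r(2)[OF t] by simp
        moreover have "t = [t ! 0, t ! 1]"
          using r(2)[OF t] by (auto simp: numeral_2_eq_2 length_Suc_conv)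
        ultimately have "t ! 0 = 0 \<or> t ! 1 = 0" by (metis empty_iff insert_iff list.set)
        then show ?thesis by (auto simp: \<phi>_zero)
      qed
      then have r0: "word_functional (\<lambda>t. \<phi> (w ! i) (t ! 0) * \<phi> (w ! Suc i) (t ! 1)) r = 0"
        unfolding word_functional_def by (intro sum.neutral ballI) (simp only: mult_zero_right)
      have "e = \<phi> (w ! i) (sc (Q k l * b) (x l)) * \<phi> (w ! Suc i) (sc a (x k))"
        unfolding e_def r(1) word_functional_add word_functional_word r0 by simp
      then show ?thesis
        using wI k l by (auto simp: \<phi>_sc \<phi>_x)
    qed
    ultimately show ?thesis by simp
  qed
  then have "word_functional (\<lambda>u. word_functional (\<lambda>t. evw w (take i u @ t @ drop (i + 2) u)) (c (u ! i) (u ! (i + 1)))) p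
      = word_functional (\<lambda>u. Q (w ! Suc i) (w ! i) * evw (act ?\<tau> w) u) p"
    by (rule word_functional_cong)
  then show ?thesis
    unfolding braid_at_def word_functional_lin_ext word_functional_word word_functional_mult .
qed

text \<open>Induction peels off the outermost operator, whose crossing is the single inversion
  gained. The resulting coefficient depends on \<pi> alone, so it is the same for whichever reduced
  word is chosen.\<close>

lemma ev_reduced_word:
  "is_reduced_word n \<pi> is \<Longrightarrow> good n p \<Longrightarrow> good n (foldr (\<lambda>i f. braid_at c i \<circ> f) is id p) \<and>
    (\<forall>w. length w = n \<longrightarrow> set w \<subseteq> I \<longrightarrow> ev w (foldr (\<lambda>i f. braid_at c i \<circ> f) is id p)
      = (\<Prod>(a, b)\<in>inversions n \<pi>. Q (w ! \<pi> a) (w ! \<pi> b)) * ev (act \<pi> w) p)"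
proof (induction "is" arbitrary: \<pi>)
  case Nil
  then have "\<pi> = id" by (simp add: is_reduced_word_def perm_of_word_def)
  moreover have "inversions n id = {}" by (auto simp: inversions_def)
  ultimately show ?case using Nil(2) by (simp only: act_id) simp
next
  case (Cons i "is")
  from is_reduced_word_Cons[OF Cons.prems(1)] obtain \<sigma> p1 p2
    where \<sigma>: "is_reduced_word n \<sigma> is" "\<sigma> permutes {..<n}" "\<sigma> p1 = i" "\<sigma> p2 = Suc i" "p1 < p2" "Suc i < n"
      and \<pi>: "\<pi> = adj_swap i \<circ> \<sigma>" by metis
  let ?\<tau> = "adj_swap i"
  define z where "z = foldr (\<lambda>i f. braid_at c i \<circ> f) is id p"
  have z: "good n z" and evz: "\<And>w. length w = n \<Longrightarrow> set w \<subseteq> I \<Longrightarrow> ev w z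
      = (\<Prod>(a, b)\<in>inversions n \<sigma>. Q (w ! \<sigma> a) (w ! \<sigma> b)) * ev (act \<sigma> w) p"
    unfolding z_def using Cons.IH[OF \<sigma>(1) Cons.prems(2)] by blast+
  have \<tau>: "?\<tau> permutes {..<n}" using \<sigma>(6) by (intro permutes_swap_id) auto
  note inv = perm_swap_inversions[OF \<sigma>(2,6,3,4,5), folded \<pi>]
  have "ev w (braid_at c i z) = (\<Prod>(a, b)\<in>inversions n \<pi>. Q (w ! \<pi> a) (w ! \<pi> b)) * ev (act \<pi> w) p"
    if w: "length w = n" "set w \<subseteq> I" for w
  proof -
    have "ev (act ?\<tau> w) z
      = (\<Prod>(a, b)\<in>inversions n \<sigma>. Q (act ?\<tau> w ! \<sigma> a) (act ?\<tau> w ! \<sigma> b)) * ev (act \<sigma> (act ?\<tau> w)) p"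
      using w set_act[of ?\<tau> w] \<tau> by (intro evz) auto
    also have "act \<sigma> (act ?\<tau> w) = act \<pi> w"
      using \<sigma>(2) w(1) unfolding \<pi> by (intro act_act) simp
    also have "(\<Prod>(a, b)\<in>inversions n \<sigma>. Q (act ?\<tau> w ! \<sigma> a) (act ?\<tau> w ! \<sigma> b))
      = (\<Prod>(a, b)\<in>inversions n \<sigma>. Q (w ! \<pi> a) (w ! \<pi> b))"
    proof (intro prod.cong refl, clarify)
      fix a b assume "(a, b) \<in> inversions n \<sigma>"
      then have "\<sigma> a < n" "\<sigma> b < n"
        using permutes_in_image[OF \<sigma>(2), of a] permutes_in_image[OF \<sigma>(2), of b] by (simp_all add: inversions_def)
      then show "Q (act ?\<tau> w ! \<sigma> a) (act ?\<tau> w ! \<sigma> b) = Q (w ! \<pi> a) (w ! \<pi> b)"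
        using w(1) by (simp add: \<pi> nth_act)
    qed
    finally have "ev (act ?\<tau> w) z = (\<Prod>(a, b)\<in>inversions n \<sigma>. Q (w ! \<pi> a) (w ! \<pi> b)) * ev (act \<pi> w) p" .
    \<comment> \<open>The factor from \<open>ev_braid_at\<close> belongs to the new inversion
      \<open>(p1, p2)\<close>, whose places carry \<open>Suc i\<close> and \<open>i\<close> after
      the swap.\<close>
    then show ?thesis
      unfolding ev_braid_at[OF z \<sigma>(6) w] inv(1) prod.insert[OF finite_inversions inv(2)]
      using \<sigma>(3,4) by (simp add: \<pi>)
  qed
  moreover have "foldr (\<lambda>i f. braid_at c i \<circ> f) (i # is) id p = braid_at c i z"
    unfolding z_def by (simp only: foldr.simps o_apply)
  ultimately show ?case using good_braid_at[OF z \<sigma>(6)] by metis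
qed

lemma ev_braid_perm:
  assumes \<pi>: "\<pi> permutes {..<length u}" and u: "set u \<subseteq> I" and w: "length w = length u" "set w \<subseteq> I"
  shows "ev w (braid_perm c (length u) \<pi> (word (map x u))) = perm_coeff Q u w \<pi>"
proof -
  let ?n = "length u"
  have red: "is_reduced_word ?n \<pi> (SOME is. is_reduced_word ?n \<pi> is)"
    by (rule someI_ex[OF reduced_word_exists[OF \<pi>]])
  have "letter (x i)" if "i \<in> I" for i
    unfolding letter_def using that sc_one[of "x i"] by metis
  then have good: "good ?n (word (map x u))"
    using u by (auto simp: good_def word_def)
  have "ev w (braid_perm c ?n \<pi> (word (map x u)))
    = (\<Prod>(a, b)\<in>inversions ?n \<pi>. Q (w ! \<pi> a) (w ! \<pi> b)) * evw (act \<pi> w) (map x u)"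
    using ev_reduced_word[OF red good] w unfolding braid_perm_def word_functional_word by blast
  also have "evw (act \<pi> w) (map x u) = (if \<forall>a<?n. w ! \<pi> a = u ! a then 1 else 0)"
  proof -
    have "evw (act \<pi> w) (map x u) = (\<Prod>k<?n. \<phi> (act \<pi> w ! k) (map x u ! k))"
      using w(1) by (simp add: evw_def)
    also have "\<dots> = (\<Prod>k<?n. if w ! \<pi> k = u ! k then 1 else 0)"
    proof (intro prod.cong refl)
      fix k assume k: "k \<in> {..<?n}"
      then have "\<pi> k < ?n" using permutes_in_image[OF \<pi>, of k] by simp
      then have "w ! \<pi> k \<in> I" "u ! k \<in> I"
        using k u w nth_mem[of "\<pi> k" w] nth_mem[of k u] by auto
      then show "\<phi> (act \<pi> w ! k) (map x u ! k) = (if w ! \<pi> k = u ! k then 1 else 0)"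
        using k w(1) \<phi>_x by (simp add: nth_act)
    qed
    also have "\<dots> = (if \<forall>a<?n. w ! \<pi> a = u ! a then 1 else 0)"
      by (auto intro!: prod_zero)
    finally show ?thesis .
  qed
  also have "(\<Prod>(a, b)\<in>inversions ?n \<pi>. Q (w ! \<pi> a) (w ! \<pi> b)) * (if \<forall>a<?n. w ! \<pi> a = u ! a then 1 else 0)
    = perm_coeff Q u w \<pi>"
  proof (cases "\<forall>a<?n. w ! \<pi> a = u ! a")
    case True
    have "(\<Prod>(a, b)\<in>inversions ?n \<pi>. Q (w ! \<pi> a) (w ! \<pi> b)) = (\<Prod>(a, b)\<in>inversions ?n \<pi>. Q (u ! a) (u ! b))"
      using True by (intro prod.cong refl) (auto simp: inversions_def)
    then show ?thesis using True w(1) by (simp add: perm_coeff_def)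
  next
    case False
    then have "perm_coeff Q u w \<pi> = 0" by (auto simp: perm_coeff_def)
    then show ?thesis using False by (simp only: if_False mult_zero_right)
  qed
  finally show ?thesis .
qed

lemma ev_quantum_symmetrizer:
  assumes "set u \<subseteq> I" "length w = length u" "set w \<subseteq> I"
  shows "ev w (quantum_symmetrizer c (word (map x u))) = lshuffle Q u w"
  unfolding quantum_symmetrizer_def lin_ext_word word_functional_sum lshuffle_eq_sum length_map
  using assms by (intro sum.cong refl ev_braid_perm) auto

lemma length_braid_word:
  assumes "\<forall>i\<in>set is. Suc i < n" "length u = n"
  shows "v \<in> Poly_Mapping.keys (foldr (\<lambda>i f. braid_at c i \<circ> f) is id (word u)) \<Longrightarrow> length v = n"
  using assms(1)
proof (induction "is" arbitrary: v)
  case Nil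
  then show ?case using assms(2) by (simp add: word_def)
next
  case (Cons i "is")
  have eq: "foldr (\<lambda>i f. braid_at c i \<circ> f) (i # is) id (word u)
      = braid_at c i (foldr (\<lambda>i f. braid_at c i \<circ> f) is id (word u))"
    by (simp only: foldr.simps o_apply)
  show ?case
  proof (rule length_braid_at[OF _ _ Cons.prems(1)[unfolded eq]])
    fix u' assume "u' \<in> Poly_Mapping.keys (foldr (\<lambda>i f. braid_at c i \<circ> f) is id (word u))"
    then show "length u' = n" by (rule Cons.IH) (use Cons.prems(2) in auto)
  qed (use Cons.prems(2) in auto)
qed

lemma ev_quantum_symmetrizer_length:
  assumes "length u \<noteq> length w" shows "ev w (quantum_symmetrizer c (word u)) = 0"
proof -
  have "ev w (braid_perm c (length u) \<pi> (word u)) = 0" if \<pi>: "\<pi> permutes {..<length u}" for \<pi>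
  proof -
    have red: "is_reduced_word (length u) \<pi> (SOME is. is_reduced_word (length u) \<pi> is)"
      by (rule someI_ex[OF reduced_word_exists[OF \<pi>]])
    then have "\<forall>i\<in>set (SOME is. is_reduced_word (length u) \<pi> is). Suc i < length u"
      by (rule is_reduced_wordD)
    then have "evw w v = 0" if "v \<in> Poly_Mapping.keys (braid_perm c (length u) \<pi> (word u))" for v
      using length_braid_word[OF _ refl that[unfolded braid_perm_def]] assms by (simp add: evw_def)
    then show ?thesis
      unfolding word_functional_def by (intro sum.neutral ballI) (simp only: mult_zero_right)
  qed
  then show ?thesis
    unfolding quantum_symmetrizer_def lin_ext_word word_functional_sum by (intro sum.neutral) auto
qed

text \<open>The remaining product must not mention y, so the letter at that place is replaced by a
  dummy 0. Linearity in y is then visible.\<close>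

lemma evw_split:
  assumes "length w = Suc (length u + length v)"
  shows "evw w (u @ [y] @ v) = (\<Prod>k\<in>{..<length w} - {length u}. \<phi> (w ! k) ((u @ [0] @ v) ! k)) * \<phi> (w ! length u) y"
proof -
  have "evw w (u @ [y] @ v) = (\<Prod>k<length w. \<phi> (w ! k) ((u @ [y] @ v) ! k))"
    using assms by (simp add: evw_def)
  also have "\<dots> = \<phi> (w ! length u) ((u @ [y] @ v) ! length u)
      * (\<Prod>k\<in>{..<length w} - {length u}. \<phi> (w ! k) ((u @ [y] @ v) ! k))"
    using assms by (intro prod.remove) auto
  also have "(\<Prod>k\<in>{..<length w} - {length u}. \<phi> (w ! k) ((u @ [y] @ v) ! k))
      = (\<Prod>k\<in>{..<length w} - {length u}. \<phi> (w ! k) ((u @ [0] @ v) ! k))"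
    by (intro prod.cong refl) (auto simp: nth_append nth_Cons')
  finally show ?thesis by (simp add: mult.commute)
qed

lemma ev_tens_rel: "p \<in> tens_rel sc M \<Longrightarrow> ev w p = 0"
  unfolding tens_rel_def
proof (induction rule: tens.span_induct_alt)
  case base
  show ?case by (rule word_functional_zero)
next
  case (step a y z)
  have "ev w y = 0"
  proof -
    consider u v x1 x2 where "y = word (u @ [x1 + x2] @ v) - word (u @ [x1] @ v) - word (u @ [x2] @ v)"
      | b u v x1 where "y = word (u @ [sc b x1] @ v) - tscale b (word (u @ [x1] @ v))"
      using step(1) by blast
    then show ?thesis
    proof cases
      case 1
      show ?thesis
        unfolding 1 word_functional_minus word_functional_word
        by (cases "length w = Suc (length u + length v)")
          (simp only: evw_split \<phi>_add distrib_left, simp, simp add: evw_def)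
    next
      case 2
      show ?thesis
        unfolding 2 word_functional_minus word_functional_scale word_functional_word
        by (cases "length w = Suc (length u + length v)")
          (simp only: evw_split \<phi>_sc mult.left_commute, simp, simp add: evw_def)
    qed
  qed
  then show ?case using step by (simp add: word_functional_add word_functional_scale)
qed

text \<open>A matrix coefficient of the symmetrizer kills the ideal. It also kills the finitely many
  further spanning tensors once w is longer than all their words, so it vanishes on the whole free
  tensor space.\<close>

theorem lshuffle_eq_zero:
  assumes "nichols_finite_dim sc M c"
  obtains D where "\<And>u w. set u \<subseteq> I \<Longrightarrow> D < length u \<Longrightarrow> lshuffle Q u w = 0"
proof -
  obtain B where B: "finite B" "B \<subseteq> free_tens M" "free_tens M \<subseteq> tens.span (B \<union> nichols_ideal sc M c)"
    using assms unfolding nichols_finite_dim_def by blast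
  define W where "W = (\<Union>p\<in>B. Poly_Mapping.keys p)"
  have W: "finite W" using B(1) by (simp add: W_def)
  define D where "D = Max (insert 0 (length ` W))"
  have D: "length u \<le> D" if "u \<in> W" for u
    unfolding D_def using W that by (intro Max_ge) auto
  have "lshuffle Q u w = 0" if u: "set u \<subseteq> I" "D < length u" for u w
  proof (rule ccontr)
    assume nz: "lshuffle Q u w \<noteq> 0"
    have w: "length w = length u" "set w \<subseteq> I" using lshuffle_nonzeroD[OF nz] u by auto
    define \<Phi> where "\<Phi> p = ev w (quantum_symmetrizer c p)" for p
    note lin = tens.linear_simps[OF linear_lin_ext]
    have \<Phi>: "\<Phi> (tscale a p + q) = a * \<Phi> p + \<Phi> q" "\<Phi> 0 = 0" for a p q
      by (simp_all add: \<Phi>_def quantum_symmetrizer_def lin word_functional_add word_functional_scale word_functional_zero)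
    have \<Phi>B: "\<Phi> p = 0" if p: "p \<in> B" for p
    proof -
      have "\<Phi> p = word_functional (\<lambda>u. ev w (quantum_symmetrizer c (word u))) p"
        unfolding \<Phi>_def quantum_symmetrizer_def word_functional_lin_ext lin_ext_word ..
      also have "\<dots> = (\<Sum>v\<in>Poly_Mapping.keys p. Poly_Mapping.lookup p v * 0)"
        unfolding word_functional_def[of _ p]
      proof (intro sum.cong refl arg_cong2[where f = "(*)"] ev_quantum_symmetrizer_length)
        fix v assume "v \<in> Poly_Mapping.keys p"
        then have "length v \<le> D" using p by (intro D) (auto simp: W_def)
        then show "length v \<noteq> length w" using u(2) w by simp
      qed
      finally show ?thesis by simp
    qed
    have \<Phi>I: "\<Phi> p = 0" if "p \<in> nichols_ideal sc M c" for p
      using that ev_tens_rel by (simp add: \<Phi>_def nichols_ideal_def)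
    have "\<Phi> p = 0" if "p \<in> tens.span (B \<union> nichols_ideal sc M c)" for p
      using that
    proof (induction rule: tens.span_induct_alt)
      case (step a p q)
      then show ?case using \<Phi>B \<Phi>I by (auto simp: \<Phi>)
    qed (rule \<Phi>(2))
    moreover have "word (map x u) \<in> free_tens M"
      unfolding free_tens_def using u(1) x_M by (intro tens.span_base imageI) (auto simp: in_lists_conv_set)
    ultimately have "\<Phi> (word (map x u)) = 0" using B(3) by blast
    then show False
      using nz ev_quantum_symmetrizer[OF u(1) w] by (simp add: \<Phi>_def)
  qed
  then show thesis by (rule that)
qed

end

section \<open>Exponents modulo the order of the central scalar\<close>

text \<open>The smallest exponent k >= 0 with q^(a + k) = 1, for q of order N.\<close>

definition neg_mod :: "nat \<Rightarrow> int \<Rightarrow> nat" where "neg_mod N a = nat (- a mod int N)"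

lemma neg_mod_less: "0 < N \<Longrightarrow> neg_mod N a < N"
  by (simp add: neg_mod_def nat_less_iff)

lemma neg_mod_cong: "int N dvd a - b \<Longrightarrow> neg_mod N a = neg_mod N b"
  unfolding neg_mod_def by (metis mod_eq_dvd_iff mod_minus_cong)

lemma dvd_add_neg_mod: "0 < N \<Longrightarrow> int N dvd a + int (neg_mod N a)"
proof -
  assume "0 < N"
  then have "a + int (neg_mod N a) = a + (- a mod int N)" by (simp add: neg_mod_def)
  also have "\<dots> = - (int N * (- a div int N))" by (simp add: minus_div_mult_eq_mod[symmetric] algebra_simps)
  finally show ?thesis by simp
qed

text \<open>Here b is the inverse of a modulo N, and the Cartan number for a ratio d is -(d + 1/d)
  modulo N. If it is 0 for a, then a^2 = -1 and the ratio a^2 has the number 2. If it is 1, then a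
  differs from b, so the ratios a and b contribute 1 each. Otherwise N would divide 2 or 3.\<close>

lemma neg_mod_pair_sum:
  fixes a b :: int and N :: nat
  assumes N: "4 \<le> N" and ab: "int N dvd a * b - 1"
  shows "2 \<le> neg_mod N (a + b) \<or> neg_mod N (a + b) = 1 \<and> \<not> int N dvd a * a - 1
    \<or> \<not> int N dvd a * a - 1 \<and> 2 \<le> neg_mod N (a * a + b * b)"
proof -
  have pos: "0 < N" using N by simp
  note sum = dvd_add_neg_mod[OF pos, of "a + b"]
  consider "2 \<le> neg_mod N (a + b)" | "neg_mod N (a + b) = 1" | "neg_mod N (a + b) = 0" by linarith
  then show ?thesis
  proof cases
    case 2
    have "\<not> int N dvd a * a - 1"
    proof
      assume aa: "int N dvd a * a - 1"
      have s: "int N dvd a + b + 1" using sum 2 by simp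
      \<comment> \<open>If also a^2 = 1, then b = a and 2 a + 1 = 0 modulo N, while (2 a - 1) (2 a +
        1) - 4 (a^2 - 1) = 3.\<close>
      have "3 = (2 * a - 1) * ((2 * a + 1) - (a + b + 1)) + (2 * a - 1) * (a + b + 1) - 4 * (a * a - 1)"
        by (simp add: algebra_simps)
      moreover have "(2 * a - 1) * ((2 * a + 1) - (a + b + 1)) = (2 * a - 1) * (a * (1 - a * b) + b * (a * a - 1))"
        by (simp add: algebra_simps)
      moreover have "int N dvd (2 * a - 1) * (a * (1 - a * b) + b * (a * a - 1))"
        using ab aa dvd_diff_commute[of "int N" 1 "a * b"] by (intro dvd_mult dvd_add) auto
      ultimately have "int N dvd 3"
        using s aa by (metis dvd_add dvd_diff dvd_mult)
      then have "int N \<le> 3" by (rule zdvd_imp_le) simp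
      then show False using N by simp
    qed
    then show ?thesis using 2 by simp
  next
    case 3
    then have s: "int N dvd a + b" using sum by simp
    have aa: "int N dvd a * a + 1"
    proof -
      have "a * a + 1 = a * (a + b) - (a * b - 1)" by (simp add: algebra_simps)
      then show ?thesis using s ab by (metis dvd_diff dvd_mult)
    qed
    have "\<not> int N dvd a * a - 1"
    proof
      assume "int N dvd a * a - 1"
      then have "int N dvd (a * a + 1) - (a * a - 1)" using aa by (rule dvd_diff[rotated])
      then have "int N dvd 2" by simp
      then have "int N \<le> 2" by (rule zdvd_imp_le) simp
      then show False using N by simp
    qed
    moreover have "int N dvd (a * a + b * b) - (- 2)"
    proof -
      have "(a * a + b * b) - (- 2) = (a + b) * (a + b) - 2 * (a * b - 1)" by (simp add: algebra_simps)
      then show ?thesis using s ab by (metis dvd_diff dvd_mult)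
    qed
    then have "neg_mod N (a * a + b * b) = neg_mod N (- 2)" by (rule neg_mod_cong)
    moreover have "neg_mod N (- 2) = 2" using N by (simp add: neg_mod_def)
    ultimately show ?thesis by simp
  qed simp
qed

text \<open>The two mixed entries of the braiding matrix at exponents u and u' multiply to q^(u / u'
  + u' / u), whatever the vectors; \<open>neg_mod\<close> then solves the Cartan condition.\<close>

definition cartan_number :: "nat \<Rightarrow> (nat \<Rightarrow> nat) \<Rightarrow> nat \<times> 'v \<Rightarrow> nat \<times> 'v \<Rightarrow> nat" where
  "cartan_number N iv i j = neg_mod N (int (fst i * iv (fst j)) + int (fst j * iv (fst i)))"

text \<open>H is a group of exponents modulo T, so a row can be indexed by ratios d, with number -(d
  + 1/d) modulo N at the exponent e d. Congruences modulo T separate indices, those modulo N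
  evaluate numbers. For N >= 4 the ratios j, 1/j and j^2 suffice. For N = 3 the ratio 1 at a second
  vector gives -2 = 1, and the ratio j gives a nonzero number.\<close>

lemma cartan_row_sum:
  fixes S :: "'v set"
  assumes NT: "N dvd T" and H: "finite H" "\<And>e. e \<in> H \<Longrightarrow> e < T"
    and mult: "\<And>e l. e \<in> H \<Longrightarrow> l \<in> H \<Longrightarrow> e * l mod T \<in> H"
    and iv: "\<And>e. e \<in> H \<Longrightarrow> iv e \<in> H" "\<And>e. e \<in> H \<Longrightarrow> int T dvd int (e * iv e) - 1"
    and j: "j \<in> H" "\<not> int T dvd int j - 1"
    and S: "finite S" and N: "4 \<le> N \<or> N = 3 \<and> 2 \<le> card S"
    and i: "i \<in> H \<times> S"
  shows "2 \<le> (\<Sum>k\<in>H \<times> S - {i}. cartan_number N iv i k)"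
proof -
  obtain e v where ev: "i = (e, v)" "e \<in> H" "v \<in> S" using i by auto
  have NTi: "int N dvd int T" using NT by simp
  have fin: "finite (H \<times> S - {i})" using H S by simp
  have shift: "cartan_number N iv i (e * d mod T, v') = neg_mod N (int d + int (iv d))"
    if d: "d \<in> H" for d v'
  proof -
    define l where "l = e * d mod T"
    have l: "l \<in> H" unfolding l_def by (rule mult[OF ev(2) d])
    define A B C D E F where defs: "A = int e" "B = int (iv e)" "C = int d" "D = int (iv d)" "E = int l" "F = int (iv l)"
    have "int T dvd E - A * C"
      unfolding defs l_def by (simp add: zmod_int mod_eq_dvd_iff[symmetric])
    then have EAC: "int N dvd E - A * C" using NTi by (rule dvd_trans[rotated])
    have AB: "int N dvd A * B - 1" and CD: "int N dvd C * D - 1" and EF: "int N dvd E * F - 1"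
      using iv(2)[OF ev(2)] iv(2)[OF d] iv(2)[OF l] dvd_trans[OF NTi] by (auto simp: defs)
    have "(A * F + E * B) - (C + D)
      = - (A * F) * (C * D - 1) + D * (E * F - 1) - D * F * (E - A * C) + B * (E - A * C) + C * (A * B - 1)"
      by (simp add: algebra_simps)
    also have "int N dvd \<dots>"
      by (simp only: EAC AB CD EF dvd_add dvd_diff dvd_mult)
    finally have "neg_mod N (A * F + E * B) = neg_mod N (C + D)" by (rule neg_mod_cong)
    then show ?thesis by (simp add: cartan_number_def ev defs l_def)
  qed
  have neq: "e * d mod T \<noteq> e * d' mod T" if "d \<in> H" "d' \<in> H" "\<not> int T dvd int d - int d'" for d d'
  proof
    assume "e * d mod T = e * d' mod T"
    then have "int T dvd int e * int d - int e * int d'"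
      by (metis mod_eq_dvd_iff of_nat_mult zmod_int)
    then have "int T dvd int (iv e) * (int e * int d - int e * int d')" by (rule dvd_mult)
    moreover have "int d - int d' = int (iv e) * (int e * int d - int e * int d') - (int (e * iv e) - 1) * (int d - int d')"
      by (simp add: algebra_simps)
    ultimately have "int T dvd int d - int d'"
      using iv(2)[OF ev(2)] by (metis dvd_diff dvd_mult2)
    then show False using that by simp
  qed
  have eT: "e = e mod T" using H(2)[OF ev(2)] by simp
  have neq1: "e * d mod T \<noteq> e" if "d \<in> H" "\<not> int T dvd int d - 1" for d
  proof
    assume "e * d mod T = e"
    then have "int T dvd int e * int d - int e"
      using eT by (metis mod_eq_dvd_iff of_nat_mult zmod_int)
    then have "int T dvd int (iv e) * (int e * int d - int e)" by (rule dvd_mult)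
    moreover have "int d - 1 = int (iv e) * (int e * int d - int e) - (int (e * iv e) - 1) * (int d - 1)"
      by (simp add: algebra_simps)
    ultimately have "int T dvd int d - 1"
      using iv(2)[OF ev(2)] by (metis dvd_diff dvd_mult2)
    then show False using that by simp
  qed
  have one: "2 \<le> (\<Sum>k\<in>H \<times> S - {i}. cartan_number N iv i k)"
    if "k \<in> H \<times> S - {i}" "2 \<le> cartan_number N iv i k" for k
    using member_le_sum[OF that(1) _ fin, of "cartan_number N iv i"] that(2) by simp
  have two: "2 \<le> (\<Sum>k\<in>H \<times> S - {i}. cartan_number N iv i k)"
    if "k \<in> H \<times> S - {i}" "l \<in> H \<times> S - {i}" "k \<noteq> l" "1 \<le> cartan_number N iv i k" "1 \<le> cartan_number N iv i l" for k l
    using sum_mono2[OF fin, of "{k, l}" "cartan_number N iv i"] that by simp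
  let ?a = "int j" and ?b = "int (iv j)"
  have ab: "int T dvd ?a * ?b - 1" using iv(2)[OF j(1)] by simp
  then have abN: "int N dvd ?a * ?b - 1" using NTi by (rule dvd_trans[rotated])
  have mem: "(e * d mod T, v) \<in> H \<times> S - {i}" if "d \<in> H" "\<not> int T dvd int d - 1" for d
    using mult[OF ev(2) that(1)] neq1[OF that] ev by simp
  show ?thesis
  proof (cases "4 \<le> N")
    case True
    from neg_mod_pair_sum[OF True abN] consider "2 \<le> neg_mod N (?a + ?b)"
      | "neg_mod N (?a + ?b) = 1" "\<not> int N dvd ?a * ?a - 1"
      | "\<not> int N dvd ?a * ?a - 1" "2 \<le> neg_mod N (?a * ?a + ?b * ?b)" by blast
    then show ?thesis
    proof cases
      case 1
      then show ?thesis using one[OF mem[OF j]] shift[OF j(1)] by simp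
    next
      case 2
      have ne: "\<not> int T dvd ?a - ?b"
      proof
        assume "int T dvd ?a - ?b"
        then have "int N dvd ?a - ?b" using NTi by (rule dvd_trans[rotated])
        moreover have "?a * ?a - 1 = ?a * (?a - ?b) + (?a * ?b - 1)" by (simp add: algebra_simps)
        ultimately have "int N dvd ?a * ?a - 1" using abN by (metis dvd_add dvd_mult)
        then show False using 2 by simp
      qed
      have b: "\<not> int T dvd ?b - 1"
      proof
        assume "int T dvd ?b - 1"
        moreover have "?a - 1 = (?a * ?b - 1) - ?a * (?b - 1)" by (simp add: algebra_simps)
        ultimately have "int T dvd ?a - 1" using ab by (metis dvd_diff dvd_mult)
        then show False using j by simp
      qed
      have "int N dvd (?b + int (iv (iv j))) - (?a + ?b)"
      proof -
        have "int N dvd ?b * int (iv (iv j)) - 1"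
          using iv(2)[OF iv(1)[OF j(1)]] dvd_trans[OF NTi] by simp
        moreover have "(?b + int (iv (iv j))) - (?a + ?b) = ?a * (?b * int (iv (iv j)) - 1) - int (iv (iv j)) * (?a * ?b - 1)"
          by (simp add: algebra_simps)
        ultimately show ?thesis using abN by (metis dvd_diff dvd_mult)
      qed
      then have "neg_mod N (?b + int (iv (iv j))) = 1" using 2 neg_mod_cong by metis
      then show ?thesis
        using two[OF mem[OF j] mem[OF iv(1)[OF j(1)] b]] neq[OF j(1) iv(1)[OF j(1)] ne]
          shift[OF j(1)] shift[OF iv(1)[OF j(1)]] 2 by simp
    next
      case 3
      define d where "d = j * j mod T"
      have d: "d \<in> H" unfolding d_def by (rule mult[OF j(1) j(1)])
      have Td: "int T dvd int d - ?a * ?a"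
        unfolding d_def by (simp add: zmod_int mod_eq_dvd_iff[symmetric])
      then have Nd: "int N dvd int d - ?a * ?a" using NTi by (rule dvd_trans[rotated])
      have nd: "\<not> int T dvd int d - 1"
      proof
        assume "int T dvd int d - 1"
        then have "int N dvd int d - 1" using NTi by (rule dvd_trans[rotated])
        moreover have "?a * ?a - 1 = (int d - 1) - (int d - ?a * ?a)" by simp
        ultimately have "int N dvd ?a * ?a - 1" using Nd by (metis dvd_diff)
        then show False using 3 by simp
      qed
      have "int N dvd (int d + int (iv d)) - (?a * ?a + ?b * ?b)"
      proof -
        have "int N dvd int d * int (iv d) - 1"
          using iv(2)[OF d] dvd_trans[OF NTi] by simp
        moreover have "(int d + int (iv d)) - (?a * ?a + ?b * ?b)
          = (int d - ?a * ?a) + ?b * ?b * (int d * int (iv d) - 1) - ?b * ?b * int (iv d) * (int d - ?a * ?a)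
            - int (iv d) * (?a * ?b + 1) * (?a * ?b - 1)"
          by (simp add: algebra_simps)
        ultimately show ?thesis using abN Nd by (metis dvd_diff dvd_mult dvd_add)
      qed
      then have "neg_mod N (int d + int (iv d)) = neg_mod N (?a * ?a + ?b * ?b)" by (rule neg_mod_cong)
      then show ?thesis using one[OF mem[OF d nd]] shift[OF d] 3 by simp
    qed
  next
    case False
    then have N3: "N = 3" and "2 \<le> card S" using N by auto
    then obtain v' where v': "v' \<in> S" "v' \<noteq> v"
      by (metis S card_1_singleton_iff card_le_Suc0_iff_eq not_less_eq_eq numeral_2_eq_2)
    have "cartan_number N iv i (e, v') = neg_mod N 2"
      unfolding cartan_number_def ev fst_conv
      using iv(2)[OF ev(2)] dvd_trans[OF NTi, of "int (e * iv e) - 1"]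
      by (intro neg_mod_cong) (metis add_diff_add dvd_add one_add_one)
    then have 1: "cartan_number N iv i (e, v') = 1" using N3 by (simp add: neg_mod_def)
    \<comment> \<open>Otherwise j^2 = -1 modulo 3, which has no solution.\<close>
    have "\<not> 3 dvd ?a + ?b"
    proof
      assume s: "3 dvd ?a + ?b"
      have "?a * ?a + 1 = ?a * (?a + ?b) - (?a * ?b - 1)" by (simp add: algebra_simps)
      then have "3 dvd ?a * ?a + 1" using s abN N3 by (metis dvd_diff dvd_mult of_nat_numeral)
      moreover have "?a mod 3 = 0 \<or> ?a mod 3 = 1 \<or> ?a mod 3 = 2" by presburger
      moreover have "(?a * ?a + 1) mod 3 = ((?a mod 3) * (?a mod 3) + 1) mod 3"
        by (metis mod_add_left_eq mod_mult_eq)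
      ultimately show False by (elim disjE) (simp_all add: dvd_eq_mod_eq_0)
    qed
    then have "neg_mod N (?a + ?b) \<noteq> 0"
      using dvd_add_neg_mod[of N "?a + ?b"] N3 by (cases "neg_mod N (?a + ?b) = 0") auto
    then have 2: "1 \<le> cartan_number N iv i (e * j mod T, v)" using shift[OF j(1)] by simp
    show ?thesis
      by (rule two[of "(e, v')" "(e * j mod T, v)"]) (use ev v' 1 2 mem[OF j] neq1[OF j] in auto)
  qed
qed

section \<open>The Yetter-Drinfeld module\<close>

lemma sum_powers_root_of_unity:
  fixes z :: complex assumes "z ^ n = 1" "z \<noteq> 1" shows "(\<Sum>r<n. z ^ r) = 0"
proof -
  have "(1 - z) * (\<Sum>r<n. z ^ r) = 1 - z ^ n" by (rule one_diff_power_eq[symmetric])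
  then show ?thesis using assms by simp
qed

locale complex_vector_space = vector_space scale
  for scale :: "complex \<Rightarrow> 'v::ab_group_add \<Rightarrow> 'v" (infixr "*s" 75)
begin

text \<open>The projections onto the eigenspaces of an operator of finite order sum to the identity, so one
  of them does not vanish.\<close>

lemma finite_order_eigenvector:
  fixes A :: "'v \<Rightarrow> 'v" and v0 :: 'v
  assumes A: "lin_endo scale A" and T: "0 < T" "A ^^ T = id" and v0: "v0 \<noteq> 0"
  shows "\<exists>v \<zeta>. v \<noteq> 0 \<and> A v = \<zeta> *s v \<and> \<zeta> ^ T = 1"
proof -
  interpret A: Vector_Spaces.linear scale scale A by (rule A)
  define \<omega> where "\<omega> r = cis (2 * pi * real r / real T)" for r
  have bij: "bij_betw \<omega> {..<T} {z. z ^ T = 1}"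
    unfolding \<omega>_def by (rule bij_betw_roots_unity[OF T(1)])
  have \<omega>T: "\<omega> r ^ T = 1" if "r < T" for r
    using bij that by (auto simp: bij_betw_def)
  have \<omega>_power: "\<omega> r ^ k = \<omega> 1 ^ (r * k)" for r k
    by (simp add: \<omega>_def Complex.DeMoivre mult_ac)
  define u where "u r = (\<Sum>k<T. inverse (\<omega> r) ^ k *s (A ^^ k) v0)" for r
  have eigen: "A (u r) = \<omega> r *s u r" if r: "r < T" for r
  proof -
    have nz: "\<omega> r \<noteq> 0" by (simp add: \<omega>_def)
    let ?f = "\<lambda>k. inverse (\<omega> r) ^ k *s (A ^^ k) v0"
    have "A (u r) = (\<Sum>k<T. \<omega> r *s ?f (Suc k))"
      unfolding u_def A.sum by (intro sum.cong refl) (simp add: A.scale nz mult.assoc[symmetric])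
    also have "\<dots> = \<omega> r *s (\<Sum>k<T. ?f (Suc k))" by (simp add: scale_sum_right)
    also have "(\<Sum>k<T. ?f (Suc k)) = (\<Sum>k<T. ?f k) + ?f T - ?f 0"
      using sum.lessThan_Suc_shift[of ?f T] sum.lessThan_Suc[of ?f T] by (simp add: algebra_simps)
    also have "?f T = ?f 0" using \<omega>T[OF r] T(2) by (simp add: power_inverse)
    finally show ?thesis by (simp add: u_def)
  qed
  have "(\<Sum>r<T. u r) = (\<Sum>k<T. (\<Sum>r<T. inverse (\<omega> r) ^ k) *s (A ^^ k) v0)"
    unfolding u_def scale_sum_left by (rule sum.swap)
  also have "\<dots> = (\<Sum>k<T. if k = 0 then of_nat T *s v0 else 0)"
  proof (intro sum.cong refl)
    fix k assume k: "k \<in> {..<T}"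
    show "(\<Sum>r<T. inverse (\<omega> r) ^ k) *s (A ^^ k) v0 = (if k = 0 then of_nat T *s v0 else 0)"
    proof (cases "k = 0")
      case False
      have inj: "inj_on \<omega> {..<T}" using bij by (simp add: bij_betw_def)
      have "\<omega> k \<noteq> \<omega> 0" using inj_onD[OF inj, of k 0] k False T(1) by auto
      moreover have "\<omega> 0 = 1" by (simp add: \<omega>_def)
      ultimately have "inverse (\<omega> k) \<noteq> 1" by (metis inverse_eq_1_iff)
      moreover have "inverse (\<omega> k) ^ T = 1" using \<omega>T[of k] k by (simp add: power_inverse)
      ultimately have "(\<Sum>r<T. inverse (\<omega> k) ^ r) = 0" by (intro sum_powers_root_of_unity)
      \<comment> \<open>The indices r and k are interchangeable, which makes the sum over r a
        geometric series with ratio \<open>inverse (\<omega> k)\<close>.\<close>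
      moreover have "inverse (\<omega> r) ^ k = inverse (\<omega> k) ^ r" for r
        unfolding power_inverse using \<omega>_power[of r k] \<omega>_power[of k r] by (simp only: mult.commute)
      ultimately show ?thesis using False by simp
    qed simp
  qed
  also have "\<dots> = of_nat T *s v0" using T(1) by (simp add: sum.delta)
  finally have "(\<Sum>r<T. u r) \<noteq> 0" using T(1) v0 by simp
  then obtain r where "r < T" "u r \<noteq> 0" by (meson lessThan_iff sum.neutral)
  then show ?thesis using eigen \<omega>T by blast
qed

end

section \<open>The representation and the action on homogeneous elements\<close>

locale yd_setting = group G + complex_vector_space scale
  for G :: "('g, 'b) monoid_scheme" (structure) and scale :: "complex \<Rightarrow> 'v::ab_group_add \<Rightarrow> 'v" +
  fixes s :: 'g and \<rho> :: "'g \<Rightarrow> 'v \<Rightarrow> 'v" and r :: "'g \<Rightarrow> 'g"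
  assumes finite_G: "finite (carrier G)" and s: "s \<in> carrier G"
    and irr: "irreducible_rep (G\<lparr>carrier := centralizer G s\<rparr>) scale \<rho>"
    and r: "t \<in> conj_class G s \<Longrightarrow> r t \<in> carrier G \<and> r t \<otimes> s \<otimes> inv (r t) = t"
begin

lemma \<rho>_linear: "h \<in> centralizer G s \<Longrightarrow> lin_endo scale (\<rho> h)"
  and \<rho>_bij: "h \<in> centralizer G s \<Longrightarrow> bij (\<rho> h)"
  and \<rho>_mult: "h \<in> centralizer G s \<Longrightarrow> k \<in> centralizer G s \<Longrightarrow> \<rho> (h \<otimes> k) = \<rho> h \<circ> \<rho> k"
  using irr by (auto simp: irreducible_rep_def GL_def hom_def Pi_def)

lemma \<rho>_zero: "h \<in> centralizer G s \<Longrightarrow> \<rho> h 0 = 0"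
  using linear_simps(4)[OF \<rho>_linear] .

lemma pow_centralizer: "s [^] (n::nat) \<in> centralizer G s"
  unfolding centralizer_def using s nat_pow_mult[OF s, of n 1] nat_pow_mult[OF s, of 1 n] by (simp add: add.commute)

lemma \<rho>_one: "\<rho> \<one> = id"
proof -
  have one: "\<one> \<in> centralizer G s" using s by (simp add: centralizer_def)
  have "\<rho> \<one> (\<rho> \<one> v) = \<rho> \<one> v" for v
    using fun_cong[OF \<rho>_mult[OF one one], of v] by simp
  then show ?thesis using \<rho>_bij[OF one] by (auto simp: bij_def inj_on_def fun_eq_iff)
qed

lemma \<rho>_pow: "\<rho> (s [^] (n::nat)) = \<rho> s ^^ n"
proof (induction n)
  case (Suc n)
  have "s [^] Suc n = s \<otimes> s [^] n" using s nat_pow_mult[OF s, of 1 n] by simp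
  then show ?case using \<rho>_mult[OF _ pow_centralizer, of s n] pow_centralizer[of 1] s Suc by simp
qed (simp add: \<rho>_one)

text \<open>Schur's Lemma: an eigenspace of \<open>\<rho> s\<close> is stable under the centralizer.
  The eigenvector comes from the finite order of s, which also makes the eigenvalue a root of
  unity.\<close>

lemma central_scalar: "\<exists>q. (\<forall>v. \<rho> s v = scale q v) \<and> q ^ ord s = 1"
proof -
  have s_cent: "s \<in> centralizer G s" using pow_centralizer[of 1] s by simp
  have T: "0 < ord s" using ord_ge_1[OF finite_G s] by simp
  have "\<rho> s ^^ ord s = id" using \<rho>_pow[of "ord s"] \<rho>_one s by simp
  moreover obtain v0 :: 'v where "v0 \<noteq> 0" using irr unfolding irreducible_rep_def by blast
  ultimately obtain v \<zeta> where v: "v \<noteq> 0" "\<rho> s v = scale \<zeta> v" "\<zeta> ^ ord s = 1"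
    using finite_order_eigenvector[OF \<rho>_linear[OF s_cent] T] by blast
  define W where "W = {v. \<rho> s v = scale \<zeta> v}"
  have "subspace W"
    by (rule subspaceI)
      (simp_all add: W_def linear_simps[OF \<rho>_linear[OF s_cent]] scale_right_distrib mult.commute)
  moreover have "\<rho> h ` W \<subseteq> W" if h: "h \<in> centralizer G s" for h
  proof
    fix y assume "y \<in> \<rho> h ` W"
    then obtain x where x: "\<rho> s x = scale \<zeta> x" "y = \<rho> h x" by (auto simp: W_def)
    have "\<rho> s (\<rho> h x) = \<rho> (s \<otimes> h) x" using \<rho>_mult[OF s_cent h] by simp
    also have "s \<otimes> h = h \<otimes> s" using h by (simp add: centralizer_def)
    also have "\<rho> (h \<otimes> s) x = \<rho> h (\<rho> s x)" using \<rho>_mult[OF h s_cent] by simp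
    finally show "y \<in> W" using x linear_simps(3)[OF \<rho>_linear[OF h]] by (simp add: W_def)
  qed
  ultimately have "W = {0} \<or> W = UNIV" using irr by (auto simp: irreducible_rep_def)
  moreover have "v \<in> W" using v by (simp add: W_def)
  ultimately have "W = UNIV" using v by blast
  then show ?thesis using v(3) by (auto simp: W_def)
qed

definition q :: complex where "q = q_scalar scale \<rho> s"

lemma \<rho>_s: "\<rho> s v = scale q v" and q_order: "q ^ ord s = 1"
proof -
  obtain z where z: "\<And>v. \<rho> s v = scale z v" "z ^ ord s = 1" using central_scalar by blast
  obtain v0 :: 'v where v0: "v0 \<noteq> 0" using irr unfolding irreducible_rep_def by blast
  have "q = z"
    unfolding q_def q_scalar_def
  proof (rule the_equality)
    fix y assume "\<forall>v. \<rho> s v = scale y v"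
    then have "scale y v0 = scale z v0" using z(1) by metis
    then show "y = z" using v0 scale_cancel_right by blast
  qed (use z in blast)
  then show "\<rho> s v = scale q v" "q ^ ord s = 1" using z by auto
qed

lemma \<rho>_s_pow: "\<rho> (s [^] (n::nat)) v = scale (q ^ n) v"
  unfolding \<rho>_pow by (induction n) (simp_all add: \<rho>_s)

lemma conj_class_conj:
  assumes h: "h \<in> carrier G" and t: "t \<in> conj_class G s" shows "h \<otimes> t \<otimes> inv h \<in> conj_class G s"
proof -
  obtain g where g: "g \<in> carrier G" "t = g \<otimes> s \<otimes> inv g" using t by (auto simp: conj_class_def)
  have "h \<otimes> t \<otimes> inv h = (h \<otimes> g) \<otimes> s \<otimes> inv (h \<otimes> g)"
    using h g s by (simp add: inv_mult_group m_assoc)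
  then show ?thesis using h g unfolding conj_class_def by blast
qed

lemma conj_class_carrier: "t \<in> conj_class G s \<Longrightarrow> t \<in> carrier G"
  using s by (auto simp: conj_class_def)

lemma finite_conj_class: "finite (conj_class G s)"
  using finite_subset[OF _ finite_G] conj_class_carrier by blast

lemma s_r:
  assumes "t \<in> conj_class G s" shows "r t \<otimes> s = t \<otimes> r t"
  using r[OF assms] s inv_solve_right'[of t "r t \<otimes> s" "r t"] conj_class_carrier[OF assms]
  by (metis inv_closed inv_solve_right m_closed)

lemma cocycle_centralizer:
  assumes h: "h \<in> carrier G" and t: "t \<in> conj_class G s"
  shows "inv (r (h \<otimes> t \<otimes> inv h)) \<otimes> h \<otimes> r t \<in> centralizer G s"
proof -
  define t' where "t' = h \<otimes> t \<otimes> inv h"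
  have t': "t' \<in> conj_class G s" unfolding t'_def by (rule conj_class_conj[OF h t])
  note c = conj_class_carrier[OF t] conj_class_carrier[OF t'] r[OF t, THEN conjunct1] r[OF t', THEN conjunct1] h s
  have "inv (r t') \<otimes> h \<otimes> r t \<otimes> s = inv (r t') \<otimes> h \<otimes> (t \<otimes> r t)"
    using c s_r[OF t] by (simp add: m_assoc)
  also have "\<dots> = inv (r t') \<otimes> (t' \<otimes> h) \<otimes> r t"
    using c by (simp add: t'_def m_assoc)
  also have "\<dots> = inv (r t') \<otimes> t' \<otimes> (h \<otimes> r t)" using c by (simp add: m_assoc)
  also have "inv (r t') \<otimes> t' = s \<otimes> inv (r t')"
  proof -
    have "t' = r t' \<otimes> s \<otimes> inv (r t')" using r[OF t'] by simp
    then have "inv (r t') \<otimes> t' = inv (r t') \<otimes> (r t' \<otimes> s \<otimes> inv (r t'))" by simp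
    also have "\<dots> = s \<otimes> inv (r t')" using c by (simp add: m_assoc[symmetric])
    finally show ?thesis .
  qed
  finally have "inv (r t') \<otimes> h \<otimes> r t \<otimes> s = s \<otimes> (inv (r t') \<otimes> h \<otimes> r t)"
    using c by (simp add: m_assoc)
  then show ?thesis using c unfolding t'_def[symmetric] by (simp add: centralizer_def)
qed

lemma yd_elem_zero: "yd_elem t 0 = 0"
  by (auto simp: yd_elem_def fun_eq_iff)

lemma yd_action_zero: "h \<in> carrier G \<Longrightarrow> yd_action G s \<rho> r h 0 = 0"
  unfolding yd_action_def Let_def
  by (intro sum.neutral ballI) (simp add: \<rho>_zero cocycle_centralizer yd_elem_zero)

lemma yd_action_elem:
  assumes h: "h \<in> carrier G" and t: "t \<in> conj_class G s"
  shows "yd_action G s \<rho> r h (yd_elem t v)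
    = yd_elem (h \<otimes> t \<otimes> inv h) (\<rho> (inv (r (h \<otimes> t \<otimes> inv h)) \<otimes> h \<otimes> r t) v)"
proof -
  have "yd_action G s \<rho> r h (yd_elem t v) = (\<Sum>t'\<in>conj_class G s. if t' = t then
      yd_elem (h \<otimes> t \<otimes> inv h) (\<rho> (inv (r (h \<otimes> t \<otimes> inv h)) \<otimes> h \<otimes> r t) v) else 0)"
    unfolding yd_action_def Let_def
    by (intro sum.cong refl) (auto simp: yd_elem_def[of t] \<rho>_zero[OF cocycle_centralizer[OF h]] yd_elem_zero)
  then show ?thesis using t finite_conj_class by (simp add: sum.delta')
qed

lemma conj_pow:
  assumes g: "g \<in> carrier G" and x: "x \<in> carrier G"
  shows "(g \<otimes> x \<otimes> inv g) [^] (n::nat) = g \<otimes> x [^] n \<otimes> inv g"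
proof (induction n)
  case (Suc n)
  have "inv g \<otimes> (g \<otimes> (x \<otimes> inv g)) = x \<otimes> inv g"
    using g x by (simp add: m_assoc[symmetric])
  then show ?case using Suc g x by (simp add: m_assoc)
qed (use g in simp)

end

lemma keys_sum_word: "Poly_Mapping.keys (\<Sum>t\<in>A. word (f t)) \<subseteq> f ` A"
proof (induction A rule: infinite_finite_induct)
  case (insert t A)
  then show ?case
    using Poly_Mapping.keys_add[of "word (f t)" "\<Sum>t\<in>A. word (f t)"] by (auto simp: word_def)
qed auto

section \<open>Powers of s inside its conjugacy class\<close>

context yd_setting begin

abbreviation T :: nat where "T \<equiv> ord s"

lemma T_pos: "0 < T"
  using ord_ge_1[OF finite_G s] by simp

lemma pow_eq_iff: "s [^] (m::nat) = s [^] (n::nat) \<longleftrightarrow> int T dvd int m - int n"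
  using int_pow_eq[OF s, of "int n" "int m"] by (auto simp: int_pow_int)

lemma pow_mod: "s [^] (n mod T) = s [^] (n::nat)"
  by (simp add: pow_eq_iff zmod_int mod_eq_dvd_iff[symmetric])

text \<open>These exponents form a subgroup of the units modulo T, which the row sums
  exploit.\<close>

definition H :: "nat set" where "H = {e. e < T \<and> s [^] e \<in> conj_class G s}"

text \<open>If g s g^-1 = s^e, then conjugating n times by g raises s to the power e^n. As the order
  of g divides that of G, e^(2 |G|) = 1 modulo T, so this power is the inverse of e.\<close>

definition iv :: "nat \<Rightarrow> nat" where "iv e = e ^ (2 * order G - 1) mod T"

lemma conj_class_iff: "t \<in> conj_class G s \<longleftrightarrow> (\<exists>g\<in>carrier G. t = g \<otimes> s \<otimes> inv g)"
  by (auto simp: conj_class_def)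

lemma pow_power:
  assumes g: "g \<in> carrier G" "s [^] (e::nat) = g \<otimes> s \<otimes> inv g"
  shows "s [^] (e ^ n) = g [^] n \<otimes> s \<otimes> inv (g [^] (n::nat))"
proof (induction n)
  case 0
  show ?case using s by simp
next
  case (Suc n)
  let ?h = "g [^] n"
  have h: "?h \<in> carrier G" using g by simp
  have "s [^] (e ^ Suc n) = (s [^] (e ^ n)) [^] e" using s by (simp add: nat_pow_pow mult.commute)
  also have "\<dots> = ?h \<otimes> s [^] e \<otimes> inv ?h" unfolding Suc by (rule conj_pow[OF h s])
  also have "\<dots> = (?h \<otimes> g) \<otimes> s \<otimes> inv (?h \<otimes> g)"
    unfolding g(2) using g h s by (simp add: m_assoc inv_mult_group)
  finally show ?case by simp
qed

lemma H_mult: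
  assumes "e \<in> H" "l \<in> H" shows "e * l mod T \<in> H"
proof -
  obtain g where g: "g \<in> carrier G" "s [^] e = g \<otimes> s \<otimes> inv g" using assms by (auto simp: H_def conj_class_iff)
  have "s [^] (e * l) = (s [^] e) [^] l" using s by (simp add: nat_pow_pow)
  also have "\<dots> = g \<otimes> s [^] l \<otimes> inv g" unfolding g(2) by (rule conj_pow[OF g(1) s])
  finally have "s [^] (e * l mod T) \<in> conj_class G s"
    using conj_class_conj[OF g(1)] assms(2) by (simp add: pow_mod H_def)
  then show ?thesis using T_pos by (simp add: H_def)
qed

lemma iv_H:
  assumes "e \<in> H" shows "iv e \<in> H" "int T dvd int (e * iv e) - 1"
proof -
  obtain g where g: "g \<in> carrier G" "s [^] e = g \<otimes> s \<otimes> inv g" using assms by (auto simp: H_def conj_class_iff)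
  let ?n = "2 * order G - 1"
  have n: "Suc ?n = 2 * order G"
    using order_gt_0_iff_finite finite_G by simp
  have "s [^] (e ^ ?n) \<in> conj_class G s"
    unfolding pow_power[OF g] conj_class_iff using g by blast
  then show "iv e \<in> H" using T_pos by (simp add: H_def iv_def pow_mod)
  have "s [^] (e * iv e) = (s [^] iv e) [^] e" using s by (simp add: nat_pow_pow mult.commute)
  also have "\<dots> = s [^] (e ^ Suc ?n)" unfolding iv_def pow_mod using s by (simp add: nat_pow_pow mult.commute)
  also have "\<dots> = g [^] (2 * order G) \<otimes> s \<otimes> inv (g [^] (2 * order G))"
    unfolding n by (rule pow_power[OF g])
  also have "g [^] (2 * order G) = \<one>"
    using g pow_order_eq_1[OF g(1)] by (metis mult.commute nat_pow_one nat_pow_pow)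
  finally have "s [^] (e * iv e) = s [^] (1::nat)" using s by simp
  then show "int T dvd int (e * iv e) - 1" unfolding pow_eq_iff by simp
qed

text \<open>Write t = s^l = g s g^-1. Since l * \<open>iv l\<close> = 1 modulo T, s^e is the power e
  * \<open>iv l\<close> of t. Conjugating back by g turns it into the same power of s, which acts by
  a scalar.\<close>

lemma yd_action_H:
  assumes l: "l \<in> H"
  shows "yd_action G s \<rho> r (s [^] (e::nat)) (yd_elem (s [^] l) v) = yd_elem (s [^] l) (scale (q ^ (e * iv l)) v)"
proof -
  define t where "t = s [^] l"
  define g where "g = r t"
  have t: "t \<in> conj_class G s" using l by (simp add: H_def t_def)
  have g: "g \<in> carrier G" "t = g \<otimes> s \<otimes> inv g" using r[OF t] by (simp_all add: g_def)
  let ?h = "s [^] e"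
  have h: "?h \<in> carrier G" and tc: "t \<in> carrier G" using s by (simp_all add: t_def)
  have "?h \<otimes> t = t \<otimes> ?h" using s by (simp add: t_def nat_pow_mult add.commute)
  then have conj: "?h \<otimes> t \<otimes> inv ?h = t" using h tc by (simp add: m_assoc)
  have "int T dvd int e - int (l * (e * iv l))"
  proof -
    have "int e - int (l * (e * iv l)) = - (int e * (int (l * iv l) - 1))" by (simp add: algebra_simps)
    then show ?thesis using iv_H(2)[OF l] by (simp add: dvd_mult)
  qed
  then have "?h = t [^] (e * iv l)" unfolding t_def using s by (simp add: nat_pow_pow pow_eq_iff)
  also have "\<dots> = g \<otimes> s [^] (e * iv l) \<otimes> inv g" unfolding g(2) by (rule conj_pow[OF g(1) s])
  finally have "inv g \<otimes> ?h \<otimes> g = inv g \<otimes> (g \<otimes> s [^] (e * iv l) \<otimes> inv g) \<otimes> g" by simp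
  also have "\<dots> = (inv g \<otimes> g) \<otimes> s [^] (e * iv l) \<otimes> (inv g \<otimes> g)"
    using g(1) s by (simp only: m_assoc inv_closed m_closed nat_pow_closed)
  also have "\<dots> = s [^] (e * iv l)" using g(1) s by simp
  finally have "inv g \<otimes> ?h \<otimes> g = s [^] (e * iv l)" .
  then show ?thesis
    using yd_action_elem[OF h t, of v] unfolding conj t_def[symmetric] g_def[symmetric] by (simp add: \<rho>_s_pow)
qed

definition diag_Q :: "nat \<times> 'v \<Rightarrow> nat \<times> 'v \<Rightarrow> complex" where
  "diag_Q i k = q ^ (fst i * iv (fst k))"

lemma yd_scale_elem: "yd_scale scale a (yd_elem t v) = yd_elem t (scale a v)"
  by (auto simp: yd_scale_def yd_elem_def fun_eq_iff)

text \<open>A vector supported at s^u meets only the summand t = s^u of the coaction. All other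
  summands are words whose second letter is 0, as the locale allows.\<close>

lemma diagonal_part:
  assumes B: "independent B" "span B = UNIV" and S: "S \<subseteq> B"
  shows "diagonal_part (yd_scale scale) (yd_space G s) (yd_braiding G s \<rho> r) (H \<times> S)
    (\<lambda>i. yd_elem (s [^] fst i) (snd i)) (\<lambda>i f. representation B (f (s [^] fst i)) (snd i)) diag_Q"
proof
  fix i :: "nat \<times> 'v" and y z :: "'g \<Rightarrow> 'v"
  show "representation B ((y + z) (s [^] fst i)) (snd i)
     = representation B (y (s [^] fst i)) (snd i) + representation B (z (s [^] fst i)) (snd i)"
    using B by (simp add: representation_add)
  show "representation B (yd_scale scale a y (s [^] fst i)) (snd i) = a * representation B (y (s [^] fst i)) (snd i)" for a
    using B by (simp add: yd_scale_def representation_scale)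
  show "yd_scale scale 1 y = y" by (simp add: yd_scale_def)
  fix v
  show "length v = 2" if "v \<in> Poly_Mapping.keys (yd_braiding G s \<rho> r y z)"
    using that subsetD[OF keys_sum_word] unfolding yd_braiding_def by fastforce
  show "0 \<in> set v" if yz: "y = 0 \<or> z = 0" and v: "v \<in> Poly_Mapping.keys (yd_braiding G s \<rho> r y z)"
  proof -
    obtain t where t: "t \<in> conj_class G s" "v = [yd_action G s \<rho> r t z, yd_elem t (y t)]"
      using v subsetD[OF keys_sum_word] unfolding yd_braiding_def by fastforce
    then show ?thesis
      using yz yd_action_zero[OF conj_class_carrier[OF t(1)]] yd_elem_zero[of t] by auto
  qed
next
  fix i k :: "nat \<times> 'v" assume i: "i \<in> H \<times> S" and k: "k \<in> H \<times> S"
  have eq: "s [^] fst i = s [^] fst k \<longleftrightarrow> fst i = fst k"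
  proof
    assume "s [^] fst i = s [^] fst k"
    then have "fst i mod T = fst k mod T" by (metis pow_eq_iff mod_eq_dvd_iff of_nat_eq_iff zmod_int)
    then show "fst i = fst k" using i k by (auto simp: H_def)
  qed simp
  show "representation B (yd_elem (s [^] fst k) (snd k) (s [^] fst i)) (snd i) = (if i = k then 1 else 0)"
    using i k S B(1) eq
    by (auto simp: yd_elem_def representation_basis representation_zero prod_eq_iff subset_iff)
  fix a b
  let ?t = "s [^] fst i"
  let ?y = "yd_scale scale b (yd_elem (s [^] fst k) (snd k))"
  define R where "R = (\<Sum>t\<in>conj_class G s - {?t}. word [yd_action G s \<rho> r t ?y, yd_elem t (yd_elem ?t (scale a (snd i)) t)])"
  have "yd_braiding G s \<rho> r (yd_scale scale a (yd_elem ?t (snd i))) ?y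
      = word [yd_action G s \<rho> r ?t ?y, yd_elem ?t (yd_elem ?t (scale a (snd i)) ?t)] + R"
    unfolding yd_braiding_def yd_scale_elem R_def using i
    by (intro sum.remove finite_conj_class) (auto simp: H_def)
  also have "yd_action G s \<rho> r ?t ?y = yd_scale scale (diag_Q i k * b) (yd_elem (s [^] fst k) (snd k))"
    using k by (auto simp: yd_scale_elem yd_action_H diag_Q_def)
  also have "yd_elem ?t (yd_elem ?t (scale a (snd i)) ?t) = yd_scale scale a (yd_elem ?t (snd i))"
    by (simp add: yd_scale_elem) (simp add: yd_elem_def)
  finally have 1: "yd_braiding G s \<rho> r (yd_scale scale a (yd_elem ?t (snd i))) ?y
      = word [yd_scale scale (diag_Q i k * b) (yd_elem (s [^] fst k) (snd k)), yd_scale scale a (yd_elem ?t (snd i))] + R" .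
  have "length v = 2 \<and> 0 \<in> set v" if v: "v \<in> Poly_Mapping.keys R" for v
  proof -
    obtain t where "t \<noteq> ?t" "v = [yd_action G s \<rho> r t ?y, yd_elem t (yd_elem ?t (scale a (snd i)) t)]"
      using v subsetD[OF keys_sum_word] unfolding R_def by fastforce
    moreover from this have "yd_elem t (yd_elem ?t (scale a (snd i)) t) = 0"
      by (simp add: yd_elem_def[of ?t] yd_elem_zero)
    ultimately show ?thesis by simp
  qed
  then show "\<exists>R. yd_braiding G s \<rho> r (yd_scale scale a (yd_elem ?t (snd i))) ?y
      = word [yd_scale scale (diag_Q i k * b) (yd_elem (s [^] fst k) (snd k)), yd_scale scale a (yd_elem ?t (snd i))] + R
        \<and> (\<forall>v\<in>Poly_Mapping.keys R. length v = 2 \<and> 0 \<in> set v)"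
    using 1 by blast
next
  fix i :: "nat \<times> 'v" assume "i \<in> H \<times> S"
  then show "yd_elem (s [^] fst i) (snd i) \<in> yd_space G s"
    by (auto simp: yd_space_def yd_elem_def H_def)
qed

lemma q_power_cong:
  assumes "int T dvd int m - int n" shows "q ^ m = q ^ n"
proof -
  have "q ^ k = q ^ (k mod T)" for k
  proof -
    have "q ^ k = q ^ (T * (k div T) + k mod T)" by simp
    also have "\<dots> = q ^ (k mod T)" unfolding power_add power_mult q_order by simp
    finally show ?thesis .
  qed
  moreover have "m mod T = n mod T" using assms by (metis mod_eq_dvd_iff of_nat_eq_iff zmod_int)
  ultimately show ?thesis by metis
qed

lemma norm_q: "norm q = 1"
  using power_eq_imp_eq_base[of "norm q" T 1] T_pos q_order by (simp flip: norm_power)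

lemma diag_Q_self: "i \<in> H \<times> S \<Longrightarrow> diag_Q i i = q"
  using q_power_cong[of "fst i * iv (fst i)" 1] iv_H(2)[of "fst i"] by (auto simp: diag_Q_def)

text \<open>N is the order of q: large values contradict the row sum criterion, and q = 1
  contradicts the rank one coefficients. S is a finite part of a basis, so that two vectors can be
  selected to exclude N = 3.\<close>

theorem order_constraint:
  assumes fin: "nichols_finite_dim (yd_scale scale) (yd_space G s) (yd_braiding G s \<rho> r)"
    and B: "independent B" "span B = UNIV" and S: "S \<subseteq> B" "finite S" "S \<noteq> {}"
    and j: "j \<in> H" "\<not> int T dvd int j - 1"
  obtains N where "2 \<le> N" "N < 4" "N = 3 \<longrightarrow> card S < 2" "q ^ N = 1" "N dvd T" "q \<noteq> 1"
proof -
  interpret dp: diagonal_part "yd_scale scale" "yd_space G s" "yd_braiding G s \<rho> r" "H \<times> S"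
    "\<lambda>i. yd_elem (s [^] fst i) (snd i)" "\<lambda>i f. representation B (f (s [^] fst i)) (snd i)" diag_Q
    by (rule diagonal_part[OF B S(1)])
  obtain D where D: "\<And>u w. set u \<subseteq> H \<times> S \<Longrightarrow> D < length u \<Longrightarrow> lshuffle diag_Q u w = 0"
    by (rule dp.lshuffle_eq_zero[OF fin]) blast
  obtain v where v: "v \<in> S" using S(3) by blast
  have q1: "q \<noteq> 1"
  \<comment> \<open>For q = 1 the coefficient at a constant word of length D + 1 is the factorial of
    D + 1.\<close>
  proof
    assume q: "q = 1"
    have "lshuffle diag_Q (replicate (Suc D) (j, v)) (replicate (Suc D) (j, v)) = 0"
      using j(1) v by (intro D) auto
    then have "(\<Prod>r<Suc D. q_nat q (Suc r)) = 0"
      unfolding lshuffle_replicate using diag_Q_self[of "(j, v)" S] j(1) v by simp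
    moreover have "q_nat q (Suc r) = of_nat (Suc r)" for r
      unfolding q_nat_def q by simp
    ultimately show False by (simp del: of_nat_Suc)
  qed
  define N where "N = (LEAST n. 0 < n \<and> q ^ n = 1)"
  have N: "0 < N" "q ^ N = 1"
    using LeastI[of "\<lambda>n. 0 < n \<and> q ^ n = 1" T] T_pos q_order by (auto simp: N_def)
  have least: "q ^ n \<noteq> 1" if "0 < n" "n < N" for n
    using not_less_Least[of n "\<lambda>n. 0 < n \<and> q ^ n = 1"] that by (auto simp: N_def)
  have "N \<noteq> 1" using N(2) q1 by auto
  then have N2: "2 \<le> N" using N(1) by simp
  have NT: "N dvd T"
  proof -
    have "q ^ T = (q ^ N) ^ (T div N) * q ^ (T mod N)"
      by (simp flip: power_mult power_add)
    then have "q ^ (T mod N) = 1" using N(2) q_order by simp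
    then have "T mod N = 0" using least[of "T mod N"] N(1) by (cases "T mod N = 0") auto
    then show ?thesis by (simp add: dvd_eq_mod_eq_0)
  qed
  have "\<not> (4 \<le> N \<or> N = 3 \<and> 2 \<le> card S)"
  proof
    assume large: "4 \<le> N \<or> N = 3 \<and> 2 \<le> card S"
    have fin_H: "finite H" by (simp add: H_def)
    interpret diag "H \<times> S" diag_Q q N "cartan_number N iv"
    proof
      show "finite (H \<times> S)" using fin_H S(2) by simp
      show "H \<times> S \<noteq> {}" using j(1) v by blast
      show "norm (diag_Q i k) = 1" for i k by (simp add: diag_Q_def norm_power norm_q)
      show "diag_Q i i = q" if "i \<in> H \<times> S" for i by (rule diag_Q_self[OF that])
      show "diag_Q i k * diag_Q k i * q ^ cartan_number N iv i k = 1" for i k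
      proof -
        let ?n = "fst i * iv (fst k) + fst k * iv (fst i)"
        have "int N dvd int (?n + cartan_number N iv i k)"
          using dvd_add_neg_mod[OF N(1), of "int ?n"] by (simp add: cartan_number_def)
        then obtain d where "?n + cartan_number N iv i k = N * d" by (metis dvdE int_dvd_int_iff)
        moreover have "diag_Q i k * diag_Q k i * q ^ cartan_number N iv i k = q ^ (?n + cartan_number N iv i k)"
          by (simp add: diag_Q_def power_add)
        ultimately show ?thesis using N(2) by (simp add: power_mult)
      qed
      show "cartan_number N iv i k = cartan_number N iv k i" for i k
        by (simp add: cartan_number_def add.commute)
      show "cartan_number N iv i k < N" for i k
        unfolding cartan_number_def by (rule neg_mod_less[OF N(1)])
    qed (use N least N2 in auto)
    have "\<exists>u w. set u \<subseteq> H \<times> S \<and> D < length u \<and> lshuffle diag_Q u w \<noteq> 0"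
    proof (rule lshuffle_nonzero)
      fix i assume "i \<in> H \<times> S"
      then show "2 \<le> (\<Sum>k\<in>H \<times> S - {i}. cartan_number N iv i k)"
        by (intro cartan_row_sum[OF NT fin_H _ H_mult iv_H j S(2) large]) (auto simp: H_def)
    qed
    then show False using D by blast
  qed
  then show thesis using that[of N] N2 N(2) NT q1 by auto
qed

end

theorem lemma1p9:
  fixes G :: "('g, 'b) monoid_scheme"
    and s :: 'g
    and scale :: "complex \<Rightarrow> 'v::ab_group_add \<Rightarrow> 'v"
    and \<rho> :: "'g \<Rightarrow> 'v \<Rightarrow> 'v"
    and r :: "'g \<Rightarrow> 'g"
    and j :: int
  assumes "group G" and "finite (carrier G)" and "s \<in> carrier G"
    and "irreducible_rep (G\<lparr>carrier := centralizer G s\<rparr>) scale \<rho>"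
    and "\<And>t. t \<in> conj_class G s \<Longrightarrow> r t \<in> carrier G \<and> r t \<otimes>\<^bsub>G\<^esub> s \<otimes>\<^bsub>G\<^esub> inv\<^bsub>G\<^esub> (r t) = t"
    and "nichols_finite_dim (yd_scale scale) (yd_space G s) (yd_braiding G s \<rho> r)"
    and "s [^]\<^bsub>G\<^esub> j \<noteq> s" and "s [^]\<^bsub>G\<^esub> j \<in> conj_class G s"
  shows "(vector_space.dim scale (UNIV :: 'v set) > 1 \<longrightarrow>
            even (group.ord G s) \<and> q_scalar scale \<rho> s = -1)
       \<and> (vector_space.dim scale (UNIV :: 'v set) = 1 \<longrightarrow>
            (even (group.ord G s) \<and> q_scalar scale \<rho> s = -1)
            \<or> q_scalar scale \<rho> s \<in> {z. z ^ 3 = 1} - {1})"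
proof -
  have vs: "vector_space scale" using assms(4) by (simp add: irreducible_rep_def)
  interpret yd_setting G scale s \<rho> r
    by (intro yd_setting.intro complex_vector_space.intro yd_setting_axioms.intro vs assms(1-5))
  \<comment> \<open>The given exponent is an integer and may be negative; elements of
    \<open>H\<close> are residues in [0, T).\<close>
  define k where "k = nat (j mod int T)"
  have k: "int k = j mod int T" using T_pos by (simp add: k_def)
  have "int T dvd j - int k" unfolding k by (simp add: mod_eq_dvd_iff[symmetric])
  then have sk: "s [^]\<^bsub>G\<^esub> k = s [^]\<^bsub>G\<^esub> j" using int_pow_eq[OF s, of "int k" j] by (simp add: int_pow_int)
  have "int k < int T" unfolding k using T_pos by simp
  then have kH: "k \<in> H" using assms(8) sk by (simp add: H_def)
  have k1: "\<not> int T dvd int k - 1"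
  proof
    assume "int T dvd int k - 1"
    then have "s [^]\<^bsub>G\<^esub> k = s [^]\<^bsub>G\<^esub> (1::nat)" unfolding pow_eq_iff by simp
    then show False using assms(7) sk s by simp
  qed
  obtain B where B: "independent B" "UNIV \<subseteq> span B" "card B = dim UNIV"
    by (rule basis_exists[of UNIV])
  have span: "span B = UNIV" using B(2) by blast
  \<comment> \<open>From q^2 = 1 and q different from 1 follows q = -1, and N = 2 divides the order
    of s.\<close>
  have two: "even T \<and> q = - 1" if N: "N = 2" "q ^ N = 1" "N dvd T" "q \<noteq> 1" for N
  proof -
    have "q = 1 \<or> q = - 1" using N(1,2) by (simp add: power2_eq_1_iff)
    then show ?thesis using N by simp
  qed
  have "even T \<and> q = - 1" if dim: "1 < dim UNIV"
  proof -
    \<comment> \<open>Two basis vectors already rule out N = 3.\<close>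
    obtain S where S: "S \<subseteq> B" "card S = 2" "finite S"
      using obtain_subset_with_card_n[of 2 B] dim B(3) by auto
    obtain N where "2 \<le> N" "N < 4" "N = 3 \<longrightarrow> card S < 2" "q ^ N = 1" "N dvd T" "q \<noteq> 1"
      by (rule order_constraint[OF assms(6) B(1) span S(1,3) _ kH k1]) (use S(2) in auto)
    then show ?thesis using two[of N] S(2) by force
  qed
  moreover have "(even T \<and> q = - 1) \<or> q \<in> {z. z ^ 3 = 1} - {1}" if dim: "dim UNIV = 1"
  proof -
    have S: "finite B" "B \<noteq> {}" using B(3) dim card_gt_0_iff[of B] by auto
    obtain N where N: "2 \<le> N" "N < 4" "q ^ N = 1" "N dvd T" "q \<noteq> 1"
      by (rule order_constraint[OF assms(6) B(1) span subset_refl S kH k1]) auto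
    then have "N = 2 \<or> N = 3" by auto
    then show ?thesis using two[of N] N by auto
  qed
  ultimately show ?thesis unfolding q_def by blast
qed

end
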